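(* For each closed $P$-pair $(X,A)\in\mathcal{K}^2_{Top}$ and abelian group $G$ there is an isomorphism $$\bar H^*_N(X,A;G)\simeq\check H^*_N(X,A;G),$$ where $\bar H^*_N$ is the Alexander-Spanier normal cohomology and $\check H^*_N$ is the Alexandroff-Čech cohomology based on all normal coverings.
   Context: A normal covering of a space $X$ is an open covering $\alpha=\{U_\alpha\}$ admitting a partition of unity $\{\varphi_{U_\alpha}\}$ subordinated to it: continuous $\varphi_{U_\alpha}\ge 0$, $\sum\varphi_{U_\alpha}=1$, $\{x:\varphi_{U_\alpha}(x)>0\}\subset U_\alpha$. A subspace $A\subset X$ is $P$-embedded if every normal covering $\beta$ of $A$ is refined by $\alpha|_A=\{U_\alpha\cap A: U_\alpha\in\alpha\}$ for some normal covering $\alpha$ of $X$. A closed $P$-pair is a pair $(X,A)$ with $A$ closed and $P$-embedded in $X$; $\mathcal{K}^2_{Top}$ is the category of closed $P$-pairs. Alexander-Spanier normal cohomology: let $C^n(X;G)$ be the group of all functions $X^{n+1}\to G$ with $\delta\varphi(x_0,\dots,x_{n+1})=\sum_i(-1)^i\varphi(x_0,\dots,\hat x_i,\dots,x_{n+1})$. For a normal covering $\alpha$ put $\alpha^{n+1}=\bigcup_{U\in\alpha}U^{n+1}$; $\varphi$ is $N$-locally zero if it vanishes on $\alpha^{n+1}$ for some normal covering $\alpha$ of $X$. Let $C^*_N(X;G)$ be the subcomplex of $N$-locally zero functions, $\bar C^*_N(X;G)=C^*(X;G)/C^*_N(X;G)$, $\bar C^*_N(X,A;G)=\ker(\bar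 C^*_N(X;G)\to\bar C^*_N(A;G))$ (restriction), and $\bar H^*_N(X,A;G)$ its cohomology. Alexandroff-Čech cohomology based on all normal coverings: $\check H^n_N(X,A;G)=\varinjlim H^n(N(\alpha),N(\alpha|_A);G)$, the direct limit over all normal coverings $\alpha$ of $X$ ordered by refinement, where $N(\alpha)$ is the nerve of $\alpha$ and $N(\alpha|_A)$ is its subcomplex of those simplexes whose vertices have an intersection meeting $A$. (For closed $P$-pairs this is the limit over the normal coverings of the pair.) *)

theory Defs
  imports "HOL-Analysis.Analysis" "HOL-Algebra.Product_Groups" "HOL-Algebra.FiniteProduct"
begin

section \<open>Normal coverings and closed P-pairs\<close>

text \<open>Coverings are sets of open sets. The family is required to be nonempty; this is automatic
  over a nonempty space, and over the empty space it only discards the empty family, in favour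
  of the covering by the empty set. Without this, the empty subspace of a nonempty space would
  fail to be P-embedded, as no covering of a nonempty space restricts to a refinement of the
  empty family.\<close>

definition open_covering :: "'a topology \<Rightarrow> 'a set set \<Rightarrow> bool" where
  "open_covering X \<alpha> \<longleftrightarrow> \<alpha> \<noteq> {} \<and> (\<forall>U\<in>\<alpha>. openin X U) \<and> \<Union>\<alpha> = topspace X"

text \<open>Local finiteness is not part of the definition; the sum is the unordered
  pointwise one.\<close>

definition subordinated_partition_of_unity ::
    "'a topology \<Rightarrow> 'a set set \<Rightarrow> ('a set \<Rightarrow> 'a \<Rightarrow> real) \<Rightarrow> bool" where
  "subordinated_partition_of_unity X \<alpha> \<phi> \<longleftrightarrow>
     (\<forall>U\<in>\<alpha>. continuous_map X euclideanreal (\<phi> U) \<and>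
            (\<forall>x\<in>topspace X. 0 \<le> \<phi> U x) \<and>
            {x \<in> topspace X. 0 < \<phi> U x} \<subseteq> U) \<and>
     (\<forall>x\<in>topspace X. ((\<lambda>U. \<phi> U x) has_sum 1) \<alpha>)"

definition normal_covering :: "'a topology \<Rightarrow> 'a set set \<Rightarrow> bool" where
  "normal_covering X \<alpha> \<longleftrightarrow>
     open_covering X \<alpha> \<and> (\<exists>\<phi>. subordinated_partition_of_unity X \<alpha> \<phi>)"

definition refinement_of :: "'a set set \<Rightarrow> 'a set set \<Rightarrow> bool" where
  "refinement_of \<beta> \<alpha> \<longleftrightarrow> (\<forall>V\<in>\<beta>. \<exists>U\<in>\<alpha>. V \<subseteq> U)"

definition restrict_covering :: "'a set set \<Rightarrow> 'a set \<Rightarrow> 'a set set" where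
  "restrict_covering \<alpha> A = (\<lambda>U. U \<inter> A) ` \<alpha>"

definition P_embedded :: "'a topology \<Rightarrow> 'a set \<Rightarrow> bool" where
  "P_embedded X A \<longleftrightarrow> A \<subseteq> topspace X \<and>
     (\<forall>\<beta>. normal_covering (subtopology X A) \<beta> \<longrightarrow>
        (\<exists>\<alpha>. normal_covering X \<alpha> \<and> refinement_of (restrict_covering \<alpha> A) \<beta>))"

definition closed_P_pair :: "'a topology \<Rightarrow> 'a set \<Rightarrow> bool" where
  "closed_P_pair X A \<longleftrightarrow> closedin X A \<and> P_embedded X A"


section \<open>Cochain complexes and direct limits of groups\<close>

text \<open>The map between quotient groups induced by \<open>f\<close>, where \<open>K\<close> is a subgroup of the target
  \<open>H\<close>. When \<open>f\<close> is a homomorphism compatible with the subgroups, all the cosets in the union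
  coincide.\<close>

definition induced_on_cosets ::
    "('b, 'm) monoid_scheme \<Rightarrow> 'b set \<Rightarrow> ('a \<Rightarrow> 'b) \<Rightarrow> 'a set \<Rightarrow> 'b set" where
  "induced_on_cosets H K f c = (\<Union>x\<in>c. K #>\<^bsub>H\<^esub> f x)"

definition cocycles ::
    "(nat \<Rightarrow> ('a, 'm) monoid_scheme) \<Rightarrow> (nat \<Rightarrow> 'a \<Rightarrow> 'a) \<Rightarrow> nat \<Rightarrow> 'a set" where
  "cocycles C d n = kernel (C n) (C (Suc n)) (d n)"

definition coboundaries ::
    "(nat \<Rightarrow> ('a, 'm) monoid_scheme) \<Rightarrow> (nat \<Rightarrow> 'a \<Rightarrow> 'a) \<Rightarrow> nat \<Rightarrow> 'a set" where
  "coboundaries C d n =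
     (case n of 0 \<Rightarrow> {\<one>\<^bsub>C 0\<^esub>} | Suc m \<Rightarrow> d m ` carrier (C m))"

definition cohomology_group ::
    "(nat \<Rightarrow> ('a, 'm) monoid_scheme) \<Rightarrow> (nat \<Rightarrow> 'a \<Rightarrow> 'a) \<Rightarrow> nat \<Rightarrow> 'a set monoid" where
  "cohomology_group C d n = (C n)\<lparr>carrier := cocycles C d n\<rparr> Mod coboundaries C d n"

text \<open>Direct limit of the groups \<open>H i\<close> along the bonding homomorphisms \<open>f i j\<close> from \<open>H i\<close> to
  \<open>H j\<close> for \<open>before i j\<close>, the index set \<open>I\<close> being directed by \<open>before\<close>: the disjoint union modulo
  eventual equality. In the product and the unit, the union is over representatives of one and
  the same class.\<close>

definition limit_rel ::
    "'i set \<Rightarrow> ('i \<Rightarrow> 'i \<Rightarrow> bool) \<Rightarrow> ('i \<Rightarrow> ('a, 'm) monoid_scheme) \<Rightarrow>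
     ('i \<Rightarrow> 'i \<Rightarrow> 'a \<Rightarrow> 'a) \<Rightarrow> (('i \<times> 'a) \<times> ('i \<times> 'a)) set" where
  "limit_rel I before H f =
     {((i, x), (j, y)). i \<in> I \<and> x \<in> carrier (H i) \<and> j \<in> I \<and> y \<in> carrier (H j) \<and>
        (\<exists>k\<in>I. before i k \<and> before j k \<and> f i k x = f j k y)}"

definition direct_limit ::
    "'i set \<Rightarrow> ('i \<Rightarrow> 'i \<Rightarrow> bool) \<Rightarrow> ('i \<Rightarrow> ('a, 'm) monoid_scheme) \<Rightarrow>
     ('i \<Rightarrow> 'i \<Rightarrow> 'a \<Rightarrow> 'a) \<Rightarrow> ('i \<times> 'a) set monoid" where
  "direct_limit I before H f =
     \<lparr>carrier = (SIGMA i:I. carrier (H i)) // limit_rel I before H f,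
      monoid.mult = (\<lambda>P Q. \<Union>{limit_rel I before H f `` {(k, f i k x \<otimes>\<^bsub>H k\<^esub> f j k y)} |i x j y k.
                       (i, x) \<in> P \<and> (j, y) \<in> Q \<and> k \<in> I \<and> before i k \<and> before j k}),
      one = (\<Union>i\<in>I. limit_rel I before H f `` {(i, \<one>\<^bsub>H i\<^esub>)})\<rparr>"


section \<open>The coboundary formula\<close>

text \<open>An \<open>n\<close>-cochain is a function on a set \<open>T\<close> of \<open>(n+1)\<close>-tuples, given as lists, with values in
  the group \<open>G\<close>, which is written multiplicatively; \<open>coboundary G T\<close> produces a cochain on the set
  \<open>T\<close> of \<open>(n+2)\<close>-tuples.\<close>

definition face :: "nat \<Rightarrow> 'a list \<Rightarrow> 'a list" where
  "face i xs = take i xs @ drop (Suc i) xs"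

definition coboundary ::
    "('g, 'm) monoid_scheme \<Rightarrow> 'a list set \<Rightarrow> ('a list \<Rightarrow> 'g) \<Rightarrow> 'a list \<Rightarrow> 'g" where
  "coboundary G T \<phi> =
     (\<lambda>xs\<in>T. finprod G (\<lambda>i. \<phi> (face i xs) [^]\<^bsub>G\<^esub> ((- 1) ^ i :: int)) {..<length xs})"


section \<open>Alexander-Spanier normal cohomology\<close>

definition tuples :: "nat \<Rightarrow> 'a set \<Rightarrow> 'a list set" where
  "tuples n S = {xs. length xs = Suc n \<and> set xs \<subseteq> S}"

definition AS_cochains ::
    "'a topology \<Rightarrow> ('g, 'm) monoid_scheme \<Rightarrow> nat \<Rightarrow> ('a list \<Rightarrow> 'g) monoid" where
  "AS_cochains X G n = product_group (tuples n (topspace X)) (\<lambda>_. G)"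

definition AS_coboundary ::
    "'a topology \<Rightarrow> ('g, 'm) monoid_scheme \<Rightarrow> nat \<Rightarrow> ('a list \<Rightarrow> 'g) \<Rightarrow> 'a list \<Rightarrow> 'g" where
  "AS_coboundary X G n = coboundary G (tuples (Suc n) (topspace X))"

definition N_locally_zero ::
    "'a topology \<Rightarrow> ('g, 'm) monoid_scheme \<Rightarrow> nat \<Rightarrow> ('a list \<Rightarrow> 'g) set" where
  "N_locally_zero X G n =
     {\<phi> \<in> carrier (AS_cochains X G n).
        \<exists>\<alpha>. normal_covering X \<alpha> \<and> (\<forall>xs \<in> (\<Union>U\<in>\<alpha>. tuples n U). \<phi> xs = \<one>\<^bsub>G\<^esub>)}"

definition ASN_cochains ::
    "'a topology \<Rightarrow> ('g, 'm) monoid_scheme \<Rightarrow> nat \<Rightarrow> ('a list \<Rightarrow> 'g) set monoid" where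
  "ASN_cochains X G n = AS_cochains X G n Mod N_locally_zero X G n"

definition ASN_coboundary ::
    "'a topology \<Rightarrow> ('g, 'm) monoid_scheme \<Rightarrow> nat \<Rightarrow>
     ('a list \<Rightarrow> 'g) set \<Rightarrow> ('a list \<Rightarrow> 'g) set" where
  "ASN_coboundary X G n =
     induced_on_cosets (AS_cochains X G (Suc n)) (N_locally_zero X G (Suc n)) (AS_coboundary X G n)"

definition ASN_restriction ::
    "'a topology \<Rightarrow> 'a set \<Rightarrow> ('g, 'm) monoid_scheme \<Rightarrow> nat \<Rightarrow>
     ('a list \<Rightarrow> 'g) set \<Rightarrow> ('a list \<Rightarrow> 'g) set" where
  "ASN_restriction X A G n =
     induced_on_cosets (AS_cochains (subtopology X A) G n) (N_locally_zero (subtopology X A) G n)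
       (\<lambda>\<phi>. restrict \<phi> (tuples n (topspace (subtopology X A))))"

definition ASN_relative_cochains ::
    "'a topology \<Rightarrow> 'a set \<Rightarrow> ('g, 'm) monoid_scheme \<Rightarrow> nat \<Rightarrow> ('a list \<Rightarrow> 'g) set monoid" where
  "ASN_relative_cochains X A G n =
     (ASN_cochains X G n)
       \<lparr>carrier := kernel (ASN_cochains X G n) (ASN_cochains (subtopology X A) G n)
                    (ASN_restriction X A G n)\<rparr>"

definition alexander_spanier_normal_cohomology ::
    "nat \<Rightarrow> 'a topology \<Rightarrow> 'a set \<Rightarrow> ('g, 'm) monoid_scheme \<Rightarrow>
     ('a list \<Rightarrow> 'g) set set monoid" where
  "alexander_spanier_normal_cohomology n X A G =
     cohomology_group (ASN_relative_cochains X A G) (ASN_coboundary X G) n"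


section \<open>Simplicial cohomology of a pair\<close>

text \<open>A simplicial complex is given by the set \<open>K\<close> of its simplexes (finite nonempty sets of
  vertices). Its cohomology is that of the ordered cochain complex: an \<open>n\<close>-cochain is an arbitrary
  function on the \<open>(n+1)\<close>-tuples of vertices, repetitions allowed, that span a simplex.\<close>

definition ordered_simplexes :: "nat \<Rightarrow> 'v set set \<Rightarrow> 'v list set" where
  "ordered_simplexes n K = {vs. length vs = Suc n \<and> set vs \<in> K}"

definition simplicial_cochains ::
    "'v set set \<Rightarrow> ('g, 'm) monoid_scheme \<Rightarrow> nat \<Rightarrow> ('v list \<Rightarrow> 'g) monoid" where
  "simplicial_cochains K G n = product_group (ordered_simplexes n K) (\<lambda>_. G)"

definition simplicial_relative_cochains ::
    "'v set set \<Rightarrow> 'v set set \<Rightarrow> ('g, 'm) monoid_scheme \<Rightarrow> nat \<Rightarrow> ('v list \<Rightarrow> 'g) monoid" where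
  "simplicial_relative_cochains K L G n =
     (simplicial_cochains K G n)
       \<lparr>carrier := kernel (simplicial_cochains K G n) (simplicial_cochains L G n)
                    (\<lambda>\<phi>. restrict \<phi> (ordered_simplexes n L))\<rparr>"

definition simplicial_coboundary ::
    "'v set set \<Rightarrow> ('g, 'm) monoid_scheme \<Rightarrow> nat \<Rightarrow> ('v list \<Rightarrow> 'g) \<Rightarrow> 'v list \<Rightarrow> 'g" where
  "simplicial_coboundary K G n = coboundary G (ordered_simplexes (Suc n) K)"

definition simplicial_cohomology ::
    "nat \<Rightarrow> 'v set set \<Rightarrow> 'v set set \<Rightarrow> ('g, 'm) monoid_scheme \<Rightarrow> ('v list \<Rightarrow> 'g) set monoid" where
  "simplicial_cohomology n K L G =
     cohomology_group (simplicial_relative_cochains K L G) (simplicial_coboundary K G) n"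

text \<open>The homomorphism from the cohomology of \<open>(K, L)\<close> to that of \<open>(K', L')\<close> induced by a vertex
  map \<open>p\<close> that is simplicial from \<open>(K', L')\<close> to \<open>(K, L)\<close>.\<close>

definition simplicial_cohomology_map ::
    "nat \<Rightarrow> 'w set set \<Rightarrow> 'w set set \<Rightarrow> ('g, 'm) monoid_scheme \<Rightarrow> ('w \<Rightarrow> 'v) \<Rightarrow>
     ('v list \<Rightarrow> 'g) set \<Rightarrow> ('w list \<Rightarrow> 'g) set" where
  "simplicial_cohomology_map n K' L' G p =
     induced_on_cosets (simplicial_relative_cochains K' L' G n)
       (coboundaries (simplicial_relative_cochains K' L' G) (simplicial_coboundary K' G) n)
       (\<lambda>\<phi>. \<lambda>vs\<in>ordered_simplexes n K'. \<phi> (map p vs))"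


section \<open>Alexandroff-Cech cohomology based on all normal coverings\<close>

definition nerve :: "'a set set \<Rightarrow> 'a set set set" where
  "nerve \<alpha> = {\<sigma>. finite \<sigma> \<and> \<sigma> \<noteq> {} \<and> \<sigma> \<subseteq> \<alpha> \<and> \<Inter>\<sigma> \<noteq> {}}"

definition nerve_meeting :: "'a set set \<Rightarrow> 'a set \<Rightarrow> 'a set set set" where
  "nerve_meeting \<alpha> A = {\<sigma> \<in> nerve \<alpha>. \<Inter>\<sigma> \<inter> A \<noteq> {}}"

definition projection :: "'a set set \<Rightarrow> 'a set \<Rightarrow> 'a set" where
  "projection \<alpha> V = (SOME U. U \<in> \<alpha> \<and> V \<subseteq> U)"

text \<open>The bonding map for a refinement \<open>\<beta>\<close> of \<open>\<alpha>\<close>. Any two projections are contiguous, so the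
  choice made in \<open>projection\<close> does not matter in cohomology.\<close>

definition cech_bonding ::
    "nat \<Rightarrow> 'a set \<Rightarrow> ('g, 'm) monoid_scheme \<Rightarrow> 'a set set \<Rightarrow> 'a set set \<Rightarrow>
     ('a set list \<Rightarrow> 'g) set \<Rightarrow> ('a set list \<Rightarrow> 'g) set" where
  "cech_bonding n A G \<alpha> \<beta> =
     simplicial_cohomology_map n (nerve \<beta>) (nerve_meeting \<beta> A) G (projection \<alpha>)"

definition cech_normal_cohomology ::
    "nat \<Rightarrow> 'a topology \<Rightarrow> 'a set \<Rightarrow> ('g, 'm) monoid_scheme \<Rightarrow>
     ('a set set \<times> ('a set list \<Rightarrow> 'g) set) set monoid" where
  "cech_normal_cohomology n X A G =
     direct_limit {\<alpha>. normal_covering X \<alpha>} (\<lambda>\<alpha> \<beta>. refinement_of \<beta> \<alpha>)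
       (\<lambda>\<alpha>. simplicial_cohomology n (nerve \<alpha>) (nerve_meeting \<alpha> A) G)
       (cech_bonding n A G)"

end

theory Submission
  imports Defs
begin

text \<open>For a normal covering \<open>\<beta>\<close>, the tuples contained in some star \<open>star \<beta> z\<close> form a Vietoris-type complex,
  and the Alexander-Spanier normal cohomology is the direct limit of the cohomology of these complexes
  (relative to the tuples in \<open>A\<close>; this is where \<open>A\<close> has to be \<open>P\<close>-embedded). Every normal covering has a
  normal point-star refinement. Choosing a point in each member of a covering, in \<open>A\<close> if possible, maps
  the nerve of \<open>\<beta>\<close> to the Vietoris complex of \<open>\<beta>\<close>; choosing for each point a member of \<open>\<alpha>\<close> that contains its
  star in a point-star refinement of \<open>\<alpha>\<close> maps a Vietoris complex to the nerve of \<open>\<alpha>\<close>. After passing to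
  refinements, both composites are contiguous to the canonical projections, so the two direct systems
  have the same limit.\<close>

section \<open>Partitions of unity and point-star refinements\<close>

text \<open>Partitions of unity are only pointwise summable here, not locally finite, so continuity
  of infinite sums and suprema has to be earned: near each point finitely many functions carry all
  but an arbitrarily small part of the total mass 1. The point-star refinement is modelled on the
  open stars of the barycentric subdivision of the nerve, written directly in terms of the
  functions. Vietoris simplexes lie in stars rather than in members because points chosen in sets
  with a common point z are only known to lie in the star of z. No limit of Vietoris groups is
  formed: both cohomology groups are images of one set \<open>germ_cocycles\<close> of honest
  functions on tuples, and both identify two of these exactly when their quotient satisfies
  \<open>germ_coboundary\<close>; no map between quotients of quotients has to be written down.
  Finally, a covering may have the empty set as a member, and a point chosen in it is arbitrary;
  conditions on vertex maps are therefore imposed on nonempty members only, and only those are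
  vertices of a nerve.\<close>

lemma continuous_map_locally_approximable:
  fixes g :: "'a \<Rightarrow> real"
  assumes "\<And>x e. \<lbrakk>x \<in> topspace X; e > 0\<rbrakk> \<Longrightarrow>
    \<exists>N h. openin X N \<and> x \<in> N \<and> continuous_map X euclideanreal h \<and> (\<forall>y\<in>N. \<bar>g y - h y\<bar> \<le> e)"
  shows "continuous_map X euclideanreal g"
proof -
  \<comment> \<open>Only lower semicontinuity is argued; the hypothesis is symmetric under negation,
    so applying this to \<open>g\<close> and to \<open>- g\<close> gives continuity.\<close>
  have *: "openin X {x \<in> topspace X. a < k x}"
    if k: "\<And>x e. \<lbrakk>x \<in> topspace X; e > 0\<rbrakk> \<Longrightarrow>
      \<exists>N h. openin X N \<and> x \<in> N \<and> continuous_map X euclideanreal h \<and> (\<forall>y\<in>N. \<bar>k y - h y\<bar> \<le> e)" for a k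
  proof (subst openin_subopen, intro ballI)
    fix x assume x: "x \<in> {x \<in> topspace X. a < k x}"
    \<comment> \<open>One third is lost at x in passing from \<open>k\<close> to \<open>h\<close>
      and another at y in passing back; the threshold \<open>a + e\<close> for \<open>h\<close>
      leaves room for both.\<close>
    define e where "e = (k x - a) / 3"
    then have e: "0 < e" "k x = a + 3 * e" using x by auto
    then obtain N h where N: "openin X N" "x \<in> N" and h: "continuous_map X euclideanreal h"
      and le: "\<And>y. y \<in> N \<Longrightarrow> \<bar>k y - h y\<bar> \<le> e" using k[of x e] x by auto
    let ?T = "N \<inter> {y \<in> topspace X. a + e < h y}"
    have "openin X ?T"
      using N h by (intro openin_Int) (auto simp: continuous_map_upper_lower_semicontinuous_lt)
    moreover have "a + e < h x" using le[OF N(2)] e by linarith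
    moreover have "a < k y" if "y \<in> ?T" for y using le[of y] that by auto
    ultimately show "\<exists>T. openin X T \<and> x \<in> T \<and> T \<subseteq> {x \<in> topspace X. a < k x}"
      using N x by (intro exI[of _ ?T]) auto
  qed
  have "openin X {x \<in> topspace X. - a < - g x}" for a
  proof (rule *)
    fix x e assume "x \<in> topspace X" "(e::real) > 0"
    then obtain N h where N: "openin X N" "x \<in> N" and h: "continuous_map X euclideanreal h"
      and le: "\<forall>y\<in>N. \<bar>g y - h y\<bar> \<le> e" using assms by metis
    then show "\<exists>N h. openin X N \<and> x \<in> N \<and> continuous_map X euclideanreal h \<and> (\<forall>y\<in>N. \<bar>- g y - h y\<bar> \<le> e)"
      by (intro exI[of _ N] exI[of _ "\<lambda>x. - h x"]) (auto simp: abs_minus_commute)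
  qed
  with *[of g] assms show ?thesis
    by (simp add: continuous_map_upper_lower_semicontinuous_lt)
qed

text \<open>Coverings are sets, so an indexed family may give the same member several times; this
  regroups a sum over indices into one over members.\<close>

lemma has_sum_fibres:
  fixes g :: "'i \<Rightarrow> real"
  assumes "(g has_sum s) I"
  shows "((\<lambda>v. \<Sum>\<^sub>\<infinity>i\<in>{i\<in>I. h i = v}. g i) has_sum s) (h ` I)"
proof (rule has_sum_SigmaD[where f = "\<lambda>p. g (snd p)" and B = "\<lambda>v. {i\<in>I. h i = v}"])
  let ?S = "Sigma (h ` I) (\<lambda>v. {i\<in>I. h i = v})"
  have "bij_betw snd ?S I" by (rule bij_betwI[where g = "\<lambda>i. (h i, i)"]) auto
  from has_sum_reindex_bij_betw[OF this, of g s]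
  show "((\<lambda>p. g (snd p)) has_sum s) ?S" using assms by (rule iffD2)
  fix v
  have "g summable_on {i\<in>I. h i = v}"
    using has_sum_imp_summable[OF assms] by (rule summable_on_subset_banach) auto
  then show "((\<lambda>i. g (snd (v, i))) has_sum (\<Sum>\<^sub>\<infinity>i\<in>{i\<in>I. h i = v}. g i)) {i\<in>I. h i = v}"
    unfolding snd_conv by (rule has_sum_infsum)
qed

section \<open>Partitions of unity over an arbitrary index set\<close>

text \<open>Indices are kept apart from the sets carrying the functions: products are indexed by
  pairs of members and the barycentric functions by finite sets of indices.\<close>

locale indexed_partition_of_unity =
  fixes X :: "'a topology" and I :: "'i set" and f :: "'i \<Rightarrow> 'a \<Rightarrow> real"
  assumes continuous: "i \<in> I \<Longrightarrow> continuous_map X euclideanreal (f i)"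
    and nonneg: "i \<in> I \<Longrightarrow> x \<in> topspace X \<Longrightarrow> 0 \<le> f i x"
    and has_sum_1: "x \<in> topspace X \<Longrightarrow> ((\<lambda>i. f i x) has_sum 1) I"
begin

lemma summable: "x \<in> topspace X \<Longrightarrow> J \<subseteq> I \<Longrightarrow> (\<lambda>i. f i x) summable_on J"
  using has_sum_1 has_sum_imp_summable summable_on_subset_banach by blast

lemma sum_le_1: "x \<in> topspace X \<Longrightarrow> finite F \<Longrightarrow> F \<subseteq> I \<Longrightarrow> (\<Sum>i\<in>F. f i x) \<le> 1"
  by (rule finite_sum_le_has_sum[OF has_sum_1]) (auto intro: nonneg)

lemma le_1: "x \<in> topspace X \<Longrightarrow> i \<in> I \<Longrightarrow> f i x \<le> 1"
  using sum_le_1[of x "{i}"] by simp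

text \<open>The substitute for local finiteness: a finite partial sum close to 1 at x is continuous,
  hence stays close to 1 near x. As the total is 1, everything outside \<open>F\<close> is uniformly
  small there, both as a sum and termwise.\<close>

lemma locally_concentrated:
  assumes x: "x \<in> topspace X" and e: "e > 0"
  obtains F N where "finite F" "F \<subseteq> I" "openin X N" "x \<in> N" "\<And>y. y \<in> N \<Longrightarrow> (\<Sum>i\<in>F. f i y) > 1 - e"
proof -
  obtain F where F: "finite F" "F \<subseteq> I" "dist (\<Sum>i\<in>F. f i x) 1 \<le> e/2"
    using has_sum_finite_approximation[OF has_sum_1[OF x], of "e/2"] e by auto
  have "continuous_map X euclideanreal (\<lambda>y. \<Sum>i\<in>F. f i y)"
    using F continuous by (intro continuous_map_sum) auto
  then have "openin X {y \<in> topspace X. 1 - e < (\<Sum>i\<in>F. f i y)}"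
    by (auto simp: continuous_map_upper_lower_semicontinuous_lt)
  moreover have "1 - e < (\<Sum>i\<in>F. f i x)" using F(3) e unfolding dist_real_def by linarith
  ultimately show thesis using that[OF F(1,2)] x by auto
qed

lemma outside_small:
  assumes "y \<in> topspace X" "finite F" "F \<subseteq> I" "(\<Sum>i\<in>F. f i y) > 1 - e" "i \<in> I - F"
  shows "f i y < e"
  using sum_le_1[of y "insert i F"] assms by simp

text \<open>Near a point the finite sum over \<open>J \<inter> F\<close> is a continuous
  approximation, since the remaining terms are bounded by the part of the total mass outside
  \<open>F\<close>.\<close>

lemma continuous_infsum:
  assumes "J \<subseteq> I"
  shows "continuous_map X euclideanreal (\<lambda>x. \<Sum>\<^sub>\<infinity>i\<in>J. f i x)"
proof (rule continuous_map_locally_approximable)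
  fix x e assume "x \<in> topspace X" "(e::real) > 0"
  then obtain F N where F: "finite F" "F \<subseteq> I" and N: "openin X N" "x \<in> N"
    and gt: "\<And>y. y \<in> N \<Longrightarrow> (\<Sum>i\<in>F. f i y) > 1 - e" using locally_concentrated by metis
  have "\<bar>(\<Sum>\<^sub>\<infinity>i\<in>J. f i y) - (\<Sum>i\<in>J \<inter> F. f i y)\<bar> \<le> e" if "y \<in> N" for y
  proof -
    have y: "y \<in> topspace X" using N(1) openin_subset that by blast
    have S: "(\<lambda>i. f i y) summable_on K" if "K \<subseteq> I" for K using summable[OF y that] .
    have "(\<Sum>\<^sub>\<infinity>i\<in>J. f i y) = (\<Sum>\<^sub>\<infinity>i\<in>(J \<inter> F) \<union> (J - F). f i y)" by (simp add: Int_Diff_Un)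
    also have "\<dots> = (\<Sum>i\<in>J \<inter> F. f i y) + (\<Sum>\<^sub>\<infinity>i\<in>J - F. f i y)"
      using F assms by (subst infsum_Un_disjoint) (auto intro!: S)
    finally have 1: "(\<Sum>\<^sub>\<infinity>i\<in>J. f i y) - (\<Sum>i\<in>J \<inter> F. f i y) = (\<Sum>\<^sub>\<infinity>i\<in>J - F. f i y)" by simp
    have "(\<Sum>\<^sub>\<infinity>i\<in>J - F. f i y) \<le> (\<Sum>\<^sub>\<infinity>i\<in>I - F. f i y)"
      using assms y nonneg by (intro infsum_mono2) (auto intro!: S)
    moreover have "(\<Sum>\<^sub>\<infinity>i\<in>I. f i y) = (\<Sum>\<^sub>\<infinity>i\<in>F \<union> (I - F). f i y)"
      using F by (simp add: Un_absorb1)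
    then have "1 = (\<Sum>i\<in>F. f i y) + (\<Sum>\<^sub>\<infinity>i\<in>I - F. f i y)"
      using F has_sum_1[OF y] by (subst (asm) infsum_Un_disjoint) (auto intro!: S simp: has_sum_iff)
    moreover have "(\<Sum>\<^sub>\<infinity>i\<in>J - F. f i y) \<ge> 0"
      using assms y nonneg by (intro infsum_nonneg) auto
    ultimately show ?thesis using gt[OF that] 1 by simp
  qed
  moreover have "continuous_map X euclideanreal (\<lambda>y. \<Sum>i\<in>J \<inter> F. f i y)"
    using F continuous by (intro continuous_map_sum) auto
  ultimately show "\<exists>N h. openin X N \<and> x \<in> N \<and> continuous_map X euclideanreal h \<and>
    (\<forall>y\<in>N. \<bar>(\<Sum>\<^sub>\<infinity>i\<in>J. f i y) - h y\<bar> \<le> e)" using N by blast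
qed

text \<open>All functions belonging to the same set are added up. A fibre of \<open>h\<close> may be
  infinite, which is why \<open>continuous_infsum\<close> is needed; a positive sum of nonnegative
  terms has a positive term, so supports stay inside the members.\<close>

lemma normal_covering_image:
  assumes "I \<noteq> {}" "\<And>i. i \<in> I \<Longrightarrow> openin X (h i)"
    and supp: "\<And>i x. \<lbrakk>i \<in> I; x \<in> topspace X; 0 < f i x\<rbrakk> \<Longrightarrow> x \<in> h i"
  shows "normal_covering X (h ` I)"
proof -
  let ?\<phi> = "\<lambda>V x. \<Sum>\<^sub>\<infinity>i\<in>{i\<in>I. h i = V}. f i x"
  have sum1: "((\<lambda>V. ?\<phi> V x) has_sum 1) (h ` I)" if x: "x \<in> topspace X" for x
    using has_sum_fibres[OF has_sum_1[OF x]] .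
  have pos: "\<exists>i\<in>J. f i x > 0" if "x \<in> topspace X" "J \<subseteq> I" "(\<Sum>\<^sub>\<infinity>i\<in>J. f i x) > 0" for x J
  proof (rule ccontr)
    assume "\<not> ?thesis"
    then have "f i x = 0" if "i \<in> J" for i
      using that nonneg[of i x] \<open>x \<in> topspace X\<close> \<open>J \<subseteq> I\<close> by force
    then have "(\<Sum>\<^sub>\<infinity>i\<in>J. f i x) = 0" by (intro infsum_0) auto
    with that show False by simp
  qed
  have "\<Union>(h ` I) = topspace X"
  proof
    show "\<Union>(h ` I) \<subseteq> topspace X" using assms(2) openin_subset by blast
    show "topspace X \<subseteq> \<Union>(h ` I)"
      using pos[of _ I] has_sum_1 supp by (fastforce simp: has_sum_iff)
  qed
  moreover have "subordinated_partition_of_unity X (h ` I) ?\<phi>"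
    unfolding subordinated_partition_of_unity_def
  proof (intro conjI ballI)
    fix V
    show "continuous_map X euclideanreal (?\<phi> V)" by (rule continuous_infsum) auto
    show "0 \<le> ?\<phi> V x" if "x \<in> topspace X" for x using nonneg that by (intro infsum_nonneg) auto
    show "{x \<in> topspace X. 0 < ?\<phi> V x} \<subseteq> V" using pos[of _ "{i\<in>I. h i = V}"] supp by fastforce
  qed (rule sum1)
  ultimately show ?thesis
    using assms(1,2) by (auto simp: normal_covering_def open_covering_def)
qed

section \<open>Continuous suprema and the barycentric family\<close>

definition supremum :: "'i set \<Rightarrow> 'a \<Rightarrow> real" where
  "supremum J x = Sup (insert 0 ((\<lambda>i. f i x) ` J))"

lemma bdd_above_values: "x \<in> topspace X \<Longrightarrow> J \<subseteq> I \<Longrightarrow> bdd_above (insert 0 ((\<lambda>i. f i x) ` J))"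
  using le_1 by (intro bdd_aboveI[where M=1]) auto

lemma supremum_ge: "x \<in> topspace X \<Longrightarrow> J \<subseteq> I \<Longrightarrow> i \<in> J \<Longrightarrow> f i x \<le> supremum J x"
  unfolding supremum_def by (intro cSup_upper bdd_above_values) auto

lemma supremum_nonneg: "x \<in> topspace X \<Longrightarrow> J \<subseteq> I \<Longrightarrow> 0 \<le> supremum J x"
  unfolding supremum_def by (intro cSup_upper bdd_above_values) auto

text \<open>The bound has to be nonnegative because 0 is inserted in the definition, which gives the
  supremum over an empty \<open>J\<close> the value 0; for nonnegative functions and nonempty
  \<open>J\<close> the insertion changes nothing.\<close>

lemma supremum_le: "0 \<le> c \<Longrightarrow> (\<And>i. i \<in> J \<Longrightarrow> f i x \<le> c) \<Longrightarrow> supremum J x \<le> c"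
  unfolding supremum_def by (intro cSup_least) auto

lemma supremum_insert:
  assumes "x \<in> topspace X" "insert i J \<subseteq> I"
  shows "supremum (insert i J) x = max (f i x) (supremum J x)"
proof (rule antisym)
  show "supremum (insert i J) x \<le> max (f i x) (supremum J x)"
    using assms by (intro supremum_le) (auto simp: le_max_iff_disj nonneg supremum_ge)
  have "supremum J x \<le> supremum (insert i J) x"
    using assms by (intro supremum_le) (auto intro: supremum_ge supremum_nonneg)
  then show "max (f i x) (supremum J x) \<le> supremum (insert i J) x"
    using assms by (auto intro: supremum_ge)
qed

lemma continuous_supremum_finite:
  assumes "finite J" "J \<subseteq> I"
  shows "continuous_map X euclideanreal (supremum J)"
  using assms
proof (induction J)
  case empty
  then show ?case by (simp add: supremum_def[abs_def])
next
  case (insert i J)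
  then have "continuous_map X euclideanreal (\<lambda>x. max (f i x) (supremum J x))"
    by (intro continuous_map_real_max) (auto intro: continuous)
  then show ?case
    by (rule continuous_map_eq) (use insert.prems in \<open>auto simp: supremum_insert\<close>)
qed

text \<open>Indices outside \<open>F\<close> contribute less than e near the point, so dropping them
  changes the supremum by at most e, and a finite supremum is continuous.\<close>

lemma continuous_supremum:
  assumes "J \<subseteq> I"
  shows "continuous_map X euclideanreal (supremum J)"
proof (rule continuous_map_locally_approximable)
  fix x e assume "x \<in> topspace X" "(e::real) > 0"
  then obtain F N where F: "finite F" "F \<subseteq> I" and N: "openin X N" "x \<in> N"
    and gt: "\<And>y. y \<in> N \<Longrightarrow> (\<Sum>i\<in>F. f i y) > 1 - e" using locally_concentrated by metis
  have "\<bar>supremum J y - supremum (J \<inter> F) y\<bar> \<le> e" if "y \<in> N" for y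
  proof -
    have y: "y \<in> topspace X" using N(1) openin_subset that by blast
    have "supremum (J \<inter> F) y \<le> supremum J y"
      using assms y by (intro supremum_le) (auto intro: supremum_ge supremum_nonneg)
    moreover have "supremum J y \<le> supremum (J \<inter> F) y + e"
    proof (rule supremum_le)
      have nn: "0 \<le> supremum (J \<inter> F) y" using assms y by (intro supremum_nonneg) auto
      with \<open>e > 0\<close> show "0 \<le> supremum (J \<inter> F) y + e" by simp
      fix i assume "i \<in> J"
      show "f i y \<le> supremum (J \<inter> F) y + e"
      proof (cases "i \<in> F")
        case True
        then show ?thesis
          using supremum_ge[OF y, of "J \<inter> F" i] assms \<open>i \<in> J\<close> \<open>e > 0\<close> by fastforce
      next
        case False
        then show ?thesis
          using outside_small[OF y F gt[OF that], of i] assms \<open>i \<in> J\<close> nn by auto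
      qed
    qed
    ultimately show ?thesis by simp
  qed
  moreover have "continuous_map X euclideanreal (supremum (J \<inter> F))"
    using F by (intro continuous_supremum_finite) auto
  ultimately show "\<exists>N h. openin X N \<and> x \<in> N \<and> continuous_map X euclideanreal h \<and>
    (\<forall>y\<in>N. \<bar>supremum J y - h y\<bar> \<le> e)" using N by blast
qed

lemma supremum_pos: "x \<in> topspace X \<Longrightarrow> 0 < supremum I x"
proof (rule ccontr)
  assume x: "x \<in> topspace X" and "\<not> 0 < supremum I x"
  then have "f i x = 0" if "i \<in> I" for i
    using supremum_ge[OF x subset_refl that] nonneg[OF that x] by simp
  then have "((\<lambda>i. f i x) has_sum 0) I" by (intro has_sum_0) auto
  then show False using has_sum_1[OF x] has_sum_unique by fastforce
qed

text \<open>\<open>barycentric F\<close> is positive where the values \<open>f i x\<close> with \<open>i \<in> F\<close> dominate all the others;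
  the comparison with half of the largest value makes the family locally finite.\<close>

definition barycentric :: "'i set \<Rightarrow> 'a \<Rightarrow> real" where
  "barycentric F x = (\<Prod>i\<in>F. max 0 (f i x - max (supremum (I - F) x) (supremum I x / 2)))"

lemma continuous_barycentric:
  assumes "finite F" "F \<subseteq> I"
  shows "continuous_map X euclideanreal (barycentric F)"
  unfolding barycentric_def[abs_def]
  using assms continuous
  by (intro continuous_intros continuous_supremum continuous_map_real_divide) auto

lemma barycentric_nonneg: "0 \<le> barycentric F x"
  unfolding barycentric_def by (intro prod_nonneg) auto

lemma barycentric_posD:
  assumes "finite F" "0 < barycentric F x" "i \<in> F"
  shows "supremum (I - F) x < f i x" "supremum I x / 2 < f i x"
proof -
  have "max 0 (f i x - max (supremum (I - F) x) (supremum I x / 2)) \<noteq> 0"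
    using assms unfolding barycentric_def by (metis (no_types, lifting) less_irrefl prod_zero_iff)
  then show "supremum (I - F) x < f i x" "supremum I x / 2 < f i x" by (auto simp: max_def split: if_splits)
qed

text \<open>For i in \<open>F - F'\<close> and j in \<open>F' - F\<close>, positivity of both
  functions would give f i x > f j x and f j x > f i x. As in a barycentric subdivision, the sets
  whose functions are positive at one point are nested.\<close>

lemma barycentric_chain:
  assumes "x \<in> topspace X" "finite F" "F \<subseteq> I" "finite F'" "F' \<subseteq> I"
    "0 < barycentric F x" "0 < barycentric F' x"
  shows "F \<subseteq> F' \<or> F' \<subseteq> F"
proof (rule ccontr)
  assume "\<not> ?thesis"
  then obtain i j where ij: "i \<in> F - F'" "j \<in> F' - F" by blast
  have "f i x \<le> supremum (I - F') x" "f j x \<le> supremum (I - F) x"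
    using ij assms by (auto intro!: supremum_ge)
  with barycentric_posD[OF assms(2,6), of i] barycentric_posD[OF assms(4,7), of j] ij
  show False by simp
qed

text \<open>The witness is the set of indices at which the largest value M is attained. It is finite
  because only finitely many values exceed M/2.\<close>

lemma barycentric_pos_ex:
  assumes x: "x \<in> topspace X"
  shows "\<exists>F. finite F \<and> F \<noteq> {} \<and> F \<subseteq> I \<and> 0 < barycentric F x"
proof -
  let ?M = "supremum I x"
  have M: "?M > 0" using supremum_pos[OF x] .
  obtain F0 N where F0: "finite F0" "F0 \<subseteq> I" "x \<in> N" and
    gt: "\<And>y. y \<in> N \<Longrightarrow> (\<Sum>i\<in>F0. f i y) > 1 - ?M / 2"
    using locally_concentrated[OF x half_gt_zero[OF M]] by metis
  have small: "f i x \<le> ?M / 2" if "i \<in> I - F0" for i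
    using outside_small[OF x F0(1,2) gt[OF F0(3)] that] by simp
  define F where "F = {i \<in> I. f i x = ?M}"
  have "F \<subseteq> F0" using small M by (force simp: F_def)
  then have "finite F" using F0 finite_subset by blast
  \<comment> \<open>A number strictly below M that dominates M/2 and all values outside
    \<open>F\<close>: those outside \<open>F0\<close> are at most M/2, and \<open>F0 - F\<close> is
    finite.\<close>
  let ?b = "Max (insert (?M / 2) ((\<lambda>i. f i x) ` (F0 - F)))"
  have "f i x < ?M" if "i \<in> I - F" for i
    using supremum_ge[OF x subset_refl, of i] that by (force simp: F_def)
  then have b: "?b < ?M" using F0 M by (subst Max_less_iff) auto
  have b': "?M / 2 \<le> ?b" using F0 by (intro Max_ge) auto
  have le: "f i x \<le> ?b" if "i \<in> I - F" for i
    using small[of i] that b' F0 by (cases "i \<in> F0") (auto intro: Max_ge simp del: Max_insert)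
  have "supremum (I - F) x \<le> ?b" using le b' M by (intro supremum_le) (auto simp del: Max_insert)
  then have "0 < barycentric F x"
    unfolding barycentric_def using b M by (intro prod_pos) (auto simp: F_def simp del: Max_insert)
  moreover have "F \<noteq> {}"
  proof
    assume "F = {}"
    then have "supremum I x \<le> ?b" using le b' M by (intro supremum_le) (auto simp del: Max_insert)
    then show False using b by (simp del: Max_insert)
  qed
  ultimately show ?thesis using \<open>finite F\<close> unfolding F_def by blast
qed

text \<open>Positivity of the function of \<open>F\<close> forces every value with index in
  \<open>F\<close> above half the maximum, while near x all values outside a fixed finite
  \<open>F0\<close> are below that. So only the finitely many subsets of \<open>F0\<close>
  matter.\<close>

lemma barycentric_locally_finite:
  assumes x: "x \<in> topspace X"
  obtains F0 N where "finite F0" "F0 \<subseteq> I" "openin X N" "x \<in> N"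
    "\<And>F y. \<lbrakk>y \<in> N; finite F; F \<subseteq> I; \<not> F \<subseteq> F0\<rbrakk> \<Longrightarrow> barycentric F y = 0"
proof -
  let ?M = "supremum I"
  have M: "?M x > 0" using supremum_pos[OF x] .
  \<comment> \<open>A quarter of the maximum at x is half of one half: on the neighbourhood chosen
    next the maximum stays above half its value at x, and the barycentric condition compares with
    half of the maximum at y.\<close>
  obtain F0 N where F0: "finite F0" "F0 \<subseteq> I" and N: "openin X N" "x \<in> N" and
    gt: "\<And>y. y \<in> N \<Longrightarrow> (\<Sum>i\<in>F0. f i y) > 1 - ?M x / 4"
    using locally_concentrated[OF x divide_pos_pos[OF M zero_less_numeral]] by metis
  have "openin X {y \<in> topspace X. ?M x / 2 < ?M y}"
    using continuous_supremum[of I] unfolding continuous_map_upper_lower_semicontinuous_lt by blast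
  then have N': "openin X (N \<inter> {y \<in> topspace X. ?M x / 2 < ?M y})" using N by blast
  have x': "x \<in> N \<inter> {y \<in> topspace X. ?M x / 2 < ?M y}" using N x M by simp
  have zero: "barycentric F y = 0"
    if y: "y \<in> N \<inter> {y \<in> topspace X. ?M x / 2 < ?M y}" and F: "finite F" "F \<subseteq> I" "\<not> F \<subseteq> F0" for F y
  proof (rule ccontr)
    assume "barycentric F y \<noteq> 0"
    then have pos: "0 < barycentric F y" using barycentric_nonneg[of F y] by simp
    obtain i where "i \<in> F" "i \<in> I - F0" using F by blast
    with barycentric_posD(2)[OF F(1) pos, of i] outside_small[of y F0 "?M x / 4" i] y F0 gt[of y]
    show False by simp
  qed
  show thesis by (rule that[OF F0 N' x' zero])
qed

end

text \<open>Used twice: as the index set of the barycentric partition and, later, as the full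
  simplicial complex whose vertices are all points of the space.\<close>

definition finite_subsets :: "'i set \<Rightarrow> 'i set set" where
  "finite_subsets I = {F. finite F \<and> F \<noteq> {} \<and> F \<subseteq> I}"

context indexed_partition_of_unity
begin

lemma barycentric_finite_support:
  assumes x: "x \<in> topspace X"
  shows "finite {F \<in> finite_subsets I. barycentric F x \<noteq> 0}"
proof -
  obtain F0 where "finite F0" "\<And>F. \<lbrakk>finite F; F \<subseteq> I; \<not> F \<subseteq> F0\<rbrakk> \<Longrightarrow> barycentric F x = 0"
    using barycentric_locally_finite[OF x] by metis
  then have "{F \<in> finite_subsets I. barycentric F x \<noteq> 0} \<subseteq> Pow F0"
    by (auto simp: finite_subsets_def)
  then show ?thesis using \<open>finite F0\<close> by (meson finite_Pow_iff finite_subset)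
qed

text \<open>The barycentric functions do not add up to 1; this sum, locally finite and everywhere
  positive, is the normalizing factor.\<close>

definition total :: "'a \<Rightarrow> real" where
  "total x = (\<Sum>\<^sub>\<infinity>F\<in>finite_subsets I. barycentric F x)"

lemma has_sum_total:
  assumes "x \<in> topspace X"
  shows "((\<lambda>F. barycentric F x) has_sum total x) (finite_subsets I)"
proof -
  have "((\<lambda>F. barycentric F x) has_sum (\<Sum>F\<in>{F \<in> finite_subsets I. barycentric F x \<noteq> 0}. barycentric F x))
    (finite_subsets I)"
    by (rule has_sum_finite_neutralI[OF barycentric_finite_support[OF assms]]) auto
  from has_sum_infsum[OF has_sum_imp_summable[OF this]] show ?thesis by (simp only: total_def)
qed

lemma total_pos:
  assumes "x \<in> topspace X"
  shows "0 < total x"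
proof -
  obtain F where F: "F \<in> finite_subsets I" "0 < barycentric F x"
    using barycentric_pos_ex[OF assms] unfolding finite_subsets_def by blast
  have "(\<Sum>F\<in>{F}. barycentric F x) \<le> total x"
  proof (rule finite_sum_le_has_sum)
    show "((\<lambda>F. barycentric F x) has_sum total x) (finite_subsets I)"
      using has_sum_total[OF assms] .
  qed (use F barycentric_nonneg in auto)
  with F show ?thesis by simp
qed

lemma continuous_total: "continuous_map X euclideanreal total"
proof (rule continuous_map_locally_approximable)
  fix x e assume x: "x \<in> topspace X" and e: "(e::real) > 0"
  show "\<exists>N h. openin X N \<and> x \<in> N \<and> continuous_map X euclideanreal h \<and> (\<forall>y\<in>N. \<bar>total y - h y\<bar> \<le> e)"
  proof (rule barycentric_locally_finite[OF x])
    fix F0 N assume F0: "finite F0" "F0 \<subseteq> I" and N: "openin X N" "x \<in> N"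
      and z: "\<And>F y. \<lbrakk>y \<in> N; finite F; F \<subseteq> I; \<not> F \<subseteq> F0\<rbrakk> \<Longrightarrow> barycentric F y = 0"
    let ?h = "\<lambda>y. \<Sum>F\<in>finite_subsets F0. barycentric F y"
    have fin: "finite (finite_subsets F0)" using F0 by (auto simp: finite_subsets_def)
    have "total y = ?h y" if "y \<in> N" for y
      unfolding total_def
      by (intro infsumI has_sum_finite_neutralI[OF fin]) (use F0 z that in \<open>auto simp: finite_subsets_def\<close>)
    moreover have "continuous_map X euclideanreal ?h"
      using fin F0 by (intro continuous_map_sum continuous_barycentric) (auto simp: finite_subsets_def)
    ultimately show ?thesis using N e by (intro exI[of _ N] exI[of _ ?h]) auto
  qed
qed

lemma barycentric_partition:
  "indexed_partition_of_unity X (finite_subsets I) (\<lambda>F x. barycentric F x / total x)"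
proof
  fix F assume "F \<in> finite_subsets I"
  then show "continuous_map X euclideanreal (\<lambda>x. barycentric F x / total x)"
    using total_pos
    by (intro continuous_map_real_divide continuous_barycentric continuous_total)
       (force simp: finite_subsets_def)+
next
  fix x assume x: "x \<in> topspace X"
  then show "0 \<le> barycentric F x / total x" for F
    using total_pos[OF x] barycentric_nonneg[of F x] by simp
  show "((\<lambda>F. barycentric F x / total x) has_sum 1) (finite_subsets I)"
    using has_sum_divide_const[OF has_sum_total[OF x], of "total x"] total_pos[OF x] by simp
qed

end

section \<open>Normal coverings under restriction, intersection and refinement\<close>

text \<open>From right to left the covering property comes back from the functions: their sum is 1
  at each point, so one of them is positive there and its member contains the point.\<close>

lemma normal_covering_iff:
  "normal_covering X \<alpha> \<longleftrightarrow> \<alpha> \<noteq> {} \<and> (\<forall>U\<in>\<alpha>. openin X U) \<and>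
     (\<exists>\<phi>. indexed_partition_of_unity X \<alpha> \<phi> \<and> (\<forall>U\<in>\<alpha>. {x \<in> topspace X. 0 < \<phi> U x} \<subseteq> U))" (is "?L = ?R")
proof
  assume ?L
  then obtain \<phi> where "open_covering X \<alpha>" and "subordinated_partition_of_unity X \<alpha> \<phi>"
    by (auto simp: normal_covering_def)
  then show ?R
    by (intro conjI exI[of _ \<phi>]) (auto simp: open_covering_def subordinated_partition_of_unity_def indexed_partition_of_unity_def)
next
  assume R: ?R
  then obtain \<phi> where "indexed_partition_of_unity X \<alpha> \<phi>" "\<forall>U\<in>\<alpha>. {x \<in> topspace X. 0 < \<phi> U x} \<subseteq> U" by blast
  from indexed_partition_of_unity.normal_covering_image[OF this(1), of "\<lambda>U. U"] this(2) R
  show ?L by auto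
qed

lemma normal_covering_trivial: "normal_covering X {topspace X}"
  unfolding normal_covering_iff
  by (auto intro!: exI[of _ "\<lambda>_ _. 1"] has_sum_finiteI simp: indexed_partition_of_unity_def)

lemma normal_covering_subset_topspace: "normal_covering X \<alpha> \<Longrightarrow> U \<in> \<alpha> \<Longrightarrow> U \<subseteq> topspace X"
  by (simp add: normal_covering_iff openin_subset)

lemma normal_covering_nonempty: "normal_covering X \<alpha> \<Longrightarrow> \<alpha> \<noteq> {}"
  by (simp add: normal_covering_iff)

text \<open>The functions restrict as they are. Different members may have the same trace on
  \<open>A\<close>, so the new partition is obtained through
  \<open>normal_covering_image\<close>.\<close>

lemma normal_covering_restrict:
  assumes "normal_covering X \<alpha>" "A \<subseteq> topspace X"
  shows "normal_covering (subtopology X A) (restrict_covering \<alpha> A)"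
proof -
  obtain \<phi> where \<phi>: "indexed_partition_of_unity X \<alpha> \<phi>" "\<forall>U\<in>\<alpha>. {x \<in> topspace X. 0 < \<phi> U x} \<subseteq> U"
    using assms by (auto simp: normal_covering_iff)
  interpret indexed_partition_of_unity X \<alpha> \<phi> by fact
  have "indexed_partition_of_unity (subtopology X A) \<alpha> \<phi>"
    by unfold_locales (auto intro: continuous_map_from_subtopology continuous nonneg has_sum_1)
  then show ?thesis unfolding restrict_covering_def
    by (rule indexed_partition_of_unity.normal_covering_image)
       (use assms \<phi> in \<open>auto simp: normal_covering_iff openin_subtopology\<close>)
qed

text \<open>The products of a function for U and one for V are supported in
  \<open>U \<inter> V\<close> and sum to 1 over all pairs.\<close>

lemma normal_covering_common_refinement:
  assumes "normal_covering X \<alpha>" "normal_covering X \<beta>"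
  obtains \<gamma> where "normal_covering X \<gamma>" "refinement_of \<gamma> \<alpha>" "refinement_of \<gamma> \<beta>"
proof -
  obtain \<phi> where \<phi>: "indexed_partition_of_unity X \<alpha> \<phi>" "\<forall>U\<in>\<alpha>. {x \<in> topspace X. 0 < \<phi> U x} \<subseteq> U"
    using assms by (auto simp: normal_covering_iff)
  obtain \<psi> where \<psi>: "indexed_partition_of_unity X \<beta> \<psi>" "\<forall>U\<in>\<beta>. {x \<in> topspace X. 0 < \<psi> U x} \<subseteq> U"
    using assms by (auto simp: normal_covering_iff)
  interpret a: indexed_partition_of_unity X \<alpha> \<phi> by fact
  interpret b: indexed_partition_of_unity X \<beta> \<psi> by fact
  have "indexed_partition_of_unity X (\<alpha> \<times> \<beta>) (\<lambda>p x. \<phi> (fst p) x * \<psi> (snd p) x)"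
  proof
    fix x assume x: "x \<in> topspace X"
    have "((\<lambda>V. \<phi> U x * \<psi> V x) has_sum \<phi> U x * 1) \<beta>" for U
      by (intro has_sum_cmult_right b.has_sum_1 x)
    then have *: "((\<lambda>V. \<phi> U x * \<psi> V x) has_sum \<phi> U x) \<beta>" for U by simp
    have "(\<lambda>p. \<phi> (fst p) x * \<psi> (snd p) x) summable_on (\<alpha> \<times> \<beta>)"
      by (rule summable_on_SigmaI[where g = "\<lambda>U. \<phi> U x" and f = "\<lambda>p. \<phi> (fst p) x * \<psi> (snd p) x"])
         (use * a.has_sum_1[OF x] a.nonneg b.nonneg x in \<open>auto simp: has_sum_imp_summable\<close>)
    then show "((\<lambda>p. \<phi> (fst p) x * \<psi> (snd p) x) has_sum 1) (\<alpha> \<times> \<beta>)"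
      using *
      by (intro has_sum_SigmaI[where f = "\<lambda>p. \<phi> (fst p) x * \<psi> (snd p) x", OF _ a.has_sum_1[OF x]]) auto
  qed (auto intro!: continuous_intros a.continuous b.continuous mult_nonneg_nonneg a.nonneg b.nonneg)
  then have "normal_covering X ((\<lambda>p. fst p \<inter> snd p) ` (\<alpha> \<times> \<beta>))"
  proof (rule indexed_partition_of_unity.normal_covering_image)
    show "\<alpha> \<times> \<beta> \<noteq> {}" using assms by (auto simp: normal_covering_iff)
    show "openin X (fst p \<inter> snd p)" if "p \<in> \<alpha> \<times> \<beta>" for p
      using assms that by (auto simp: normal_covering_iff)
    show "x \<in> fst p \<inter> snd p" if "p \<in> \<alpha> \<times> \<beta>" "x \<in> topspace X" "0 < \<phi> (fst p) x * \<psi> (snd p) x" for p x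
    proof -
      have "0 \<le> \<phi> (fst p) x" "0 \<le> \<psi> (snd p) x" using that a.nonneg b.nonneg by auto
      with that(3) have "0 < \<phi> (fst p) x" "0 < \<psi> (snd p) x"
        by (auto simp: zero_less_mult_iff)
      then show ?thesis using \<phi>(2) \<psi>(2) that by auto
    qed
  qed
  then show thesis by (rule that) (auto simp: refinement_of_def)
qed

section \<open>Point-star refinements\<close>

definition star :: "'a set set \<Rightarrow> 'a \<Rightarrow> 'a set" where
  "star \<beta> x = \<Union>{U \<in> \<beta>. x \<in> U}"

definition point_star_refinement :: "'a topology \<Rightarrow> 'a set set \<Rightarrow> 'a set set \<Rightarrow> bool" where
  "point_star_refinement X \<beta> \<alpha> \<longleftrightarrow> (\<forall>x\<in>topspace X. \<exists>U\<in>\<alpha>. star \<beta> x \<subseteq> U)"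

text \<open>Among the finite sets whose barycentric function is positive at x there is a least one,
  because they are nested. Any member U in it belongs to all of them, and wherever one of their
  functions is positive so is the function of U. Hence the star of x lies in U.\<close>

lemma normal_covering_point_star_refinement:
  assumes "normal_covering X \<alpha>"
  obtains \<beta> where "normal_covering X \<beta>" "point_star_refinement X \<beta> \<alpha>"
proof -
  obtain \<phi> where \<phi>: "indexed_partition_of_unity X \<alpha> \<phi>" "\<forall>U\<in>\<alpha>. {x \<in> topspace X. 0 < \<phi> U x} \<subseteq> U"
    using assms by (auto simp: normal_covering_iff)
  interpret indexed_partition_of_unity X \<alpha> \<phi> by fact
  let ?h = "\<lambda>F. {x \<in> topspace X. 0 < barycentric F x}"
  have "normal_covering X (?h ` finite_subsets \<alpha>)"
  proof (rule indexed_partition_of_unity.normal_covering_image[OF barycentric_partition])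
    show "finite_subsets \<alpha> \<noteq> {}"
      using normal_covering_nonempty[OF assms] by (auto simp: finite_subsets_def)
    show "openin X (?h F)" if "F \<in> finite_subsets \<alpha>" for F
      using continuous_barycentric[of F] that
      by (auto simp: continuous_map_upper_lower_semicontinuous_lt finite_subsets_def)
    show "x \<in> ?h F" if "F \<in> finite_subsets \<alpha>" "x \<in> topspace X" "0 < barycentric F x / total x" for F x
      using that total_pos[of x] by (simp add: zero_less_divide_iff)
  qed
  moreover have "point_star_refinement X (?h ` finite_subsets \<alpha>) \<alpha>"
    unfolding point_star_refinement_def
  proof
    fix x assume x: "x \<in> topspace X"
    let ?C = "{F \<in> finite_subsets \<alpha>. 0 < barycentric F x}"
    have "\<exists>F. F \<in> ?C" using barycentric_pos_ex[OF x] by (auto simp: finite_subsets_def)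
    \<comment> \<open>In a chain of finite sets, one of smallest cardinality is contained in all the
      others.\<close>
    then obtain F where F: "F \<in> ?C" "\<And>F'. F' \<in> ?C \<Longrightarrow> card F \<le> card F'"
      using ex_has_least_nat[of "\<lambda>F. F \<in> ?C" _ card] by blast
    have sub: "F \<subseteq> F'" if "F' \<in> ?C" for F'
    proof -
      have "F \<subseteq> F' \<or> F' \<subseteq> F"
        using F(1) that by (intro barycentric_chain[OF x]) (auto simp: finite_subsets_def)
      then show ?thesis
        using F(2)[OF that] F(1) card_seteq[of F F'] by (auto simp: finite_subsets_def)
    qed
    obtain U where U: "U \<in> F" "U \<in> \<alpha>" using F(1) by (auto simp: finite_subsets_def)
    have "?h F' \<subseteq> U" if "F' \<in> ?C" for F'
    proof
      fix y assume y: "y \<in> ?h F'"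
      have "supremum (\<alpha> - F') y < \<phi> U y"
        using barycentric_posD(1)[of F' y U] y sub[OF that] U that by (auto simp: finite_subsets_def)
      then have "0 < \<phi> U y" using supremum_nonneg[of y "\<alpha> - F'"] y by simp
      then show "y \<in> U" using \<phi>(2) U y by auto
    qed
    then have "star (?h ` finite_subsets \<alpha>) x \<subseteq> U" by (auto simp: star_def)
    then show "\<exists>U\<in>\<alpha>. star (?h ` finite_subsets \<alpha>) x \<subseteq> U" using U by blast
  qed
  ultimately show thesis by (rule that)
qed

lemma refinement_of_refl [simp]: "refinement_of \<alpha> \<alpha>"
  by (auto simp: refinement_of_def)

lemma refinement_of_trans: "refinement_of \<gamma> \<beta> \<Longrightarrow> refinement_of \<beta> \<alpha> \<Longrightarrow> refinement_of \<gamma> \<alpha>"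
  unfolding refinement_of_def by (meson order_trans)

lemma point_star_refinement_imp_refinement:
  assumes "normal_covering X \<alpha>" "normal_covering X \<beta>" "point_star_refinement X \<beta> \<alpha>"
  shows "refinement_of \<beta> \<alpha>"
  unfolding refinement_of_def
proof
  fix V assume V: "V \<in> \<beta>"
  show "\<exists>U\<in>\<alpha>. V \<subseteq> U"
  proof (cases "V = {}")
    case True
    then show ?thesis using normal_covering_nonempty[OF assms(1)] by auto
  next
    case False
    then obtain x where "x \<in> V" by blast
    then have "x \<in> topspace X" "V \<subseteq> star \<beta> x"
      using normal_covering_subset_topspace[OF assms(2) V] V by (auto simp: star_def)
    then show ?thesis using assms(3) unfolding point_star_refinement_def by (meson order_trans)
  qed
qed

lemma star_mono: "refinement_of \<gamma> \<beta> \<Longrightarrow> star \<gamma> x \<subseteq> star \<beta> x"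
  unfolding refinement_of_def star_def by blast

lemma star_subset_topspace: "normal_covering X \<beta> \<Longrightarrow> star \<beta> x \<subseteq> topspace X"
  using normal_covering_subset_topspace unfolding star_def by blast

section \<open>Cochain complexes and direct limits\<close>

text \<open>Both groups appear as quotients of the same set \<open>Z\<close> by the same
  equivalence. \<open>Z\<close> is only asked to be closed under \<open>m\<close>, so
  representatives can be taken among plain functions, without making them into a group.\<close>

lemma iso_by_common_representatives:
  fixes G :: "('a, 'm) monoid_scheme" and H :: "('b, 'n) monoid_scheme"
  assumes G: "\<Psi> ` Z = carrier G" and H: "\<Phi> ` Z = carrier H"
    and fibres: "\<And>a b. \<lbrakk>a \<in> Z; b \<in> Z\<rbrakk> \<Longrightarrow> \<Psi> a = \<Psi> b \<longleftrightarrow> \<Phi> a = \<Phi> b"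
    and closed: "\<And>a b. \<lbrakk>a \<in> Z; b \<in> Z\<rbrakk> \<Longrightarrow> m a b \<in> Z"
    and \<Psi>: "\<And>a b. \<lbrakk>a \<in> Z; b \<in> Z\<rbrakk> \<Longrightarrow> \<Psi> (m a b) = \<Psi> a \<otimes>\<^bsub>G\<^esub> \<Psi> b"
    and \<Phi>: "\<And>a b. \<lbrakk>a \<in> Z; b \<in> Z\<rbrakk> \<Longrightarrow> \<Phi> (m a b) = \<Phi> a \<otimes>\<^bsub>H\<^esub> \<Phi> b"
  shows "G \<cong> H"
proof (rule is_isoI)
  define F where "F x = \<Phi> (inv_into Z \<Psi> x)" for x
  have F: "F (\<Psi> a) = \<Phi> a" if "a \<in> Z" for a
  proof -
    have *: "\<Psi> a \<in> \<Psi> ` Z" using that by (rule imageI)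
    show ?thesis
      unfolding F_def using fibres[OF inv_into_into[OF *] that] f_inv_into_f[OF *] by simp
  qed
  have "F \<in> hom G H"
  proof (rule homI)
    fix x assume "x \<in> carrier G"
    then obtain a where "a \<in> Z" "x = \<Psi> a" using G by blast
    then show "F x \<in> carrier H" using F H by auto
  next
    fix x y assume "x \<in> carrier G" "y \<in> carrier G"
    then obtain a b where "a \<in> Z" "b \<in> Z" "x = \<Psi> a" "y = \<Psi> b" using G by blast
    then show "F (x \<otimes>\<^bsub>G\<^esub> y) = F x \<otimes>\<^bsub>H\<^esub> F y"
      using F[OF closed[of a b]] by (simp add: F \<Phi> \<Psi>)
  qed
  moreover have "bij_betw F (carrier G) (carrier H)"
    unfolding bij_betw_def
  proof
    show "inj_on F (carrier G)"
    proof (rule inj_onI)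
      fix x y assume xy: "x \<in> carrier G" "y \<in> carrier G" and eq: "F x = F y"
      obtain a b where ab: "a \<in> Z" "b \<in> Z" "x = \<Psi> a" "y = \<Psi> b" using G xy by blast
      then have "\<Phi> a = \<Phi> b" using eq F[of a] F[of b] by simp
      then show "x = y" using fibres[of a b] ab by simp
    qed
    have "F ` \<Psi> ` Z = \<Phi> ` Z" unfolding image_image by (rule image_cong) (auto simp: F)
    then show "F ` carrier G = carrier H" by (simp add: G H)
  qed
  ultimately show "F \<in> iso G H" by (simp add: iso_def)
qed

section \<open>Cosets and the cohomology of a cochain complex\<close>

lemma (in group) r_coset_eq_iff:
  assumes "subgroup H G" "a \<in> carrier G" "b \<in> carrier G"
  shows "H #> a = H #> b \<longleftrightarrow> a \<otimes> inv b \<in> H"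
  using assms subgroup.subset[OF assms(1)]
  by (metis coset_join1 coset_join2 coset_mult_inv1 coset_mult_inv2 inv_closed m_closed)

text \<open>Cosets depend on the multiplication alone; cohomology classes can therefore be computed
  in the whole cochain group instead of the subgroup of cocycles.\<close>

lemma r_coset_carrier_update [simp]: "H #>\<^bsub>G\<lparr>carrier := S\<rparr>\<^esub> a = H #>\<^bsub>G\<^esub> a"
  by (simp add: r_coset_def)

lemma set_mult_carrier_update [simp]: "H <#>\<^bsub>G\<lparr>carrier := S\<rparr>\<^esub> K = H <#>\<^bsub>G\<^esub> K"
  by (simp add: set_mult_def)

lemma (in comm_group) subgroup_comm_group:
  assumes "subgroup H G"
  shows "comm_group (G\<lparr>carrier := H\<rparr>)"
proof (rule group.group_comm_groupI)
  show "group (G\<lparr>carrier := H\<rparr>)" using assms subgroup.subgroup_is_group is_group by blast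
qed (use m_comm subgroup.mem_carrier[OF assms] in auto)

text \<open>The union defining \<open>induced_on_cosets\<close> collapses: two representatives
  differ by an element of \<open>N\<close>, whose image lies in \<open>K\<close>, so they produce
  the same coset.\<close>

lemma induced_on_cosets_r_coset:
  assumes "group G" "group H" "f \<in> hom G H" "subgroup N G" "subgroup K H" "f ` N \<subseteq> K" "x \<in> carrier G"
  shows "induced_on_cosets H K f (N #>\<^bsub>G\<^esub> x) = K #>\<^bsub>H\<^esub> f x"
proof -
  have fx: "f x \<in> carrier H" using assms(3,7) by (auto simp: hom_def)
  have "K #>\<^bsub>H\<^esub> f y = K #>\<^bsub>H\<^esub> f x" if yN: "y \<in> N #>\<^bsub>G\<^esub> x" for y
  proof -
    obtain h where h: "h \<in> N" "y = h \<otimes>\<^bsub>G\<^esub> x" using yN unfolding r_coset_def by blast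
    then have y: "f y = f h \<otimes>\<^bsub>H\<^esub> f x" and K: "f h \<in> K"
      using hom_mult[OF assms(3) subgroup.mem_carrier[OF assms(4) h(1)] assms(7)] assms(6) by auto
    then have "f y \<in> K #>\<^bsub>H\<^esub> f x" by (auto simp: r_coset_def)
    then show ?thesis using group.repr_independence[OF assms(2) _ fx assms(5)] by simp
  qed
  moreover have "x \<in> N #>\<^bsub>G\<^esub> x" using group.rcos_self[OF assms(1,7,4)] .
  ultimately show ?thesis unfolding induced_on_cosets_def by blast
qed

locale cochain_complex =
  fixes C :: "nat \<Rightarrow> ('a, 'm) monoid_scheme" and d :: "nat \<Rightarrow> 'a \<Rightarrow> 'a"
  assumes comm_group: "comm_group (C n)"
    and hom: "d n \<in> hom (C n) (C (Suc n))"
    and square_zero: "x \<in> carrier (C n) \<Longrightarrow> d (Suc n) (d n x) = \<one>\<^bsub>C (Suc (Suc n))\<^esub>"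

definition cohomology_class ::
    "(nat \<Rightarrow> ('a, 'm) monoid_scheme) \<Rightarrow> (nat \<Rightarrow> 'a \<Rightarrow> 'a) \<Rightarrow> nat \<Rightarrow> 'a \<Rightarrow> 'a set" where
  "cohomology_class C d n z = coboundaries C d n #>\<^bsub>C n\<^esub> z"

context cochain_complex
begin

lemma group: "group (C n)"
  using comm_group by (simp add: comm_group_def)

lemma group_hom: "group_hom (C n) (C (Suc n)) (d n)"
  using group hom by (simp add: group_hom_def group_hom_axioms_def)

lemma cocycles_subgroup: "subgroup (cocycles C d n) (C n)"
  unfolding cocycles_def by (rule group_hom.subgroup_kernel[OF group_hom])

lemma coboundaries_subgroup: "subgroup (coboundaries C d n) (C n)"
proof (cases n)
  case 0
  then show ?thesis using group.triv_subgroup[OF group] by (simp add: coboundaries_def)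
next
  case (Suc m)
  then show ?thesis using group_hom.img_is_subgroup[OF group_hom[of m]] by (simp add: coboundaries_def)
qed

lemma coboundaries_subset_cocycles: "coboundaries C d n \<subseteq> cocycles C d n"
proof (cases n)
  case 0
  then show ?thesis using subgroup.one_closed[OF cocycles_subgroup[of 0]] by (simp add: coboundaries_def)
next
  case (Suc m)
  then show ?thesis
    using square_zero[of _ m] hom[of m] by (auto simp: coboundaries_def cocycles_def kernel_def hom_def)
qed

lemma cocycles_carrier: "z \<in> cocycles C d n \<Longrightarrow> z \<in> carrier (C n)"
  using subgroup.mem_carrier[OF cocycles_subgroup] .

lemma cocycles_comm_group: "comm_group ((C n)\<lparr>carrier := cocycles C d n\<rparr>)"
  by (rule comm_group.subgroup_comm_group[OF comm_group cocycles_subgroup])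

lemma coboundaries_subgroup_cocycles:
  "subgroup (coboundaries C d n) ((C n)\<lparr>carrier := cocycles C d n\<rparr>)"
  by (rule group.subgroup_incl[OF group coboundaries_subgroup cocycles_subgroup coboundaries_subset_cocycles])

lemma carrier_cohomology_group:
  "carrier (cohomology_group C d n) = cohomology_class C d n ` cocycles C d n"
  by (simp add: cohomology_group_def carrier_FactGroup cohomology_class_def[abs_def])

lemma cohomology_comm_group: "comm_group (cohomology_group C d n)"
  unfolding cohomology_group_def
  by (rule comm_group.abelian_FactGroup[OF cocycles_comm_group coboundaries_subgroup_cocycles])

lemma cohomology_class_mult:
  assumes "a \<in> cocycles C d n" "b \<in> cocycles C d n"
  shows "cohomology_class C d n a \<otimes>\<^bsub>cohomology_group C d n\<^esub> cohomology_class C d n b =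
    cohomology_class C d n (a \<otimes>\<^bsub>C n\<^esub> b)"
proof -
  have "coboundaries C d n \<lhd> C n"
    using comm_group.subgroup_imp_normal[OF comm_group coboundaries_subgroup] .
  from normal.rcos_sum[OF this, of a b] assms cocycles_carrier show ?thesis
    by (simp add: cohomology_group_def cohomology_class_def)
qed

lemma cohomology_class_eq_iff:
  assumes "a \<in> cocycles C d n" "b \<in> cocycles C d n"
  shows "cohomology_class C d n a = cohomology_class C d n b \<longleftrightarrow>
    a \<otimes>\<^bsub>C n\<^esub> inv\<^bsub>C n\<^esub> b \<in> coboundaries C d n"
  unfolding cohomology_class_def
  using group.r_coset_eq_iff[OF group coboundaries_subgroup] assms cocycles_carrier by blast

end

lemma induced_on_cohomology_class:
  assumes "cochain_complex C d" "cochain_complex C' d'" "F \<in> hom (C n) (C' n)"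
    "F ` coboundaries C d n \<subseteq> coboundaries C' d' n" "z \<in> cocycles C d n"
  shows "induced_on_cosets (C' n) (coboundaries C' d' n) F (cohomology_class C d n z) =
    cohomology_class C' d' n (F z)"
  unfolding cohomology_class_def
  by (rule induced_on_cosets_r_coset[OF cochain_complex.group[OF assms(1)] cochain_complex.group[OF assms(2)]
      assms(3) cochain_complex.coboundaries_subgroup[OF assms(1)]
      cochain_complex.coboundaries_subgroup[OF assms(2)] assms(4) cochain_complex.cocycles_carrier[OF assms(1,5)]])

text \<open>The order on indices is a directed preorder: distinct coverings may refine each other,
  so antisymmetry cannot be asked for.\<close>

locale directed_system =
  fixes I :: "'i set" and before :: "'i \<Rightarrow> 'i \<Rightarrow> bool"
    and H :: "'i \<Rightarrow> ('a, 'm) monoid_scheme" and f :: "'i \<Rightarrow> 'i \<Rightarrow> 'a \<Rightarrow> 'a"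
  assumes refl: "i \<in> I \<Longrightarrow> before i i"
    and trans: "\<lbrakk>i \<in> I; j \<in> I; k \<in> I; before i j; before j k\<rbrakk> \<Longrightarrow> before i k"
    and directed: "\<lbrakk>i \<in> I; j \<in> I\<rbrakk> \<Longrightarrow> \<exists>k\<in>I. before i k \<and> before j k"
    and group: "i \<in> I \<Longrightarrow> group (H i)"
    and hom: "\<lbrakk>i \<in> I; j \<in> I; before i j\<rbrakk> \<Longrightarrow> f i j \<in> hom (H i) (H j)"
    and compose: "\<lbrakk>i \<in> I; j \<in> I; k \<in> I; before i j; before j k; x \<in> carrier (H i)\<rbrakk> \<Longrightarrow>
      f j k (f i j x) = f i k x"
begin

definition limit_class :: "'i \<Rightarrow> 'a \<Rightarrow> ('i \<times> 'a) set" where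
  "limit_class i x = limit_rel I before H f `` {(i, x)}"

lemma bonding_closed: "\<lbrakk>i \<in> I; j \<in> I; before i j; x \<in> carrier (H i)\<rbrakk> \<Longrightarrow> f i j x \<in> carrier (H j)"
  using hom by (auto simp: hom_def)

lemma mem_limit_rel:
  "((i, x), (j, y)) \<in> limit_rel I before H f \<longleftrightarrow> i \<in> I \<and> x \<in> carrier (H i) \<and> j \<in> I \<and>
     y \<in> carrier (H j) \<and> (\<exists>k\<in>I. before i k \<and> before j k \<and> f i k x = f j k y)"
  by (simp only: limit_rel_def mem_Collect_eq prod.case)

lemma equiv_limit_rel: "equiv (SIGMA i:I. carrier (H i)) (limit_rel I before H f)"
proof (rule equivI)
  show "limit_rel I before H f \<subseteq> (SIGMA i:I. carrier (H i)) \<times> (SIGMA i:I. carrier (H i))"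
  proof (rule subrelI)
    fix p q assume "(p, q) \<in> limit_rel I before H f"
    then show "(p, q) \<in> (SIGMA i:I. carrier (H i)) \<times> (SIGMA i:I. carrier (H i))"
      by (cases p; cases q) (simp add: mem_limit_rel)
  qed
  show "refl_on (SIGMA i:I. carrier (H i)) (limit_rel I before H f)"
  proof (rule refl_onI)
    fix p assume "p \<in> (SIGMA i:I. carrier (H i))"
    then show "(p, p) \<in> limit_rel I before H f"
      using refl by (cases p) (auto simp: mem_limit_rel)
  qed
  show "sym (limit_rel I before H f)"
    unfolding sym_def split_paired_All mem_limit_rel by metis
  show "trans (limit_rel I before H f)"
  proof (rule transI)
    fix p q r assume pqr: "(p, q) \<in> limit_rel I before H f" "(q, r) \<in> limit_rel I before H f"
    obtain i x j y l z where eq: "p = (i, x)" "q = (j, y)" "r = (l, z)" by (cases p; cases q; cases r)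
    obtain k1 k2
      where I: "i \<in> I" "j \<in> I" "l \<in> I" "k1 \<in> I" "k2 \<in> I"
        and c: "x \<in> carrier (H i)" "y \<in> carrier (H j)" "z \<in> carrier (H l)"
        and b: "before i k1" "before j k1" "before j k2" "before l k2"
        and e: "f i k1 x = f j k1 y" "f j k2 y = f l k2 z"
      using pqr unfolding eq mem_limit_rel by blast
    obtain k where k: "k \<in> I" "before k1 k" "before k2 k" using directed I by blast
    have "f i k x = f k1 k (f i k1 x)" using compose I c b k by metis
    also have "\<dots> = f j k y" using compose I c b k e by metis
    also have "\<dots> = f k2 k (f j k2 y)" using compose I c b k by metis
    also have "\<dots> = f l k z" using compose I c b k e by metis
    finally have "f i k x = f l k z" .
    moreover have "before i k" "before l k" using trans I k b by blast+
    ultimately show "(p, r) \<in> limit_rel I before H f"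
      using I c k(1) unfolding eq mem_limit_rel by blast
  qed
qed

lemma limit_class_eq_iff:
  assumes "i \<in> I" "x \<in> carrier (H i)" "j \<in> I" "y \<in> carrier (H j)"
  shows "limit_class i x = limit_class j y \<longleftrightarrow> (\<exists>k\<in>I. before i k \<and> before j k \<and> f i k x = f j k y)"
proof -
  have "limit_class i x = limit_class j y \<longleftrightarrow> ((i, x), (j, y)) \<in> limit_rel I before H f"
    unfolding limit_class_def using assms by (intro eq_equiv_class_iff[OF equiv_limit_rel]) auto
  then show ?thesis using assms by (simp add: limit_rel_def)
qed

lemma limit_class_bonding:
  assumes "i \<in> I" "j \<in> I" "before i j" "x \<in> carrier (H i)"
  shows "limit_class j (f i j x) = limit_class i x"
  using assms refl compose bonding_closed by (subst limit_class_eq_iff) (auto intro!: bexI[of _ j])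

lemma carrier_direct_limit:
  "carrier (direct_limit I before H f) = {limit_class i x | i x. i \<in> I \<and> x \<in> carrier (H i)}"
  by (auto simp: direct_limit_def limit_class_def quotient_def)

text \<open>The product in \<open>direct_limit\<close> is a union over all choices of
  representatives and of a common later index. All choices yield one class, so the union is over a
  singleton. Factors at the same index are enough, since any two classes can be moved to a common
  index.\<close>

lemma limit_class_mult:
  assumes i: "i \<in> I" and x: "x \<in> carrier (H i)" and y: "y \<in> carrier (H i)"
  shows "limit_class i x \<otimes>\<^bsub>direct_limit I before H f\<^esub> limit_class i y = limit_class i (x \<otimes>\<^bsub>H i\<^esub> y)"
proof -
  have xy: "x \<otimes>\<^bsub>H i\<^esub> y \<in> carrier (H i)" using group[OF i] x y by (simp add: group.is_monoid monoid.m_closed)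
  have same: "limit_class k (f i' k x' \<otimes>\<^bsub>H k\<^esub> f j' k y') = limit_class i (x \<otimes>\<^bsub>H i\<^esub> y)"
    if rep: "(i', x') \<in> limit_class i x" "(j', y') \<in> limit_class i y" "k \<in> I" "before i' k" "before j' k"
    for i' x' j' y' k
  proof -
    obtain k1 k2 where I: "i' \<in> I" "j' \<in> I" "k1 \<in> I" "k2 \<in> I" "x' \<in> carrier (H i')" "y' \<in> carrier (H j')"
      and b: "before i k1" "before i' k1" "before i k2" "before j' k2"
      and e: "f i k1 x = f i' k1 x'" "f i k2 y = f j' k2 y'"
      using rep unfolding limit_class_def Image_singleton_iff mem_limit_rel by blast
    \<comment> \<open>The two equalities of representatives hold at different indices, and the
      product was formed at a third; \<open>l\<close> is later than all of them, so everything can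
      be compared there.\<close>
    obtain k3 where k3: "k3 \<in> I" "before k1 k3" "before k2 k3" using directed I by blast
    obtain l where l: "l \<in> I" "before k3 l" "before k l" using directed k3 \<open>k \<in> I\<close> by blast
    have kl: "before k1 l" "before k2 l" using trans k3 l I by blast+
    have il: "before i l" using trans[OF i I(3) l(1) b(1) kl(1)] .
    have 1: "f i' l x' = f i l x" using compose I b e kl l i x by metis
    have 2: "f j' l y' = f i l y" using compose I b e kl l i y by metis
    have cl: "f i' k x' \<in> carrier (H k)" "f j' k y' \<in> carrier (H k)"
      using bonding_closed I that by auto
    then have "f k l (f i' k x' \<otimes>\<^bsub>H k\<^esub> f j' k y') = f k l (f i' k x') \<otimes>\<^bsub>H l\<^esub> f k l (f j' k y')"
      using hom[OF that(3) l(1,3)] by (auto simp: hom_def)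
    also have "\<dots> = f i l x \<otimes>\<^bsub>H l\<^esub> f i l y"
      using compose[OF I(1) that(3) l(1) that(4) l(3) I(5)] compose[OF I(2) that(3) l(1) that(5) l(3) I(6)] 1 2
      by simp
    also have "\<dots> = f i l (x \<otimes>\<^bsub>H i\<^esub> y)" using hom[OF i l(1) il] x y by (auto simp: hom_def)
    finally show ?thesis
      using l i il xy cl that(3) group[OF that(3)]
      by (subst limit_class_eq_iff) (auto intro!: bexI[of _ l] simp: group.is_monoid monoid.m_closed)
  qed
  have "(i, x) \<in> limit_class i x" "(i, y) \<in> limit_class i y"
    using i x y refl by (auto simp: limit_class_def limit_rel_def)
  then have "{limit_class k (f i' k x' \<otimes>\<^bsub>H k\<^esub> f j' k y') | i' x' j' y' k. (i', x') \<in> limit_class i x \<and>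
      (j', y') \<in> limit_class i y \<and> k \<in> I \<and> before i' k \<and> before j' k} = {limit_class i (x \<otimes>\<^bsub>H i\<^esub> y)}"
    using same refl[OF i] i by blast
  then show ?thesis by (simp add: direct_limit_def limit_class_def)
qed

end

section \<open>The prism operator and contiguous maps\<close>

lemma length_face: "i < length xs \<Longrightarrow> length (face i xs) = length xs - 1"
  by (auto simp: face_def)

lemma set_face_subset: "set (face i xs) \<subseteq> set xs"
  by (auto simp: face_def dest: in_set_takeD in_set_dropD)

lemma face_map: "face i (map p xs) = map p (face i xs)"
  by (simp add: face_def take_map drop_map)

lemma face_0 [simp]: "face 0 (x # xs) = xs"
  by (simp add: face_def)

lemma face_Suc [simp]: "face (Suc i) (x # xs) = x # face i xs"
  by (simp add: face_def)

text \<open>The coboundary formula without its domain. Applied to functions with values in the group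
  on all lists, it obeys a recursion on the tuple that no simplicial condition interrupts.\<close>

definition alternating_sum :: "('g, 'm) monoid_scheme \<Rightarrow> ('a list \<Rightarrow> 'g) \<Rightarrow> 'a list \<Rightarrow> 'g" where
  "alternating_sum G \<phi> xs = finprod G (\<lambda>i. \<phi> (face i xs) [^]\<^bsub>G\<^esub> ((- 1) ^ i :: int)) {..<length xs}"

text \<open>The terms of the prism operator between the maps induced by \<open>p\<close> and \<open>q\<close>; recursion on the
  tuple makes the homotopy formula a plain induction.\<close>

primrec prism ::
    "('g, 'm) monoid_scheme \<Rightarrow> ('a \<Rightarrow> 'b) \<Rightarrow> ('a \<Rightarrow> 'b) \<Rightarrow> 'a list \<Rightarrow> ('b list \<Rightarrow> 'g) \<Rightarrow> 'g" where
  "prism G p q [] \<phi> = \<one>\<^bsub>G\<^esub>"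
| "prism G p q (x # xs) \<phi> =
     \<phi> (p x # q x # map q xs) \<otimes>\<^bsub>G\<^esub> inv\<^bsub>G\<^esub> prism G p q xs (\<lambda>ys. \<phi> (p x # ys))"

context comm_group
begin

lemma finprod_inv:
  assumes "\<And>i. i \<in> A \<Longrightarrow> f i \<in> carrier G"
  shows "finprod G (\<lambda>i. inv (f i)) A = inv (finprod G f A)"
proof (cases "finite A")
  case True
  then show ?thesis using assms
    by (induction A) (auto simp: inv_mult Pi_def)
qed simp

lemma alternating_sum_Nil [simp]: "alternating_sum G \<phi> [] = \<one>"
  by (simp add: alternating_sum_def)

lemma alternating_sum_closed [simp]:
  assumes "\<And>ys. \<phi> ys \<in> carrier G"
  shows "alternating_sum G \<phi> xs \<in> carrier G"
  unfolding alternating_sum_def using assms by (intro finprod_closed) auto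

text \<open>Deleting the head gives the first term; every other face keeps the head and has its
  index shifted by one, which turns the sign into an inverse.\<close>

lemma alternating_sum_Cons:
  assumes "\<And>ys. \<phi> ys \<in> carrier G"
  shows "alternating_sum G \<phi> (x # xs) = \<phi> xs \<otimes> inv (alternating_sum G (\<lambda>ys. \<phi> (x # ys)) xs)"
proof -
  let ?f = "\<lambda>i. \<phi> (face i (x # xs)) [^] ((- 1) ^ i :: int)"
  have "alternating_sum G \<phi> (x # xs) = finprod G ?f (insert 0 (Suc ` {..<length xs}))"
    by (simp add: alternating_sum_def lessThan_Suc_eq_insert_0)
  also have "\<dots> = ?f 0 \<otimes> finprod G ?f (Suc ` {..<length xs})"
    using assms by (intro finprod_insert) auto
  also have "finprod G ?f (Suc ` {..<length xs}) = finprod G (\<lambda>i. ?f (Suc i)) {..<length xs}"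
    using assms by (intro finprod_reindex) auto
  also have "\<dots> = finprod G (\<lambda>i. inv (\<phi> (x # face i xs) [^] ((- 1) ^ i :: int))) {..<length xs}"
    using assms by (intro finprod_cong') (auto simp: int_pow_neg)
  also have "\<dots> = inv (alternating_sum G (\<lambda>ys. \<phi> (x # ys)) xs)"
    unfolding alternating_sum_def using assms by (intro finprod_inv) auto
  finally show ?thesis using assms by (simp add: int_pow_1)
qed

lemma alternating_sum_cong:
  assumes "\<And>i. i < length xs \<Longrightarrow> \<phi> (face i xs) = \<psi> (face i xs)"
    and "\<And>i. i < length xs \<Longrightarrow> \<psi> (face i xs) \<in> carrier G"
  shows "alternating_sum G \<phi> xs = alternating_sum G \<psi> xs"
  unfolding alternating_sum_def using assms by (intro finprod_cong') auto

lemma alternating_sum_one: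
  assumes "\<And>i. i < length xs \<Longrightarrow> \<phi> (face i xs) = \<one>"
  shows "alternating_sum G \<phi> xs = \<one>"
  unfolding alternating_sum_def using assms by (intro finprod_one_eqI) (auto simp: int_pow_one)

lemma mult_rearrange:
  assumes "a \<in> carrier G" "b \<in> carrier G" "c \<in> carrier G" "e \<in> carrier G"
  shows "a \<otimes> b \<otimes> inv (c \<otimes> e) = (a \<otimes> inv c) \<otimes> (b \<otimes> inv e)"
  using assms by (simp add: inv_mult m_ac)

lemma alternating_sum_mult:
  assumes "\<And>ys. \<phi> ys \<in> carrier G" "\<And>ys. \<psi> ys \<in> carrier G"
  shows "alternating_sum G (\<lambda>ys. \<phi> ys \<otimes> \<psi> ys) xs = alternating_sum G \<phi> xs \<otimes> alternating_sum G \<psi> xs"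
  using assms
  by (induction xs arbitrary: \<phi> \<psi>) (auto simp: alternating_sum_Cons mult_rearrange)

lemma alternating_sum_inv:
  assumes "\<And>ys. \<phi> ys \<in> carrier G"
  shows "alternating_sum G (\<lambda>ys. inv (\<phi> ys)) xs = inv (alternating_sum G \<phi> xs)"
  using assms
  by (induction xs arbitrary: \<phi>) (auto simp: alternating_sum_Cons inv_mult)

lemma alternating_sum_map:
  "alternating_sum G (\<lambda>ys. \<phi> (map p ys)) xs = alternating_sum G \<phi> (map p xs)"
  by (simp add: alternating_sum_def face_map)

text \<open>Peeling off the head x writes the coboundary on \<open>x # ys\<close> as
  \<open>\<phi> ys\<close> divided by the coboundary of \<open>\<phi> (x # _)\<close>. The double
  coboundary of the latter is trivial by induction, and the two copies of the coboundary of
  \<open>\<phi>\<close> that are left cancel.\<close>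

lemma alternating_sum_alternating_sum:
  assumes "\<And>ys. \<phi> ys \<in> carrier G"
  shows "alternating_sum G (alternating_sum G \<phi>) xs = \<one>"
  using assms
proof (induction xs arbitrary: \<phi>)
  case (Cons x xs)
  let ?\<psi> = "\<lambda>ys. \<phi> (x # ys)"
  have "alternating_sum G (\<lambda>ys. alternating_sum G \<phi> (x # ys)) xs =
      alternating_sum G (\<lambda>ys. \<phi> ys \<otimes> inv (alternating_sum G ?\<psi> ys)) xs"
    by (simp add: alternating_sum_Cons Cons.prems)
  also have "\<dots> = alternating_sum G \<phi> xs \<otimes> inv (alternating_sum G (alternating_sum G ?\<psi>) xs)"
    using Cons.prems by (simp add: alternating_sum_mult alternating_sum_inv)
  also have "\<dots> = alternating_sum G \<phi> xs" using Cons.IH[of ?\<psi>] Cons.prems by simp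
  finally show ?case using Cons.prems by (simp add: alternating_sum_Cons[where \<phi> = "alternating_sum G \<phi>"])
qed simp

lemma prism_closed [simp]:
  assumes "\<And>ys. \<phi> ys \<in> carrier G"
  shows "prism G p q xs \<phi> \<in> carrier G"
  using assms by (induction xs arbitrary: \<phi>) auto

lemma prism_mult:
  assumes "\<And>ys. \<phi> ys \<in> carrier G" "\<And>ys. \<psi> ys \<in> carrier G"
  shows "prism G p q xs (\<lambda>ys. \<phi> ys \<otimes> \<psi> ys) = prism G p q xs \<phi> \<otimes> prism G p q xs \<psi>"
  using assms by (induction xs arbitrary: \<phi> \<psi>) (auto simp: mult_rearrange)

lemma prism_inv:
  assumes "\<And>ys. \<phi> ys \<in> carrier G"
  shows "prism G p q xs (\<lambda>ys. inv (\<phi> ys)) = inv (prism G p q xs \<phi>)"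
  using assms by (induction xs arbitrary: \<phi>) (auto simp: inv_mult)

text \<open>The prism evaluates \<open>\<phi>\<close> only at tuples one entry longer, with entries
  in the two images. This locality is what contiguity controls.\<close>

lemma prism_one:
  assumes "\<And>ys. length ys = Suc (length xs) \<Longrightarrow> set ys \<subseteq> p ` set xs \<union> q ` set xs \<Longrightarrow> \<phi> ys = \<one>"
  shows "prism G p q xs \<phi> = \<one>"
  using assms
proof (induction xs arbitrary: \<phi>)
  case (Cons x xs)
  have "prism G p q xs (\<lambda>ys. \<phi> (p x # ys)) = \<one>"
    by (rule Cons.IH, rule Cons.prems) auto
  moreover have "\<phi> (p x # q x # map q xs) = \<one>"
    by (rule Cons.prems) auto
  ultimately show ?case by simp
qed simp

text \<open>The arithmetic of the induction step below. Here w is the prism of the cochain, c the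
  coboundary term occurring in both summands, and \<open>uv\<close> is the induction hypothesis for
  the cochain with \<open>p x\<close> put in front.\<close>

lemma prism_cancellation:
  assumes "a \<in> carrier G" "b \<in> carrier G" "c \<in> carrier G" "e \<in> carrier G" "u \<in> carrier G"
    "v \<in> carrier G" "w \<in> carrier G" and uv: "u \<otimes> v = b \<otimes> inv e"
  shows "(a \<otimes> inv (b \<otimes> inv c)) \<otimes> inv (w \<otimes> inv u) \<otimes> (w \<otimes> inv (c \<otimes> inv v)) = a \<otimes> inv e"
proof -
  have "(a \<otimes> inv (b \<otimes> inv c)) \<otimes> inv (w \<otimes> inv u) \<otimes> (w \<otimes> inv (c \<otimes> inv v)) =
      a \<otimes> inv b \<otimes> (c \<otimes> inv c) \<otimes> (w \<otimes> inv w) \<otimes> (u \<otimes> v)"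
    by (simp only: inv_mult inv_inv m_ac m_closed inv_closed assms(1-7))
  also have "\<dots> = a \<otimes> inv b \<otimes> (b \<otimes> inv e)"
    using assms(1-7) uv by simp
  also have "\<dots> = a \<otimes> (b \<otimes> inv b) \<otimes> inv e"
    by (simp only: m_ac m_closed inv_closed assms(1-7))
  finally show ?thesis using assms by simp
qed

text \<open>In additive notation, P(d \<phi>) + d(P \<phi>) = q* \<phi> - p* \<phi>. It holds for
  arbitrary functions on tuples and arbitrary vertex maps; simplicial hypotheses enter only when the
  first term has to vanish.\<close>

lemma prism_homotopy:
  assumes "\<And>ys. \<phi> ys \<in> carrier G"
  shows "prism G p q xs (alternating_sum G \<phi>) \<otimes> alternating_sum G (\<lambda>ys. prism G p q ys \<phi>) xs =
    \<phi> (map q xs) \<otimes> inv (\<phi> (map p xs))"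
  using assms
proof (induction xs arbitrary: \<phi>)
  case (Cons x xs)
  note [simp] = Cons.prems
  let ?\<psi> = "\<lambda>ys. \<phi> (p x # ys)"
  let ?\<rho> = "\<lambda>ys. \<phi> (p x # q x # ys)"
  have "prism G p q (x # xs) (alternating_sum G \<phi>) =
      alternating_sum G \<phi> (p x # q x # map q xs) \<otimes>
      inv (prism G p q xs (\<lambda>ys. \<phi> ys \<otimes> inv (alternating_sum G ?\<psi> ys)))"
    by (simp add: alternating_sum_Cons)
  also have "alternating_sum G \<phi> (p x # q x # map q xs) =
      \<phi> (q x # map q xs) \<otimes> inv (?\<psi> (map q xs) \<otimes> inv (alternating_sum G ?\<rho> (map q xs)))"
    by (simp add: alternating_sum_Cons)
  also have "prism G p q xs (\<lambda>ys. \<phi> ys \<otimes> inv (alternating_sum G ?\<psi> ys)) =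
      prism G p q xs \<phi> \<otimes> inv (prism G p q xs (alternating_sum G ?\<psi>))"
    by (simp add: prism_mult prism_inv)
  finally have 1: "prism G p q (x # xs) (alternating_sum G \<phi>) =
      \<phi> (q x # map q xs) \<otimes> inv (?\<psi> (map q xs) \<otimes> inv (alternating_sum G ?\<rho> (map q xs))) \<otimes>
      inv (prism G p q xs \<phi> \<otimes> inv (prism G p q xs (alternating_sum G ?\<psi>)))" .
  have "alternating_sum G (\<lambda>ys. prism G p q ys \<phi>) (x # xs) = prism G p q xs \<phi> \<otimes>
      inv (alternating_sum G (\<lambda>ys. ?\<rho> (map q ys) \<otimes> inv (prism G p q ys ?\<psi>)) xs)"
    by (simp add: alternating_sum_Cons)
  also have "alternating_sum G (\<lambda>ys. ?\<rho> (map q ys) \<otimes> inv (prism G p q ys ?\<psi>)) xs =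
      alternating_sum G ?\<rho> (map q xs) \<otimes> inv (alternating_sum G (\<lambda>ys. prism G p q ys ?\<psi>) xs)"
    by (simp add: alternating_sum_mult alternating_sum_inv alternating_sum_map[where \<phi> = ?\<rho>])
  finally have 2: "alternating_sum G (\<lambda>ys. prism G p q ys \<phi>) (x # xs) = prism G p q xs \<phi> \<otimes>
      inv (alternating_sum G ?\<rho> (map q xs) \<otimes> inv (alternating_sum G (\<lambda>ys. prism G p q ys ?\<psi>) xs))" .
  show ?case
    unfolding 1 2 using Cons.IH[of ?\<psi>]
    by (subst prism_cancellation[where e = "?\<psi> (map p xs)"]) auto
qed simp

end

section \<open>Relative cochains of a simplicial pair\<close>

definition simplicial_pair :: "'v set set \<Rightarrow> 'v set set \<Rightarrow> bool" where
  "simplicial_pair K L \<longleftrightarrow> L \<subseteq> K \<and> (\<forall>\<sigma>\<in>K. \<forall>\<tau>\<subseteq>\<sigma>. \<tau> \<noteq> {} \<longrightarrow> \<tau> \<in> K) \<and> (\<forall>\<sigma>\<in>L. \<forall>\<tau>\<subseteq>\<sigma>. \<tau> \<noteq> {} \<longrightarrow> \<tau> \<in> L)"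

lemma face_ordered_simplex:
  assumes "vs \<in> ordered_simplexes (Suc n) K" "i < length vs" "\<forall>\<sigma>\<in>K. \<forall>\<tau>\<subseteq>\<sigma>. \<tau> \<noteq> {} \<longrightarrow> \<tau> \<in> K"
  shows "face i vs \<in> ordered_simplexes n K"
proof -
  have "length (face i vs) = Suc n" using assms by (simp add: length_face ordered_simplexes_def)
  then have "face i vs \<noteq> []" by auto
  then show ?thesis
    using assms set_face_subset[of i vs] \<open>length (face i vs) = Suc n\<close> by (auto simp: ordered_simplexes_def)
qed

lemma ordered_simplexes_mono: "L \<subseteq> K \<Longrightarrow> ordered_simplexes n L \<subseteq> ordered_simplexes n K"
  by (auto simp: ordered_simplexes_def)

lemma carrier_simplicial_relative_cochains:
  "carrier (simplicial_relative_cochains K L G n) =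
    {\<phi> \<in> ordered_simplexes n K \<rightarrow>\<^sub>E carrier G. \<forall>vs\<in>ordered_simplexes n L. \<phi> vs = \<one>\<^bsub>G\<^esub>}"
  by (auto simp: simplicial_relative_cochains_def simplicial_cochains_def kernel_def restrict_def fun_eq_iff)

lemma one_simplicial_relative_cochains:
  "\<one>\<^bsub>simplicial_relative_cochains K L G n\<^esub> = (\<lambda>vs\<in>ordered_simplexes n K. \<one>\<^bsub>G\<^esub>)"
  by (simp add: simplicial_relative_cochains_def simplicial_cochains_def)

lemma mult_simplicial_relative_cochains:
  "\<phi> \<otimes>\<^bsub>simplicial_relative_cochains K L G n\<^esub> \<psi> = (\<lambda>vs\<in>ordered_simplexes n K. \<phi> vs \<otimes>\<^bsub>G\<^esub> \<psi> vs)"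
  by (simp add: simplicial_relative_cochains_def simplicial_cochains_def)

text \<open>Cochains are \<open>undefined\<close> outside their domain, while the identities for
  \<open>alternating_sum\<close> and \<open>prism\<close> ask for values in the group at every list.
  The filled-in values are never seen on faces of simplexes.\<close>

definition extend_by_one :: "('g, 'm) monoid_scheme \<Rightarrow> 'b set \<Rightarrow> ('b \<Rightarrow> 'g) \<Rightarrow> 'b \<Rightarrow> 'g" where
  "extend_by_one G T \<phi> x = (if x \<in> T then \<phi> x else \<one>\<^bsub>G\<^esub>)"

locale coefficients = comm_group G for G :: "('g, 'm) monoid_scheme" (structure)
begin

lemma PiE_const_mem: "f \<in> T \<rightarrow>\<^sub>E B \<Longrightarrow> t \<in> T \<Longrightarrow> f t \<in> B"
  by (rule PiE_mem)

lemma simplicial_cochains_comm_group: "comm_group (simplicial_cochains K G n)"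
proof (rule group.group_comm_groupI)
  show "group (simplicial_cochains K G n)" by (simp add: simplicial_cochains_def is_group)
qed (auto simp: simplicial_cochains_def intro!: restrict_ext m_comm intro: PiE_const_mem)

lemma simplicial_relative_cochains_comm_group:
  assumes "L \<subseteq> K"
  shows "comm_group (simplicial_relative_cochains K L G n)"
proof -
  have "ordered_simplexes n L \<subseteq> ordered_simplexes n K"
    using assms by (rule ordered_simplexes_mono)
  then have "(\<lambda>\<phi>. restrict \<phi> (ordered_simplexes n L)) \<in> hom (simplicial_cochains K G n) (simplicial_cochains L G n)"
    by (intro homI) (auto simp: simplicial_cochains_def subsetD PiE_mem intro!: restrict_ext)
  then have "group_hom (simplicial_cochains K G n) (simplicial_cochains L G n)
      (\<lambda>\<phi>. restrict \<phi> (ordered_simplexes n L))"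
    by (simp add: group_hom_def group_hom_axioms_def comm_group.axioms(2)[OF simplicial_cochains_comm_group])
  then show ?thesis
    unfolding simplicial_relative_cochains_def
    by (intro comm_group.subgroup_comm_group simplicial_cochains_comm_group group_hom.subgroup_kernel)
qed

lemma inv_simplicial_relative_cochains:
  assumes "L \<subseteq> K" "\<phi> \<in> carrier (simplicial_relative_cochains K L G n)"
  shows "inv\<^bsub>simplicial_relative_cochains K L G n\<^esub> \<phi> = (\<lambda>vs\<in>ordered_simplexes n K. inv (\<phi> vs))"
proof (rule group.inv_equality)
  show "group (simplicial_relative_cochains K L G n)"
    using simplicial_relative_cochains_comm_group[OF assms(1)] by (simp add: comm_group_def)
  show "(\<lambda>vs\<in>ordered_simplexes n K. inv (\<phi> vs)) \<otimes>\<^bsub>simplicial_relative_cochains K L G n\<^esub> \<phi> =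
      \<one>\<^bsub>simplicial_relative_cochains K L G n\<^esub>"
    using assms(2)
    by (auto simp: mult_simplicial_relative_cochains one_simplicial_relative_cochains
        carrier_simplicial_relative_cochains intro!: restrict_ext l_inv intro: PiE_const_mem)
  show "(\<lambda>vs\<in>ordered_simplexes n K. inv (\<phi> vs)) \<in> carrier (simplicial_relative_cochains K L G n)"
    using assms(2) ordered_simplexes_mono[OF assms(1), of n]
    by (auto simp: carrier_simplicial_relative_cochains PiE_mem subsetD)
qed (rule assms)

lemma cochain_closed:
  "\<phi> \<in> carrier (simplicial_relative_cochains K L G n) \<Longrightarrow> vs \<in> ordered_simplexes n K \<Longrightarrow> \<phi> vs \<in> carrier G"
  by (auto simp: carrier_simplicial_relative_cochains PiE_mem)

lemma extend_by_one_closed [simp]: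
  "\<phi> \<in> carrier (simplicial_relative_cochains K L G n) \<Longrightarrow>
    extend_by_one G (ordered_simplexes n K) \<phi> ys \<in> carrier G"
  by (simp add: extend_by_one_def cochain_closed)

lemma simplicial_coboundary_eq:
  assumes "simplicial_pair K L" "\<phi> \<in> carrier (simplicial_relative_cochains K L G n)"
    "vs \<in> ordered_simplexes (Suc n) K"
  shows "simplicial_coboundary K G n \<phi> vs = alternating_sum G (extend_by_one G (ordered_simplexes n K) \<phi>) vs"
proof -
  have "face i vs \<in> ordered_simplexes n K" if "i < length vs" for i
    using face_ordered_simplex[OF assms(3) that] assms(1) by (auto simp: simplicial_pair_def)
  then have "alternating_sum G \<phi> vs = alternating_sum G (extend_by_one G (ordered_simplexes n K) \<phi>) vs"
    using assms(2) by (intro alternating_sum_cong) (auto simp: extend_by_one_def cochain_closed)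
  then show ?thesis
    using assms(3) by (simp add: simplicial_coboundary_def coboundary_def alternating_sum_def)
qed

lemma simplicial_coboundary_closed:
  assumes K: "simplicial_pair K L" and \<phi>: "\<phi> \<in> carrier (simplicial_relative_cochains K L G n)"
  shows "simplicial_coboundary K G n \<phi> \<in> carrier (simplicial_relative_cochains K L G (Suc n))"
proof -
  have LK: "ordered_simplexes (Suc n) L \<subseteq> ordered_simplexes (Suc n) K"
    using K by (simp add: simplicial_pair_def ordered_simplexes_mono)
  have "simplicial_coboundary K G n \<phi> vs = \<one>" if vs: "vs \<in> ordered_simplexes (Suc n) L" for vs
  proof -
    have "face i vs \<in> ordered_simplexes n L" if "i < length vs" for i
      using face_ordered_simplex[OF vs that] K by (auto simp: simplicial_pair_def)
    then show ?thesis
      using vs LK \<phi>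
      by (subst simplicial_coboundary_eq[OF K \<phi>]) (auto simp: extend_by_one_def carrier_simplicial_relative_cochains intro!: alternating_sum_one)
  qed
  moreover have "simplicial_coboundary K G n \<phi> \<in> extensional (ordered_simplexes (Suc n) K)"
    by (simp add: simplicial_coboundary_def coboundary_def)
  moreover have "simplicial_coboundary K G n \<phi> vs \<in> carrier G" if "vs \<in> ordered_simplexes (Suc n) K" for vs
    using simplicial_coboundary_eq[OF K \<phi> that] \<phi> by simp
  ultimately show ?thesis
    by (simp add: carrier_simplicial_relative_cochains PiE_def)
qed

lemma simplicial_cochain_complex:
  assumes K: "simplicial_pair K L"
  shows "cochain_complex (simplicial_relative_cochains K L G) (simplicial_coboundary K G)"
proof (rule cochain_complex.intro)
  have LK: "L \<subseteq> K" using K by (simp add: simplicial_pair_def)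
  note comm = simplicial_relative_cochains_comm_group[OF LK]
  have closed: "\<phi> \<otimes>\<^bsub>simplicial_relative_cochains K L G n\<^esub> \<psi> \<in> carrier (simplicial_relative_cochains K L G n)"
    if "\<phi> \<in> carrier (simplicial_relative_cochains K L G n)" "\<psi> \<in> carrier (simplicial_relative_cochains K L G n)"
    for \<phi> \<psi> n
    using that comm by (simp add: comm_group_def group_def monoid.m_closed)
  fix n
  show "comm_group (simplicial_relative_cochains K L G n)" by (rule comm)
  show "simplicial_coboundary K G n \<in>
    hom (simplicial_relative_cochains K L G n) (simplicial_relative_cochains K L G (Suc n))"
  proof (rule homI)
    fix \<phi> \<psi> assume \<phi>: "\<phi> \<in> carrier (simplicial_relative_cochains K L G n)"
      and \<psi>: "\<psi> \<in> carrier (simplicial_relative_cochains K L G n)"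
    let ?e = "extend_by_one G (ordered_simplexes n K)"
    have "?e (\<phi> \<otimes>\<^bsub>simplicial_relative_cochains K L G n\<^esub> \<psi>) = (\<lambda>ys. ?e \<phi> ys \<otimes> ?e \<psi> ys)"
      by (auto simp: extend_by_one_def mult_simplicial_relative_cochains fun_eq_iff)
    then have "simplicial_coboundary K G n (\<phi> \<otimes>\<^bsub>simplicial_relative_cochains K L G n\<^esub> \<psi>) vs =
        simplicial_coboundary K G n \<phi> vs \<otimes> simplicial_coboundary K G n \<psi> vs"
      if "vs \<in> ordered_simplexes (Suc n) K" for vs
      using that \<phi> \<psi> by (simp add: simplicial_coboundary_eq[OF K] closed alternating_sum_mult)
    moreover have "simplicial_coboundary K G n \<rho> \<in> extensional (ordered_simplexes (Suc n) K)" for \<rho>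
      by (simp add: simplicial_coboundary_def coboundary_def)
    ultimately show "simplicial_coboundary K G n (\<phi> \<otimes>\<^bsub>simplicial_relative_cochains K L G n\<^esub> \<psi>) =
      simplicial_coboundary K G n \<phi> \<otimes>\<^bsub>simplicial_relative_cochains K L G (Suc n)\<^esub> simplicial_coboundary K G n \<psi>"
      unfolding mult_simplicial_relative_cochains[of K L G "Suc n"]
      by (intro extensionalityI[of _ "ordered_simplexes (Suc n) K"]) auto
  qed (rule simplicial_coboundary_closed[OF K])
  fix \<phi> assume \<phi>: "\<phi> \<in> carrier (simplicial_relative_cochains K L G n)"
  let ?\<psi> = "simplicial_coboundary K G n \<phi>"
  note \<psi> = simplicial_coboundary_closed[OF K \<phi>]
  have "simplicial_coboundary K G (Suc n) ?\<psi> vs = \<one>" if vs: "vs \<in> ordered_simplexes (Suc (Suc n)) K" for vs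
  proof -
    let ?a = "alternating_sum G (extend_by_one G (ordered_simplexes n K) \<phi>)"
    have "extend_by_one G (ordered_simplexes (Suc n) K) ?\<psi> (face i vs) = ?a (face i vs)" if "i < length vs" for i
      using face_ordered_simplex[OF vs that] K simplicial_coboundary_eq[OF K \<phi>]
      by (auto simp: extend_by_one_def simplicial_pair_def)
    then have "alternating_sum G (extend_by_one G (ordered_simplexes (Suc n) K) ?\<psi>) vs = alternating_sum G ?a vs"
      using \<phi> by (intro alternating_sum_cong) auto
    then show ?thesis
      using simplicial_coboundary_eq[OF K \<psi> vs] \<phi> by (simp add: alternating_sum_alternating_sum)
  qed
  then show "simplicial_coboundary K G (Suc n) ?\<psi> = \<one>\<^bsub>simplicial_relative_cochains K L G (Suc (Suc n))\<^esub>"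
    unfolding one_simplicial_relative_cochains
    by (intro extensionalityI[of _ "ordered_simplexes (Suc (Suc n)) K"])
       (auto simp: simplicial_coboundary_def coboundary_def)
qed

end

section \<open>Pullbacks along simplicial maps and contiguity\<close>

definition simplicial_pair_map ::
    "('w \<Rightarrow> 'v) \<Rightarrow> 'w set set \<Rightarrow> 'w set set \<Rightarrow> 'v set set \<Rightarrow> 'v set set \<Rightarrow> bool" where
  "simplicial_pair_map p K' L' K L \<longleftrightarrow> (\<forall>\<sigma>\<in>K'. p ` \<sigma> \<in> K) \<and> (\<forall>\<sigma>\<in>L'. p ` \<sigma> \<in> L)"

text \<open>Contiguity of maps of pairs: simplexes of the subcomplex must have their joint image in
  the subcomplex, or the prism would leave the relative cochains. With \<open>p = q\<close> it says
  that the map is simplicial, and that is how several maps are shown to be simplicial.\<close>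

definition contiguous ::
    "('w \<Rightarrow> 'v) \<Rightarrow> ('w \<Rightarrow> 'v) \<Rightarrow> 'w set set \<Rightarrow> 'w set set \<Rightarrow> 'v set set \<Rightarrow> 'v set set \<Rightarrow> bool" where
  "contiguous p q K' L' K L \<longleftrightarrow> (\<forall>\<sigma>\<in>K'. p ` \<sigma> \<union> q ` \<sigma> \<in> K) \<and> (\<forall>\<sigma>\<in>L'. p ` \<sigma> \<union> q ` \<sigma> \<in> L)"

definition pullback :: "nat \<Rightarrow> 'w set set \<Rightarrow> ('w \<Rightarrow> 'v) \<Rightarrow> ('v list \<Rightarrow> 'g) \<Rightarrow> 'w list \<Rightarrow> 'g" where
  "pullback n K' p \<phi> = (\<lambda>vs\<in>ordered_simplexes n K'. \<phi> (map p vs))"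

lemma map_ordered_simplex:
  "\<forall>\<sigma>\<in>K'. p ` \<sigma> \<in> K \<Longrightarrow> vs \<in> ordered_simplexes n K' \<Longrightarrow> map p vs \<in> ordered_simplexes n K"
  by (simp add: ordered_simplexes_def)

lemma pullback_pullback:
  assumes "\<forall>\<sigma>\<in>K''. p ` \<sigma> \<in> K'"
  shows "pullback n K'' p (pullback n K' q \<phi>) = pullback n K'' (q \<circ> p) \<phi>"
  using map_ordered_simplex[OF assms] by (auto simp: pullback_def intro!: restrict_ext)

context coefficients
begin

lemma pullback_closed:
  assumes "simplicial_pair_map p K' L' K L" "L' \<subseteq> K'"
    and \<phi>: "\<phi> \<in> carrier (simplicial_relative_cochains K L G n)"
  shows "pullback n K' p \<phi> \<in> carrier (simplicial_relative_cochains K' L' G n)"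
proof -
  have m: "map p vs \<in> ordered_simplexes n K" if "vs \<in> ordered_simplexes n K'" for vs
    using map_ordered_simplex[of K' p K vs n] assms(1) that by (simp add: simplicial_pair_map_def)
  have m': "map p vs \<in> ordered_simplexes n L" if "vs \<in> ordered_simplexes n L'" for vs
    using map_ordered_simplex[of L' p L vs n] assms(1) that by (simp add: simplicial_pair_map_def)
  have "\<phi> (map p vs) \<in> carrier G" if "vs \<in> ordered_simplexes n K'" for vs
    using cochain_closed[OF \<phi> m[OF that]] .
  then show ?thesis
    using m' \<phi> ordered_simplexes_mono[OF assms(2), of n]
    by (auto simp: carrier_simplicial_relative_cochains pullback_def)
qed

lemma pullback_hom:
  assumes "simplicial_pair_map p K' L' K L" "L' \<subseteq> K'"
  shows "pullback n K' p \<in> hom (simplicial_relative_cochains K L G n) (simplicial_relative_cochains K' L' G n)"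
proof (rule homI)
  have m: "map p vs \<in> ordered_simplexes n K" if "vs \<in> ordered_simplexes n K'" for vs
    using map_ordered_simplex[of K' p K vs n] assms(1) that by (simp add: simplicial_pair_map_def)
  fix \<phi> \<psi>
  show "pullback n K' p (\<phi> \<otimes>\<^bsub>simplicial_relative_cochains K L G n\<^esub> \<psi>) =
      pullback n K' p \<phi> \<otimes>\<^bsub>simplicial_relative_cochains K' L' G n\<^esub> pullback n K' p \<psi>"
    by (auto simp: mult_simplicial_relative_cochains pullback_def m intro!: restrict_ext)
qed (rule pullback_closed[OF assms])

lemma pullback_coboundary:
  assumes K: "simplicial_pair K L" and K': "simplicial_pair K' L'" and p: "simplicial_pair_map p K' L' K L"
    and \<phi>: "\<phi> \<in> carrier (simplicial_relative_cochains K L G n)"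
  shows "simplicial_coboundary K' G n (pullback n K' p \<phi>) = pullback (Suc n) K' p (simplicial_coboundary K G n \<phi>)"
proof (rule extensionalityI[of _ "ordered_simplexes (Suc n) K'"])
  show "simplicial_coboundary K' G n (pullback n K' p \<phi>) \<in> extensional (ordered_simplexes (Suc n) K')"
    by (simp add: simplicial_coboundary_def coboundary_def)
  show "pullback (Suc n) K' p (simplicial_coboundary K G n \<phi>) \<in> extensional (ordered_simplexes (Suc n) K')"
    by (simp add: pullback_def)
  fix vs assume vs: "vs \<in> ordered_simplexes (Suc n) K'"
  have pK: "\<forall>\<sigma>\<in>K'. p ` \<sigma> \<in> K" using p by (simp add: simplicial_pair_map_def)
  have f: "face i vs \<in> ordered_simplexes n K'" if "i < length vs" for i
    using face_ordered_simplex[OF vs that] K' by (auto simp: simplicial_pair_def)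
  have "simplicial_coboundary K' G n (pullback n K' p \<phi>) vs = alternating_sum G (pullback n K' p \<phi>) vs"
    using vs by (simp add: simplicial_coboundary_def coboundary_def alternating_sum_def)
  also have "\<dots> = alternating_sum G (\<lambda>ys. \<phi> (map p ys)) vs"
    using f cochain_closed[OF \<phi> map_ordered_simplex[OF pK f]]
    by (intro alternating_sum_cong) (auto simp: pullback_def)
  also have "\<dots> = simplicial_coboundary K G n \<phi> (map p vs)"
    using map_ordered_simplex[OF pK vs] unfolding alternating_sum_map
    by (simp add: simplicial_coboundary_def coboundary_def alternating_sum_def)
  finally show "simplicial_coboundary K' G n (pullback n K' p \<phi>) vs =
      pullback (Suc n) K' p (simplicial_coboundary K G n \<phi>) vs"
    using vs by (simp add: pullback_def)
qed

abbreviation relative_cocycles :: "'v set set \<Rightarrow> 'v set set \<Rightarrow> nat \<Rightarrow> ('v list \<Rightarrow> 'g) set" where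
  "relative_cocycles K L \<equiv> cocycles (simplicial_relative_cochains K L G) (simplicial_coboundary K G)"

abbreviation relative_coboundaries :: "'v set set \<Rightarrow> 'v set set \<Rightarrow> nat \<Rightarrow> ('v list \<Rightarrow> 'g) set" where
  "relative_coboundaries K L \<equiv> coboundaries (simplicial_relative_cochains K L G) (simplicial_coboundary K G)"

abbreviation relative_class :: "'v set set \<Rightarrow> 'v set set \<Rightarrow> nat \<Rightarrow> ('v list \<Rightarrow> 'g) \<Rightarrow> ('v list \<Rightarrow> 'g) set" where
  "relative_class K L \<equiv> cohomology_class (simplicial_relative_cochains K L G) (simplicial_coboundary K G)"

lemma pullback_one:
  assumes "simplicial_pair K L" "simplicial_pair K' L'" "simplicial_pair_map p K' L' K L"
  shows "pullback n K' p \<one>\<^bsub>simplicial_relative_cochains K L G n\<^esub> = \<one>\<^bsub>simplicial_relative_cochains K' L' G n\<^esub>"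
  using assms map_ordered_simplex[of K' p K _ n]
  by (auto simp: pullback_def one_simplicial_relative_cochains simplicial_pair_map_def intro!: restrict_ext)

lemma pullback_cocycle:
  assumes K: "simplicial_pair K L" and K': "simplicial_pair K' L'" and p: "simplicial_pair_map p K' L' K L"
    and z: "z \<in> relative_cocycles K L n"
  shows "pullback n K' p z \<in> relative_cocycles K' L' n"
proof -
  have "L' \<subseteq> K'" using K' by (simp add: simplicial_pair_def)
  with z show ?thesis
    using pullback_closed[OF p] pullback_coboundary[OF K K' p, of z n] pullback_one[OF K K' p, of "Suc n"]
    by (simp add: cocycles_def kernel_def)
qed

lemma pullback_coboundaries:
  assumes K: "simplicial_pair K L" and K': "simplicial_pair K' L'" and p: "simplicial_pair_map p K' L' K L"
  shows "pullback n K' p ` relative_coboundaries K L n \<subseteq> relative_coboundaries K' L' n"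
proof (cases n)
  case 0
  then show ?thesis using pullback_one[OF K K' p, of 0] by (simp add: coboundaries_def)
next
  case (Suc m)
  have "L' \<subseteq> K'" using K' by (simp add: simplicial_pair_def)
  then show ?thesis
    using Suc pullback_closed[OF p, of _ m] pullback_coboundary[OF K K' p, of _ m, symmetric]
    by (auto simp: coboundaries_def)
qed

lemma simplicial_cohomology_map_class:
  assumes K: "simplicial_pair K L" and K': "simplicial_pair K' L'" and p: "simplicial_pair_map p K' L' K L"
    and z: "z \<in> relative_cocycles K L n"
  shows "simplicial_cohomology_map n K' L' G p (relative_class K L n z) = relative_class K' L' n (pullback n K' p z)"
proof -
  have "L' \<subseteq> K'" using K' by (simp add: simplicial_pair_def)
  from induced_on_cohomology_class[OF simplicial_cochain_complex[OF K] simplicial_cochain_complex[OF K']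
      pullback_hom[OF p this] pullback_coboundaries[OF K K' p] z]
  show ?thesis by (simp add: simplicial_cohomology_map_def pullback_def[abs_def])
qed

text \<open>The homotopy formula for the cocycle z, extended by one: its coboundary is trivial
  wherever the prism looks, so the two pullbacks differ by the coboundary of the prism of z.\<close>

lemma contiguous_pullback:
  assumes K: "simplicial_pair K L" and K': "simplicial_pair K' L'"
    and p: "simplicial_pair_map p K' L' K L" and q: "simplicial_pair_map q K' L' K L"
    and contig: "contiguous p q K' L' K L" and z: "z \<in> relative_cocycles K L n"
  shows "pullback n K' q z \<otimes>\<^bsub>simplicial_relative_cochains K' L' G n\<^esub>
    inv\<^bsub>simplicial_relative_cochains K' L' G n\<^esub> (pullback n K' p z) \<in> relative_coboundaries K' L' n"
proof -
  let ?e = "extend_by_one G (ordered_simplexes n K) z"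
  let ?P = "\<lambda>xs. prism G p q xs ?e"
  have LK': "L' \<subseteq> K'" using K' by (simp add: simplicial_pair_def)
  have zc: "z \<in> carrier (simplicial_relative_cochains K L G n)"
    and dz: "simplicial_coboundary K G n z = \<one>\<^bsub>simplicial_relative_cochains K L G (Suc n)\<^esub>"
    using z by (auto simp: cocycles_def kernel_def)
  have sub: "ys \<in> ordered_simplexes m K"
    if "vs \<in> ordered_simplexes k K'" "length ys = Suc m" "set ys \<subseteq> p ` set vs \<union> q ` set vs" for ys vs m k
  proof -
    have "p ` set vs \<union> q ` set vs \<in> K" using that(1) contig by (simp add: ordered_simplexes_def contiguous_def)
    moreover have "set ys \<noteq> {}" using that(2) by auto
    ultimately have "set ys \<in> K" using that(3) K unfolding simplicial_pair_def by blast
    then show ?thesis using that(2) by (simp add: ordered_simplexes_def)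
  qed
  have subL: "ys \<in> ordered_simplexes m L"
    if "vs \<in> ordered_simplexes k L'" "length ys = Suc m" "set ys \<subseteq> p ` set vs \<union> q ` set vs" for ys vs m k
  proof -
    have "p ` set vs \<union> q ` set vs \<in> L" using that(1) contig by (simp add: ordered_simplexes_def contiguous_def)
    moreover have "set ys \<noteq> {}" using that(2) by auto
    ultimately have "set ys \<in> L" using that(3) K unfolding simplicial_pair_def by blast
    then show ?thesis using that(2) by (simp add: ordered_simplexes_def)
  qed
  have homotopy: "alternating_sum G ?P vs = z (map q vs) \<otimes> inv (z (map p vs))"
    if vs: "vs \<in> ordered_simplexes n K'" for vs
  proof -
    have len: "length vs = Suc n" using vs by (simp add: ordered_simplexes_def)
    \<comment> \<open>By contiguity such a tuple spans a simplex of \<open>K\<close>, where the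
      extension agrees with z and the cocycle condition applies.\<close>
    have "alternating_sum G ?e ys = \<one>"
      if "length ys = Suc (length vs)" "set ys \<subseteq> p ` set vs \<union> q ` set vs" for ys
    proof -
      have "ys \<in> ordered_simplexes (Suc n) K" using sub[OF vs _ that(2)] that(1) len by simp
      then show ?thesis
        using simplicial_coboundary_eq[OF K zc, of ys] dz by (simp add: one_simplicial_relative_cochains)
    qed
    then have "prism G p q vs (alternating_sum G ?e) = \<one>" by (intro prism_one)
    moreover have "map p vs \<in> ordered_simplexes n K" "map q vs \<in> ordered_simplexes n K"
      using sub[OF vs] len by auto
    ultimately show ?thesis
      using prism_homotopy[where \<phi> = ?e, OF extend_by_one_closed[OF zc], of p q vs] zc
      by (simp add: extend_by_one_def[of G _ z "map _ _"])
  qed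
  have eq: "pullback n K' q z \<otimes>\<^bsub>simplicial_relative_cochains K' L' G n\<^esub>
      inv\<^bsub>simplicial_relative_cochains K' L' G n\<^esub> (pullback n K' p z) =
      (\<lambda>vs\<in>ordered_simplexes n K'. z (map q vs) \<otimes> inv (z (map p vs)))"
    unfolding inv_simplicial_relative_cochains[OF LK' pullback_closed[OF p LK' zc]] mult_simplicial_relative_cochains
    by (auto simp: pullback_def intro!: restrict_ext)
  show ?thesis
  proof (cases n)
    case 0
    \<comment> \<open>The only face of a one-vertex tuple is empty, and the prism of the empty tuple
      is one. So in degree 0 the two pullbacks are equal, as they must be: the only coboundary there
      is the unit.\<close>
    have "alternating_sum G ?P vs = \<one>" if "vs \<in> ordered_simplexes n K'" for vs
      using that 0 by (intro alternating_sum_one) (auto simp: ordered_simplexes_def face_def length_Suc_conv)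
    then have "z (map q vs) \<otimes> inv (z (map p vs)) = \<one>" if "vs \<in> ordered_simplexes n K'" for vs
      using homotopy[OF that] that by simp
    then show ?thesis
      unfolding eq using 0 by (auto simp: coboundaries_def one_simplicial_relative_cochains intro!: restrict_ext)
  next
    case (Suc m)
    let ?b = "\<lambda>vs\<in>ordered_simplexes m K'. ?P vs"
    have LK'm: "ordered_simplexes m L' \<subseteq> ordered_simplexes m K'" using ordered_simplexes_mono[OF LK'] .
    \<comment> \<open>The half of contiguity concerning \<open>L'\<close> makes the prism of z a
      relative cochain: it only evaluates z on simplexes of \<open>L\<close>.\<close>
    have "?P vs = \<one>" if "vs \<in> ordered_simplexes m L'" for vs
    proof (rule prism_one)
      fix ys assume "length ys = Suc (length vs)" "set ys \<subseteq> p ` set vs \<union> q ` set vs"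
      then have "ys \<in> ordered_simplexes n L"
        using subL[OF that] that Suc by (simp add: ordered_simplexes_def)
      then show "?e ys = \<one>" using zc by (simp add: extend_by_one_def carrier_simplicial_relative_cochains)
    qed
    then have b: "?b \<in> carrier (simplicial_relative_cochains K' L' G m)"
      using zc LK'm by (auto simp: carrier_simplicial_relative_cochains[of K' L'])
    have "simplicial_coboundary K' G m ?b vs = z (map q vs) \<otimes> inv (z (map p vs))"
      if vs: "vs \<in> ordered_simplexes n K'" for vs
    proof -
      have f: "face i vs \<in> ordered_simplexes m K'" if "i < length vs" for i
        using face_ordered_simplex[of vs m K' i] vs Suc that K' by (auto simp: simplicial_pair_def)
      have "simplicial_coboundary K' G m ?b vs = alternating_sum G ?b vs"
        using vs Suc by (simp add: simplicial_coboundary_def coboundary_def alternating_sum_def)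
      also have "\<dots> = alternating_sum G ?P vs"
        using f zc by (intro alternating_sum_cong) auto
      finally show ?thesis using homotopy[OF vs] by simp
    qed
    then have "simplicial_coboundary K' G m ?b = (\<lambda>vs\<in>ordered_simplexes n K'. z (map q vs) \<otimes> inv (z (map p vs)))"
      using Suc by (intro extensionalityI[of _ "ordered_simplexes n K'"])
        (auto simp: simplicial_coboundary_def coboundary_def)
    then show ?thesis unfolding eq using b Suc by (auto simp: coboundaries_def intro: rev_image_eqI)
  qed
qed

lemma contiguous_class_eq:
  assumes K: "simplicial_pair K L" and K': "simplicial_pair K' L'"
    and p: "simplicial_pair_map p K' L' K L" and q: "simplicial_pair_map q K' L' K L"
    and contig: "contiguous p q K' L' K L" and z: "z \<in> relative_cocycles K L n"
  shows "relative_class K' L' n (pullback n K' q z) = relative_class K' L' n (pullback n K' p z)"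
  using contiguous_pullback[OF assms] pullback_cocycle[OF K K' p z] pullback_cocycle[OF K K' q z]
  by (simp add: cochain_complex.cohomology_class_eq_iff[OF simplicial_cochain_complex[OF K']])

end

section \<open>Vietoris complexes and nerves\<close>

text \<open>\<open>S\<close> is \<open>UNIV\<close> for the space and \<open>A\<close> for the
  subspace. It constrains the vertices only: the centre z ranges over the whole space in both cases,
  so that the complex for \<open>A\<close> consists exactly of the simplexes of the full complex
  with vertices in \<open>A\<close>.\<close>

definition vietoris :: "'a topology \<Rightarrow> 'a set set \<Rightarrow> 'a set \<Rightarrow> 'a set set" where
  "vietoris X \<beta> S = {\<sigma>. finite \<sigma> \<and> \<sigma> \<noteq> {} \<and> (\<exists>z\<in>topspace X. \<sigma> \<subseteq> star \<beta> z \<inter> S)}"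

lemma vietoris_simplicial_pair: "simplicial_pair (vietoris X \<beta> UNIV) (vietoris X \<beta> A)"
  unfolding simplicial_pair_def vietoris_def by (auto intro: finite_subset; blast)

lemma vietoris_mono: "refinement_of \<gamma> \<beta> \<Longrightarrow> vietoris X \<gamma> S \<subseteq> vietoris X \<beta> S"
  using star_mono[of \<gamma> \<beta>] unfolding vietoris_def by blast

lemma ordered_simplexes_finite_subsets: "ordered_simplexes n (finite_subsets S) = tuples n S"
  by (auto simp: ordered_simplexes_def finite_subsets_def tuples_def)

lemma finite_subsets_simplicial_pair: "simplicial_pair (finite_subsets S) {}"
  unfolding simplicial_pair_def finite_subsets_def by (auto intro: finite_subset)

lemma ordered_simplexes_empty [simp]: "ordered_simplexes n {} = {}"
  by (simp add: ordered_simplexes_def)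

text \<open>Functions on all tuples of points are the simplicial cochains of the full complex on the
  points, relative to the empty subcomplex. The complex and its maps are thus covered by the
  simplicial lemmas.\<close>

lemma AS_cochains_eq:
  "AS_cochains X G n = simplicial_relative_cochains (finite_subsets (topspace X)) {} G n"
  by (simp add: AS_cochains_def simplicial_relative_cochains_def simplicial_cochains_def kernel_def
      ordered_simplexes_finite_subsets product_group_def restrict_def)

lemma AS_coboundary_eq: "AS_coboundary X G n = simplicial_coboundary (finite_subsets (topspace X)) G n"
  by (simp add: AS_coboundary_def simplicial_coboundary_def ordered_simplexes_finite_subsets)

lemma nerve_simplicial_pair: "simplicial_pair (nerve \<alpha>) (nerve_meeting \<alpha> A)"
proof -
  have "\<Inter>\<sigma> \<subseteq> \<Inter>\<tau>" if "\<tau> \<subseteq> \<sigma>" for \<sigma> \<tau> :: "'a set set" using that by blast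
  note anti = this
  have nerve: "\<tau> \<in> nerve \<alpha>" if "\<sigma> \<in> nerve \<alpha>" "\<tau> \<subseteq> \<sigma>" "\<tau> \<noteq> {}" for \<sigma> \<tau>
  proof -
    have "finite \<tau>" using that finite_subset by (auto simp: nerve_def)
    moreover have "\<Inter>\<tau> \<noteq> {}" using that(1) anti[OF that(2)] unfolding nerve_def by blast
    ultimately show ?thesis using that unfolding nerve_def by blast
  qed
  have meeting: "\<tau> \<in> nerve_meeting \<alpha> A" if "\<sigma> \<in> nerve_meeting \<alpha> A" "\<tau> \<subseteq> \<sigma>" "\<tau> \<noteq> {}" for \<sigma> \<tau>
    using that nerve[of \<sigma> \<tau>] anti[OF that(2)] unfolding nerve_meeting_def by blast
  have "nerve_meeting \<alpha> A \<subseteq> nerve \<alpha>" by (auto simp: nerve_meeting_def)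
  moreover have "\<forall>\<sigma>\<in>nerve \<alpha>. \<forall>\<tau>\<subseteq>\<sigma>. \<tau> \<noteq> {} \<longrightarrow> \<tau> \<in> nerve \<alpha>"
    by (intro ballI allI impI) (erule nerve)
  moreover have "\<forall>\<sigma>\<in>nerve_meeting \<alpha> A. \<forall>\<tau>\<subseteq>\<sigma>. \<tau> \<noteq> {} \<longrightarrow> \<tau> \<in> nerve_meeting \<alpha> A"
    by (intro ballI allI impI) (erule meeting)
  ultimately show ?thesis by (simp only: simplicial_pair_def simp_thms)
qed

section \<open>Vertex maps between nerves\<close>

lemma projection:
  assumes "refinement_of \<beta> \<alpha>" "V \<in> \<beta>"
  shows "projection \<alpha> V \<in> \<alpha>" "V \<subseteq> projection \<alpha> V"
proof -
  have "\<exists>U. U \<in> \<alpha> \<and> V \<subseteq> U" using assms by (auto simp: refinement_of_def)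
  from someI_ex[OF this] show "projection \<alpha> V \<in> \<alpha>" "V \<subseteq> projection \<alpha> V" by (auto simp: projection_def)
qed

text \<open>Made to include, besides the chosen projections, their composites and the round trip
  through points, \<open>star_projection \<alpha> \<beta> \<circ> sample A\<close>.\<close>

definition enlarging :: "('a set \<Rightarrow> 'a set) \<Rightarrow> 'a set set \<Rightarrow> 'a set set \<Rightarrow> bool" where
  "enlarging p \<gamma> \<alpha> \<longleftrightarrow> (\<forall>V\<in>\<gamma>. V \<noteq> {} \<longrightarrow> p V \<in> \<alpha> \<and> V \<subseteq> p V)"

lemma enlarging_projection: "refinement_of \<beta> \<alpha> \<Longrightarrow> enlarging (projection \<alpha>) \<beta> \<alpha>"
  by (simp add: enlarging_def projection)

lemma enlarging_comp: "enlarging p \<gamma> \<beta> \<Longrightarrow> enlarging q \<beta> \<alpha> \<Longrightarrow> enlarging (q \<circ> p) \<gamma> \<alpha>"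
  unfolding enlarging_def by (auto; blast)

text \<open>A common point of the members of a simplex stays in all their enlargements under both
  maps, and it stays in \<open>A\<close> if it was there.\<close>

lemma enlarging_contiguous:
  assumes "enlarging p \<gamma> \<alpha>" "enlarging q \<gamma> \<alpha>"
  shows "contiguous p q (nerve \<gamma>) (nerve_meeting \<gamma> A) (nerve \<alpha>) (nerve_meeting \<alpha> A)"
proof -
  have *: "p ` \<sigma> \<union> q ` \<sigma> \<in> nerve \<alpha> \<and> \<Inter>\<sigma> \<subseteq> \<Inter>(p ` \<sigma> \<union> q ` \<sigma>)" if \<sigma>: "\<sigma> \<in> nerve \<gamma>" for \<sigma>
  proof -
    have pq: "p V \<in> \<alpha> \<and> V \<subseteq> p V \<and> q V \<in> \<alpha> \<and> V \<subseteq> q V" if "V \<in> \<sigma>" for V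
    proof -
      have "V \<in> \<gamma>" "V \<noteq> {}" using \<sigma> that by (auto simp: nerve_def)
      then show ?thesis using assms by (auto simp: enlarging_def)
    qed
    then have sub: "\<Inter>\<sigma> \<subseteq> \<Inter>(p ` \<sigma> \<union> q ` \<sigma>)" by blast
    have "\<Inter>\<sigma> \<noteq> {}" using \<sigma> by (simp add: nerve_def)
    with sub have "\<Inter>(p ` \<sigma> \<union> q ` \<sigma>) \<noteq> {}" by (metis subset_empty)
    then show ?thesis using \<sigma> sub pq by (auto simp: nerve_def simp del: Inter_Un_distrib)
  qed
  then show ?thesis unfolding contiguous_def nerve_meeting_def by blast
qed

lemma simplicial_pair_map_contiguous: "contiguous p p K' L' K L \<Longrightarrow> simplicial_pair_map p K' L' K L"
  by (simp add: contiguous_def simplicial_pair_map_def)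

lemma enlarging_simplicial: "enlarging p \<gamma> \<alpha> \<Longrightarrow>
    simplicial_pair_map p (nerve \<gamma>) (nerve_meeting \<gamma> A) (nerve \<alpha>) (nerve_meeting \<alpha> A)"
  using enlarging_contiguous simplicial_pair_map_contiguous by blast

section \<open>Vertex maps between nerves and Vietoris complexes\<close>

text \<open>Points of \<open>A\<close> are preferred so that the map respects pairs: if members have
  a common point in \<open>A\<close>, each of them meets \<open>A\<close> and all chosen points lie
  in \<open>A\<close>.\<close>

definition sample :: "'a set \<Rightarrow> 'a set \<Rightarrow> 'a" where
  "sample A U = (SOME x. x \<in> U \<and> (U \<inter> A \<noteq> {} \<longrightarrow> x \<in> A))"

lemma sample:
  assumes "U \<noteq> {}"
  shows "sample A U \<in> U" "U \<inter> A \<noteq> {} \<Longrightarrow> sample A U \<in> A"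
proof -
  have "\<exists>x. x \<in> U \<and> (U \<inter> A \<noteq> {} \<longrightarrow> x \<in> A)" using assms by blast
  from someI_ex[OF this] show "sample A U \<in> U" "U \<inter> A \<noteq> {} \<Longrightarrow> sample A U \<in> A"
    by (auto simp: sample_def)
qed

text \<open>Covers both \<open>sample A\<close> and \<open>sample A\<close> after an enlarging map,
  where the chosen point may lie outside U. The member W containing U and the point places the point
  in the star of every z in U.\<close>

definition near_point_map :: "'a set \<Rightarrow> ('a set \<Rightarrow> 'a) \<Rightarrow> 'a set set \<Rightarrow> 'a set set \<Rightarrow> bool" where
  "near_point_map A p \<gamma> \<beta> \<longleftrightarrow>
     (\<forall>U\<in>\<gamma>. U \<noteq> {} \<longrightarrow> (\<exists>W\<in>\<beta>. U \<subseteq> W \<and> p U \<in> W) \<and> (U \<inter> A \<noteq> {} \<longrightarrow> p U \<in> A))"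

lemma near_point_mapD:
  assumes "near_point_map A p \<gamma> \<beta>" "U \<in> \<gamma>" "z \<in> U"
  shows "p U \<in> star \<beta> z" "z \<in> A \<Longrightarrow> p U \<in> A"
proof -
  have p: "(\<exists>W\<in>\<beta>. U \<subseteq> W \<and> p U \<in> W) \<and> (U \<inter> A \<noteq> {} \<longrightarrow> p U \<in> A)"
    using assms unfolding near_point_map_def by force
  then obtain W where "W \<in> \<beta>" "U \<subseteq> W" "p U \<in> W" by (elim conjE bexE)
  with assms(3) show "p U \<in> star \<beta> z" by (auto simp: star_def)
  show "p U \<in> A" if "z \<in> A"
    using conjunct2[OF p] that assms(3) by (metis IntI empty_iff)
qed

text \<open>Any common point z of a simplex of the nerve serves as centre: all images under both
  maps lie in its star.\<close>

lemma near_point_map_contiguous: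
  assumes \<gamma>: "normal_covering X \<gamma>" and p: "near_point_map A p \<gamma> \<beta>" and q: "near_point_map A q \<gamma> \<beta>"
  shows "contiguous p q (nerve \<gamma>) (nerve_meeting \<gamma> A) (vietoris X \<beta> UNIV) (vietoris X \<beta> A)"
proof -
  have *: "p ` \<sigma> \<union> q ` \<sigma> \<in> vietoris X \<beta> S"
    if \<sigma>: "\<sigma> \<in> nerve \<gamma>" "z \<in> \<Inter>\<sigma>" and S: "S = UNIV \<or> (S = A \<and> z \<in> A)" for \<sigma> z S
  proof -
    have fin: "finite \<sigma>" "\<sigma> \<noteq> {}" using \<sigma> by (auto simp: nerve_def)
    have U: "U \<in> \<gamma> \<and> z \<in> U" if "U \<in> \<sigma>" for U
      using \<sigma> that by (auto simp: nerve_def)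
    have "p U \<in> star \<beta> z \<inter> S \<and> q U \<in> star \<beta> z \<inter> S" if "U \<in> \<sigma>" for U
      using near_point_mapD[OF p, of U z] near_point_mapD[OF q, of U z] U[OF that] S by auto
    then have "p ` \<sigma> \<union> q ` \<sigma> \<subseteq> star \<beta> z \<inter> S" by auto
    moreover have "z \<in> topspace X" using fin(2) U normal_covering_subset_topspace[OF \<gamma>] by auto
    ultimately show ?thesis using fin unfolding vietoris_def by auto
  qed
  show ?thesis
    unfolding contiguous_def
  proof (intro conjI ballI)
    fix \<sigma> assume \<sigma>: "\<sigma> \<in> nerve \<gamma>"
    then have "\<exists>z. z \<in> \<Inter>\<sigma>" by (auto simp: nerve_def)
    with *[OF \<sigma>, of _ UNIV] show "p ` \<sigma> \<union> q ` \<sigma> \<in> vietoris X \<beta> UNIV" by auto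
  next
    fix \<sigma> assume "\<sigma> \<in> nerve_meeting \<gamma> A"
    then have \<sigma>: "\<sigma> \<in> nerve \<gamma>" and "\<exists>z. z \<in> \<Inter>\<sigma> \<and> z \<in> A" by (auto simp: nerve_meeting_def)
    with *[OF \<sigma>, of _ A] show "p ` \<sigma> \<union> q ` \<sigma> \<in> vietoris X \<beta> A" by auto
  qed
qed

lemma near_point_map_sample: "refinement_of \<gamma> \<beta> \<Longrightarrow> near_point_map A (sample A) \<gamma> \<beta>"
  unfolding near_point_map_def refinement_of_def using sample by (metis subsetD)

lemma near_point_map_sample_enlarging:
  assumes "enlarging p \<gamma> \<beta>"
  shows "near_point_map A (sample A \<circ> p) \<gamma> \<beta>"
  unfolding near_point_map_def
proof (intro ballI impI)
  fix U assume "U \<in> \<gamma>" "U \<noteq> {}"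
  then have "p U \<in> \<beta>" "U \<subseteq> p U" "p U \<noteq> {}" using assms by (auto simp: enlarging_def)
  then show "(\<exists>W\<in>\<beta>. U \<subseteq> W \<and> (sample A \<circ> p) U \<in> W) \<and> (U \<inter> A \<noteq> {} \<longrightarrow> (sample A \<circ> p) U \<in> A)"
    using sample[of "p U" A] by auto
qed

lemma sample_simplicial:
  assumes "normal_covering X \<gamma>" "refinement_of \<gamma> \<beta>"
  shows "simplicial_pair_map (sample A) (nerve \<gamma>) (nerve_meeting \<gamma> A) (vietoris X \<beta> UNIV) (vietoris X \<beta> A)"
  using near_point_map_contiguous[OF assms(1)] near_point_map_sample[OF assms(2)]
    simplicial_pair_map_contiguous by blast

definition star_projection :: "'a set set \<Rightarrow> 'a set set \<Rightarrow> 'a \<Rightarrow> 'a set" where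
  "star_projection \<alpha> \<beta> x = (SOME U. U \<in> \<alpha> \<and> star \<beta> x \<subseteq> U)"

lemma star_projection:
  assumes "point_star_refinement X \<beta> \<alpha>" "x \<in> topspace X"
  shows "star_projection \<alpha> \<beta> x \<in> \<alpha>" "star \<beta> x \<subseteq> star_projection \<alpha> \<beta> x"
proof -
  have "\<exists>U. U \<in> \<alpha> \<and> star \<beta> x \<subseteq> U" using assms by (auto simp: point_star_refinement_def)
  from someI_ex[OF this] show "star_projection \<alpha> \<beta> x \<in> \<alpha>" "star \<beta> x \<subseteq> star_projection \<alpha> \<beta> x"
    by (auto simp: star_projection_def)
qed

text \<open>Two successive star refinements are needed: the star of the centre z in
  \<open>\<gamma>\<close> lies in one V of \<open>\<beta>\<close>, and V lies in the star in
  \<open>\<beta>\<close> of each vertex x, hence in the set assigned to x. So each assigned set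
  contains all vertices, and the vertices themselves witness that the assigned sets intersect,
  inside \<open>A\<close> if the simplex does.\<close>

lemma star_projection_vietoris:
  assumes "normal_covering X \<gamma>" "point_star_refinement X \<gamma> \<beta>" "point_star_refinement X \<beta> \<alpha>"
    and \<sigma>: "\<sigma> \<in> vietoris X \<gamma> S"
  shows "\<sigma> \<subseteq> topspace X" "\<sigma> \<subseteq> S" "star_projection \<alpha> \<beta> ` \<sigma> \<subseteq> \<alpha>" "\<sigma> \<subseteq> \<Inter>(star_projection \<alpha> \<beta> ` \<sigma>)"
proof -
  obtain z where z: "z \<in> topspace X" "\<sigma> \<subseteq> star \<gamma> z" "\<sigma> \<subseteq> S" using \<sigma> by (auto simp: vietoris_def)
  show S: "\<sigma> \<subseteq> S" by fact
  show X: "\<sigma> \<subseteq> topspace X" using z star_subset_topspace[OF assms(1)] by blast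
  then show "star_projection \<alpha> \<beta> ` \<sigma> \<subseteq> \<alpha>" using star_projection(1)[OF assms(3)] by blast
  obtain V where V: "V \<in> \<beta>" "star \<gamma> z \<subseteq> V" using assms(2) z(1) by (auto simp: point_star_refinement_def)
  have "V \<subseteq> star_projection \<alpha> \<beta> x" if x: "x \<in> \<sigma>" for x
  proof -
    have "x \<in> V" using x V(2) z(2) by (meson subsetD)
    then have "V \<subseteq> star \<beta> x" using V(1) by (auto simp: star_def)
    moreover have "x \<in> topspace X" using x X by (rule rev_subsetD)
    ultimately show ?thesis using star_projection(2)[OF assms(3), of x] by (meson order_trans)
  qed
  then show "\<sigma> \<subseteq> \<Inter>(star_projection \<alpha> \<beta> ` \<sigma>)" using V z(2) by blast
qed

lemma star_projection_simplicial:
  assumes "normal_covering X \<gamma>" "point_star_refinement X \<gamma> \<beta>" "point_star_refinement X \<beta> \<alpha>"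
  shows "simplicial_pair_map (star_projection \<alpha> \<beta>) (vietoris X \<gamma> UNIV) (vietoris X \<gamma> A)
    (nerve \<alpha>) (nerve_meeting \<alpha> A)"
  unfolding simplicial_pair_map_def
proof (intro conjI ballI)
  have *: "star_projection \<alpha> \<beta> ` \<sigma> \<in> nerve \<alpha>" if \<sigma>: "\<sigma> \<in> vietoris X \<gamma> S" for \<sigma> S
  proof -
    have "finite \<sigma>" "\<sigma> \<noteq> {}" using \<sigma> by (auto simp: vietoris_def)
    moreover from this have "\<Inter>(star_projection \<alpha> \<beta> ` \<sigma>) \<noteq> {}" using star_projection_vietoris(4)[OF assms \<sigma>] by blast
    ultimately show ?thesis using star_projection_vietoris(3)[OF assms \<sigma>] by (simp add: nerve_def)
  qed
  show "star_projection \<alpha> \<beta> ` \<sigma> \<in> nerve \<alpha>" if "\<sigma> \<in> vietoris X \<gamma> UNIV" for \<sigma> using *[OF that] .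
  show "star_projection \<alpha> \<beta> ` \<sigma> \<in> nerve_meeting \<alpha> A" if \<sigma>: "\<sigma> \<in> vietoris X \<gamma> A" for \<sigma>
  proof -
    have "\<sigma> \<noteq> {}" using \<sigma> by (auto simp: vietoris_def)
    then have "\<Inter>(star_projection \<alpha> \<beta> ` \<sigma>) \<inter> A \<noteq> {}"
      using star_projection_vietoris(2,4)[OF assms \<sigma>] by blast
    then show ?thesis using *[OF \<sigma>] by (simp add: nerve_meeting_def)
  qed
qed

text \<open>Any vertex \<open>x0\<close> of the simplex can be taken as centre: the member of
  \<open>\<alpha>\<close> assigned to x contains \<open>x0\<close>, x and its own sample point, so
  the last two lie in the star of \<open>x0\<close>.\<close>

lemma sample_star_projection_contiguous:
  assumes "normal_covering X \<gamma>" "point_star_refinement X \<gamma> \<beta>" "point_star_refinement X \<beta> \<alpha>"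
  shows "contiguous (sample A \<circ> star_projection \<alpha> \<beta>) id (vietoris X \<gamma> UNIV) (vietoris X \<gamma> A)
    (vietoris X \<alpha> UNIV) (vietoris X \<alpha> A)"
proof -
  let ?t = "star_projection \<alpha> \<beta>"
  have *: "(sample A \<circ> ?t) ` \<sigma> \<union> id ` \<sigma> \<in> vietoris X \<alpha> S"
    if \<sigma>: "\<sigma> \<in> vietoris X \<gamma> S" and S: "S = UNIV \<or> S = A" for \<sigma> S
  proof -
    have fin: "finite \<sigma>" "\<sigma> \<noteq> {}" using \<sigma> by (auto simp: vietoris_def)
    then obtain x0 where x0: "x0 \<in> \<sigma>" by blast
    note t = star_projection_vietoris[OF assms \<sigma>]
    have ne: "?t x \<noteq> {}" "x \<in> ?t x" "x0 \<in> ?t x" "x \<in> ?t x0" if "x \<in> \<sigma>" for x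
      using t(4) x0 that by blast+
    have "sample A (?t x) \<in> star \<alpha> x0" "x \<in> star \<alpha> x0" if "x \<in> \<sigma>" for x
    proof -
      have "?t x \<in> \<alpha>" "?t x0 \<in> \<alpha>" using t(3) x0 that by auto
      then show "sample A (?t x) \<in> star \<alpha> x0" "x \<in> star \<alpha> x0"
        using sample(1)[OF ne(1)[OF that], of A] ne[OF that] ne(2)[OF x0] unfolding star_def by auto
    qed
    then have "(sample A \<circ> ?t) ` \<sigma> \<union> id ` \<sigma> \<subseteq> star \<alpha> x0" by auto
    moreover have "sample A (?t x) \<in> S" if "x \<in> \<sigma>" for x
    proof (cases "S = UNIV")
      case False
      then have "S = A" using S by blast
      moreover from this have "?t x \<inter> A \<noteq> {}" using ne(2)[OF that] t(2) that by blast
      ultimately show ?thesis using sample(2)[OF ne(1)[OF that]] by simp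
    qed simp
    then have "(sample A \<circ> ?t) ` \<sigma> \<union> id ` \<sigma> \<subseteq> S" using t(2) by auto
    moreover have "x0 \<in> topspace X" using t(1) x0 by (rule subsetD)
    ultimately show ?thesis
      using fin unfolding vietoris_def by (intro CollectI conjI bexI[of _ x0]) auto
  qed
  show ?thesis unfolding contiguous_def using *[of _ UNIV] *[of _ A] by blast
qed

text \<open>V lies in a member of \<open>\<beta>\<close> and contains its sample point, so V lies in
  the star of that point in \<open>\<beta>\<close>, hence in the set assigned to it.\<close>

lemma enlarging_star_projection_sample:
  assumes "normal_covering X \<gamma>" "refinement_of \<gamma> \<beta>" "point_star_refinement X \<beta> \<alpha>"
  shows "enlarging (star_projection \<alpha> \<beta> \<circ> sample A) \<gamma> \<alpha>"
  unfolding enlarging_def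
proof (intro ballI impI)
  fix V assume V: "V \<in> \<gamma>" "V \<noteq> {}"
  have s: "sample A V \<in> V" using sample(1)[OF V(2)] .
  then have X: "sample A V \<in> topspace X" using normal_covering_subset_topspace[OF assms(1) V(1)] by blast
  obtain W where "W \<in> \<beta>" "V \<subseteq> W" using assms(2) V(1) by (auto simp: refinement_of_def)
  then have "V \<subseteq> star \<beta> (sample A V)" using s by (auto simp: star_def)
  with star_projection[OF assms(3) X]
  show "(star_projection \<alpha> \<beta> \<circ> sample A) V \<in> \<alpha> \<and> V \<subseteq> (star_projection \<alpha> \<beta> \<circ> sample A) V" by auto
qed

section \<open>The map to Cech cohomology\<close>

lemma simplicial_pair_map_comp:
  "simplicial_pair_map p K'' L'' K' L' \<Longrightarrow> simplicial_pair_map q K' L' K L \<Longrightarrow>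
    simplicial_pair_map (q \<circ> p) K'' L'' K L"
  unfolding simplicial_pair_map_def image_comp[symmetric] by blast

context coefficients
begin

section \<open>Alexander-Spanier cochains as functions\<close>

lemma AS_cochains_complex: "cochain_complex (AS_cochains Y G) (AS_coboundary Y G)"
  using simplicial_cochain_complex[OF finite_subsets_simplicial_pair[of "topspace Y"]]
  unfolding AS_cochains_eq[abs_def] AS_coboundary_eq[abs_def] .

lemma carrier_AS_cochains: "carrier (AS_cochains Y G m) = tuples m (topspace Y) \<rightarrow>\<^sub>E carrier G"
  by (simp add: AS_cochains_def)

lemma mult_AS_cochains: "a \<otimes>\<^bsub>AS_cochains Y G m\<^esub> b = (\<lambda>xs\<in>tuples m (topspace Y). a xs \<otimes> b xs)"
  by (simp add: AS_cochains_def)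

lemma one_AS_cochains: "\<one>\<^bsub>AS_cochains Y G m\<^esub> = (\<lambda>xs\<in>tuples m (topspace Y). \<one>)"
  by (simp add: AS_cochains_def)

lemma inv_AS_cochains_apply:
  assumes "a \<in> carrier (AS_cochains Y G m)"
  shows "inv\<^bsub>AS_cochains Y G m\<^esub> a = (\<lambda>xs\<in>tuples m (topspace Y). inv (a xs))"
  using assms unfolding AS_cochains_eq
  by (subst inv_simplicial_relative_cochains) (auto simp: ordered_simplexes_finite_subsets)

lemma tuples_mono: "S \<subseteq> T \<Longrightarrow> tuples m S \<subseteq> tuples m T"
  by (auto simp: tuples_def)

lemma normal_covering_tuples: "normal_covering Y \<alpha> \<Longrightarrow> U \<in> \<alpha> \<Longrightarrow> xs \<in> tuples m U \<Longrightarrow> xs \<in> tuples m (topspace Y)"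
  by (rule subsetD[OF tuples_mono[OF normal_covering_subset_topspace]])

lemma AS_coboundary_apply: "xs \<in> tuples (Suc m) (topspace Y) \<Longrightarrow> AS_coboundary Y G m \<phi> xs = alternating_sum G \<phi> xs"
  by (simp add: AS_coboundary_def coboundary_def alternating_sum_def)

lemma face_tuples: "xs \<in> tuples (Suc m) S \<Longrightarrow> i < length xs \<Longrightarrow> face i xs \<in> tuples m S"
  using set_face_subset[of i xs] by (auto simp: tuples_def length_face)

end

text \<open>\<open>n\<close> is the fixed degree in which the two groups are compared; lemmas about
  cochains in other degrees use a separate variable.\<close>

locale normal_P_pair = coefficients G for G :: "('g, 'm) monoid_scheme" (structure) +
  fixes X :: "'a topology" and A :: "'a set" and n :: nat
  assumes closed_P_pair: "closed_P_pair X A"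
begin

abbreviation V :: "'a set set \<Rightarrow> 'a set set" where "V \<beta> \<equiv> vietoris X \<beta> UNIV"
abbreviation VA :: "'a set set \<Rightarrow> 'a set set" where "VA \<beta> \<equiv> vietoris X \<beta> A"
abbreviation VC :: "'a set set \<Rightarrow> nat \<Rightarrow> ('a list \<Rightarrow> 'g) monoid"
  where "VC \<beta> \<equiv> simplicial_relative_cochains (V \<beta>) (VA \<beta>) G"
abbreviation NA :: "'a set set \<Rightarrow> 'a set set set" where "NA \<beta> \<equiv> nerve_meeting \<beta> A"

text \<open>Restriction to small tuples, phrased as a pullback along the identity so that the lemmas
  on simplicial maps apply to it.\<close>

abbreviation localize :: "'a set set \<Rightarrow> nat \<Rightarrow> ('a list \<Rightarrow> 'g) \<Rightarrow> 'a list \<Rightarrow> 'g" where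
  "localize \<beta> m \<equiv> pullback m (V \<beta>) id"

lemma localize_apply: "xs \<in> ordered_simplexes m (V \<beta>) \<Longrightarrow> localize \<beta> m \<phi> xs = \<phi> xs"
  by (simp add: pullback_def)

lemma V_tuples: "normal_covering X \<beta> \<Longrightarrow> xs \<in> ordered_simplexes m (V \<beta>) \<Longrightarrow> xs \<in> tuples m (topspace X)"
  using star_subset_topspace[of X \<beta>] by (fastforce simp: ordered_simplexes_def vietoris_def tuples_def)

lemma id_simplicial: "refinement_of \<gamma> \<beta> \<Longrightarrow> simplicial_pair_map id (V \<gamma>) (VA \<gamma>) (V \<beta>) (VA \<beta>)"
  using vietoris_mono[of \<gamma> \<beta> X] by (auto simp: simplicial_pair_map_def)

lemma localize_localize: "refinement_of \<gamma> \<beta> \<Longrightarrow> localize \<gamma> m (localize \<beta> m \<phi>) = localize \<gamma> m \<phi>"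
  using vietoris_mono[of \<gamma> \<beta> X UNIV] by (subst pullback_pullback) auto

definition germ_cocycle :: "'a set set \<Rightarrow> ('a list \<Rightarrow> 'g) \<Rightarrow> bool" where
  "germ_cocycle \<beta> \<phi> \<longleftrightarrow> normal_covering X \<beta> \<and> localize \<beta> n \<phi> \<in> relative_cocycles (V \<beta>) (VA \<beta>) n"

lemma germ_cocycle_refinement:
  assumes "germ_cocycle \<beta> \<phi>" "normal_covering X \<gamma>" "refinement_of \<gamma> \<beta>"
  shows "germ_cocycle \<gamma> \<phi>"
proof -
  have "localize \<gamma> n (localize \<beta> n \<phi>) \<in> relative_cocycles (V \<gamma>) (VA \<gamma>) n"
    using assms by (intro pullback_cocycle[OF vietoris_simplicial_pair vietoris_simplicial_pair id_simplicial])
      (auto simp: germ_cocycle_def)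
  then show ?thesis using assms by (simp add: germ_cocycle_def localize_localize)
qed

lemma localize_coboundary_refinement:
  assumes "localize \<beta> n \<phi> \<in> relative_coboundaries (V \<beta>) (VA \<beta>) n" "refinement_of \<gamma> \<beta>"
  shows "localize \<gamma> n \<phi> \<in> relative_coboundaries (V \<gamma>) (VA \<gamma>) n"
proof -
  have "localize \<gamma> n (localize \<beta> n \<phi>) \<in> relative_coboundaries (V \<gamma>) (VA \<gamma>) n"
    using pullback_coboundaries[OF vietoris_simplicial_pair vietoris_simplicial_pair id_simplicial[OF assms(2)]]
      assms(1) by (rule subsetD[OF _ imageI])
  then show ?thesis using assms by (simp add: localize_localize)
qed

section \<open>The direct system of nerves\<close>

lemma cech_bonding_class:
  assumes \<beta>: "refinement_of \<beta> \<alpha>" and z: "z \<in> relative_cocycles (nerve \<alpha>) (NA \<alpha>) n"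
  shows "cech_bonding n A G \<alpha> \<beta> (relative_class (nerve \<alpha>) (NA \<alpha>) n z) =
    relative_class (nerve \<beta>) (NA \<beta>) n (pullback n (nerve \<beta>) (projection \<alpha>) z)"
  unfolding cech_bonding_def
  by (rule simplicial_cohomology_map_class[OF nerve_simplicial_pair nerve_simplicial_pair
      enlarging_simplicial[OF enlarging_projection[OF \<beta>]] z])

lemma pullback_enlarging_class:
  assumes "enlarging p \<beta> \<alpha>" "enlarging q \<beta> \<alpha>" "z \<in> relative_cocycles (nerve \<alpha>) (NA \<alpha>) n"
  shows "relative_class (nerve \<beta>) (NA \<beta>) n (pullback n (nerve \<beta>) q z) =
    relative_class (nerve \<beta>) (NA \<beta>) n (pullback n (nerve \<beta>) p z)"
  by (rule contiguous_class_eq[OF nerve_simplicial_pair nerve_simplicial_pair enlarging_simplicial[OF assms(1)]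
      enlarging_simplicial[OF assms(2)] enlarging_contiguous[OF assms(1,2)] assms(3)])

lemma pullback_enlarging_cocycle:
  assumes "enlarging p \<beta> \<alpha>" "z \<in> relative_cocycles (nerve \<alpha>) (NA \<alpha>) n"
  shows "pullback n (nerve \<beta>) p z \<in> relative_cocycles (nerve \<beta>) (NA \<beta>) n"
  using pullback_cocycle[OF nerve_simplicial_pair nerve_simplicial_pair enlarging_simplicial] assms by blast

abbreviation cech_group :: "'a set set \<Rightarrow> ('a set list \<Rightarrow> 'g) set monoid" where
  "cech_group \<alpha> \<equiv> simplicial_cohomology n (nerve \<alpha>) (NA \<alpha>) G"

lemmas nerve_complex = simplicial_cochain_complex[OF nerve_simplicial_pair]

lemma carrier_cech_group:
  "carrier (cech_group \<alpha>) = relative_class (nerve \<alpha>) (NA \<alpha>) n ` relative_cocycles (nerve \<alpha>) (NA \<alpha>) n"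
  unfolding simplicial_cohomology_def by (rule cochain_complex.carrier_cohomology_group[OF nerve_complex])

lemma cech_group_mult:
  assumes "a \<in> relative_cocycles (nerve \<alpha>) (NA \<alpha>) n" "b \<in> relative_cocycles (nerve \<alpha>) (NA \<alpha>) n"
  shows "relative_class (nerve \<alpha>) (NA \<alpha>) n a \<otimes>\<^bsub>cech_group \<alpha>\<^esub> relative_class (nerve \<alpha>) (NA \<alpha>) n b =
    relative_class (nerve \<alpha>) (NA \<alpha>) n (a \<otimes>\<^bsub>simplicial_relative_cochains (nerve \<alpha>) (NA \<alpha>) G n\<^esub> b)"
  unfolding simplicial_cohomology_def by (rule cochain_complex.cohomology_class_mult[OF nerve_complex assms])

text \<open>The point is functoriality: the composite of two chosen projections is in general not
  the chosen one, but both are enlarging, hence contiguous and equal in cohomology.\<close>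

lemma cech_directed_system:
  "directed_system {\<alpha>. normal_covering X \<alpha>} (\<lambda>\<alpha> \<beta>. refinement_of \<beta> \<alpha>) cech_group (cech_bonding n A G)"
proof (rule directed_system.intro)
  fix \<alpha> \<beta> \<gamma> :: "'a set set"
  show "refinement_of \<alpha> \<alpha>" by simp
  show "refinement_of \<gamma> \<alpha>" if "refinement_of \<beta> \<alpha>" "refinement_of \<gamma> \<beta>"
    using refinement_of_trans that by blast
  show "group (cech_group \<alpha>)"
    unfolding simplicial_cohomology_def
    using cochain_complex.cohomology_comm_group[OF nerve_complex] comm_group.axioms(2) by blast
  show "\<exists>\<gamma>\<in>{\<alpha>. normal_covering X \<alpha>}. refinement_of \<gamma> \<alpha> \<and> refinement_of \<gamma> \<beta>"
    if "\<alpha> \<in> {\<alpha>. normal_covering X \<alpha>}" "\<beta> \<in> {\<alpha>. normal_covering X \<alpha>}"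
  proof -
    have "normal_covering X \<alpha>" "normal_covering X \<beta>" using that by auto
    then show ?thesis by (rule normal_covering_common_refinement) auto
  qed
  show "cech_bonding n A G \<alpha> \<beta> \<in> hom (cech_group \<alpha>) (cech_group \<beta>)" if r: "refinement_of \<beta> \<alpha>"
  proof (rule homI)
    note pb = pullback_enlarging_cocycle[OF enlarging_projection[OF r]]
    fix c assume "c \<in> carrier (cech_group \<alpha>)"
    then obtain a where a: "a \<in> relative_cocycles (nerve \<alpha>) (NA \<alpha>) n"
      and c: "c = relative_class (nerve \<alpha>) (NA \<alpha>) n a" unfolding carrier_cech_group by blast
    show "cech_bonding n A G \<alpha> \<beta> c \<in> carrier (cech_group \<beta>)"
      unfolding c cech_bonding_class[OF r a] carrier_cech_group using pb[OF a] by (rule imageI)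
    fix e assume "e \<in> carrier (cech_group \<alpha>)"
    then obtain b where b: "b \<in> relative_cocycles (nerve \<alpha>) (NA \<alpha>) n"
      and e: "e = relative_class (nerve \<alpha>) (NA \<alpha>) n b" unfolding carrier_cech_group by blast
    let ?C = "simplicial_relative_cochains (nerve \<alpha>) (NA \<alpha>) G n"
    have ab: "a \<otimes>\<^bsub>?C\<^esub> b \<in> relative_cocycles (nerve \<alpha>) (NA \<alpha>) n"
      by (rule subgroup.m_closed[OF cochain_complex.cocycles_subgroup[OF nerve_complex] a b])
    have "NA \<beta> \<subseteq> nerve \<beta>" using nerve_simplicial_pair[of \<beta> A] by (simp add: simplicial_pair_def)
    from hom_mult[OF pullback_hom[OF enlarging_simplicial[OF enlarging_projection[OF r]] this]
        cochain_complex.cocycles_carrier[OF nerve_complex a] cochain_complex.cocycles_carrier[OF nerve_complex b]]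
    show "cech_bonding n A G \<alpha> \<beta> (c \<otimes>\<^bsub>cech_group \<alpha>\<^esub> e) =
        cech_bonding n A G \<alpha> \<beta> c \<otimes>\<^bsub>cech_group \<beta>\<^esub> cech_bonding n A G \<alpha> \<beta> e"
      unfolding c e cech_group_mult[OF a b] cech_bonding_class[OF r a] cech_bonding_class[OF r b]
        cech_bonding_class[OF r ab] cech_group_mult[OF pb[OF a] pb[OF b]] by simp
  qed
  show "cech_bonding n A G \<beta> \<gamma> (cech_bonding n A G \<alpha> \<beta> c) = cech_bonding n A G \<alpha> \<gamma> c"
    if r: "refinement_of \<beta> \<alpha>" "refinement_of \<gamma> \<beta>" and "c \<in> carrier (cech_group \<alpha>)" for c
  proof -
    obtain a where a: "a \<in> relative_cocycles (nerve \<alpha>) (NA \<alpha>) n"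
      and c: "c = relative_class (nerve \<alpha>) (NA \<alpha>) n a" using \<open>c \<in> _\<close> unfolding carrier_cech_group by blast
    have r': "refinement_of \<gamma> \<alpha>" using refinement_of_trans r by blast
    note p = enlarging_projection[OF r(1)] enlarging_projection[OF r(2)]
    have s: "\<forall>\<sigma>\<in>nerve \<gamma>. projection \<beta> ` \<sigma> \<in> nerve \<beta>"
      using enlarging_simplicial[OF p(2)] unfolding simplicial_pair_map_def by blast
    show ?thesis
      unfolding c cech_bonding_class[OF r(1) a] cech_bonding_class[OF r' a]
        cech_bonding_class[OF r(2) pullback_enlarging_cocycle[OF p(1) a]] pullback_pullback[OF s]
      by (rule pullback_enlarging_class[OF enlarging_projection[OF r'] enlarging_comp[OF p(2,1)] a])
  qed
qed

sublocale cech: directed_system "{\<alpha>. normal_covering X \<alpha>}" "\<lambda>\<alpha> \<beta>. refinement_of \<beta> \<alpha>" cech_group "cech_bonding n A G"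
  by (rule cech_directed_system)

section \<open>Cech classes of cochains that are cocycles on small tuples\<close>

abbreviation nerve_cochain :: "'a set set \<Rightarrow> ('a list \<Rightarrow> 'g) \<Rightarrow> 'a set list \<Rightarrow> 'g" where
  "nerve_cochain \<beta> \<phi> \<equiv> pullback n (nerve \<beta>) (sample A) (localize \<beta> n \<phi>)"

abbreviation nerve_class :: "'a set set \<Rightarrow> ('a list \<Rightarrow> 'g) \<Rightarrow> ('a set list \<Rightarrow> 'g) set" where
  "nerve_class \<beta> \<phi> \<equiv> relative_class (nerve \<beta>) (NA \<beta>) n (nerve_cochain \<beta> \<phi>)"

lemma nerve_cocycle:
  assumes "germ_cocycle \<beta> \<phi>"
  shows "nerve_cochain \<beta> \<phi> \<in> relative_cocycles (nerve \<beta>) (NA \<beta>) n"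
  using assms unfolding germ_cocycle_def
  by (intro pullback_cocycle[OF vietoris_simplicial_pair nerve_simplicial_pair sample_simplicial]) auto

lemma nerve_class_carrier: "germ_cocycle \<beta> \<phi> \<Longrightarrow> nerve_class \<beta> \<phi> \<in> carrier (cech_group \<beta>)"
  unfolding carrier_cech_group by (rule imageI[OF nerve_cocycle])

lemma nerve_cochain_refinement:
  assumes "normal_covering X \<gamma>" "refinement_of \<gamma> \<beta>"
  shows "pullback n (nerve \<gamma>) (sample A) (localize \<beta> n \<phi>) = nerve_cochain \<gamma> \<phi>"
proof -
  have 1: "\<forall>\<sigma>\<in>nerve \<gamma>. sample A ` \<sigma> \<in> V \<beta>"
    using sample_simplicial[OF assms, of A] by (simp add: simplicial_pair_map_def)
  have 2: "\<forall>\<sigma>\<in>nerve \<gamma>. sample A ` \<sigma> \<in> V \<gamma>"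
    using sample_simplicial[OF assms(1) refinement_of_refl, of A] by (simp add: simplicial_pair_map_def)
  show ?thesis unfolding pullback_pullback[OF 1] pullback_pullback[OF 2] ..
qed

text \<open>The bonding map samples the enlarged member instead of the member itself. Both are
  near-point maps into the Vietoris complex of the coarser covering, hence contiguous; so the
  classes attached to one function are compatible along the system.\<close>

lemma cech_bonding_nerve_class:
  assumes \<beta>: "germ_cocycle \<beta> \<phi>" and \<gamma>: "normal_covering X \<gamma>" "refinement_of \<gamma> \<beta>"
  shows "cech_bonding n A G \<beta> \<gamma> (nerve_class \<beta> \<phi>) = nerve_class \<gamma> \<phi>"
proof -
  have z: "localize \<beta> n \<phi> \<in> relative_cocycles (V \<beta>) (VA \<beta>) n" using \<beta> by (simp add: germ_cocycle_def)
  have p: "enlarging (projection \<beta>) \<gamma> \<beta>" by (rule enlarging_projection[OF \<gamma>(2)])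
  have s: "\<forall>\<sigma>\<in>nerve \<gamma>. projection \<beta> ` \<sigma> \<in> nerve \<beta>"
    using enlarging_simplicial[OF p] by (simp add: simplicial_pair_map_def)
  have c: "contiguous (sample A) (sample A \<circ> projection \<beta>) (nerve \<gamma>) (NA \<gamma>) (V \<beta>) (VA \<beta>)"
    by (rule near_point_map_contiguous[OF \<gamma>(1) near_point_map_sample[OF \<gamma>(2)] near_point_map_sample_enlarging[OF p]])
  have c': "simplicial_pair_map (sample A \<circ> projection \<beta>) (nerve \<gamma>) (NA \<gamma>) (V \<beta>) (VA \<beta>)"
    by (rule simplicial_pair_map_contiguous[OF near_point_map_contiguous[OF \<gamma>(1)
        near_point_map_sample_enlarging[OF p] near_point_map_sample_enlarging[OF p]]])
  show ?thesis
    unfolding cech_bonding_class[OF \<gamma>(2) nerve_cocycle[OF \<beta>]] pullback_pullback[OF s]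
      nerve_cochain_refinement[OF \<gamma>, symmetric]
    by (rule contiguous_class_eq[OF vietoris_simplicial_pair nerve_simplicial_pair sample_simplicial[OF \<gamma>] c' c z])
qed

definition germ_cocycles :: "('a list \<Rightarrow> 'g) set" where
  "germ_cocycles = {\<phi> \<in> carrier (AS_cochains X G n). \<exists>\<beta>. germ_cocycle \<beta> \<phi>}"

definition germ_coboundary :: "('a list \<Rightarrow> 'g) \<Rightarrow> bool" where
  "germ_coboundary \<phi> \<longleftrightarrow>
     (\<exists>\<beta>. normal_covering X \<beta> \<and> localize \<beta> n \<phi> \<in> relative_coboundaries (V \<beta>) (VA \<beta>) n)"

text \<open>The covering is picked arbitrarily; by \<open>cech_class_eq\<close> every covering on
  which the function is a relative cocycle gives the same class.\<close>

definition cech_class :: "('a list \<Rightarrow> 'g) \<Rightarrow> ('a set set \<times> ('a set list \<Rightarrow> 'g) set) set" where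
  "cech_class \<phi> = cech.limit_class (SOME \<beta>. germ_cocycle \<beta> \<phi>) (nerve_class (SOME \<beta>. germ_cocycle \<beta> \<phi>) \<phi>)"

lemma cech_class_eq:
  assumes \<beta>: "germ_cocycle \<beta> \<phi>"
  shows "cech_class \<phi> = cech.limit_class \<beta> (nerve_class \<beta> \<phi>)"
proof -
  let ?\<beta> = "SOME \<beta>. germ_cocycle \<beta> \<phi>"
  have \<beta>': "germ_cocycle ?\<beta> \<phi>" using \<beta> by (rule someI)
  have n: "normal_covering X \<beta>" "normal_covering X ?\<beta>" using \<beta> \<beta>' by (auto simp: germ_cocycle_def)
  then obtain \<gamma> where \<gamma>: "normal_covering X \<gamma>" "refinement_of \<gamma> \<beta>" "refinement_of \<gamma> ?\<beta>"
    by (rule normal_covering_common_refinement)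
  have "cech.limit_class \<gamma> (nerve_class \<gamma> \<phi>) = cech.limit_class \<delta> (nerve_class \<delta> \<phi>)"
    if "germ_cocycle \<delta> \<phi>" "normal_covering X \<delta>" "refinement_of \<gamma> \<delta>" for \<delta>
    using cech.limit_class_bonding[of \<delta> \<gamma> "nerve_class \<delta> \<phi>"] that \<gamma>(1) nerve_class_carrier
      cech_bonding_nerve_class[OF that(1) \<gamma>(1) that(3)] by auto
  from this[OF \<beta> n(1) \<gamma>(2)] this[OF \<beta>' n(2) \<gamma>(3)] show ?thesis by (simp add: cech_class_def)
qed

lemma common_germ_cocycle:
  assumes "a \<in> germ_cocycles" "b \<in> germ_cocycles"
  obtains \<beta> where "normal_covering X \<beta>" "germ_cocycle \<beta> a" "germ_cocycle \<beta> b"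
proof -
  obtain \<alpha> \<beta> where ab: "germ_cocycle \<alpha> a" "germ_cocycle \<beta> b" using assms by (auto simp: germ_cocycles_def)
  then have "normal_covering X \<alpha>" "normal_covering X \<beta>" by (auto simp: germ_cocycle_def)
  then obtain \<gamma> where "normal_covering X \<gamma>" "refinement_of \<gamma> \<alpha>" "refinement_of \<gamma> \<beta>"
    by (rule normal_covering_common_refinement)
  with ab show thesis by (intro that[of \<gamma>]) (auto intro: germ_cocycle_refinement)
qed

lemmas vietoris_complex = simplicial_cochain_complex[OF vietoris_simplicial_pair]

lemma localize_mult:
  assumes "normal_covering X \<beta>"
  shows "localize \<beta> m (a \<otimes>\<^bsub>AS_cochains X G m\<^esub> b) =
    localize \<beta> m a \<otimes>\<^bsub>VC \<beta> m\<^esub> localize \<beta> m b"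
  using V_tuples[OF assms, of _ m]
  by (auto simp: pullback_def AS_cochains_def mult_simplicial_relative_cochains intro!: restrict_ext)

lemma localize_inv:
  assumes "normal_covering X \<beta>" "a \<in> carrier (AS_cochains X G m)"
    "localize \<beta> m a \<in> carrier (VC \<beta> m)"
  shows "localize \<beta> m (inv\<^bsub>AS_cochains X G m\<^esub> a) =
    inv\<^bsub>VC \<beta> m\<^esub> (localize \<beta> m a)"
proof -
  have "VA \<beta> \<subseteq> V \<beta>" using vietoris_simplicial_pair[of X \<beta> A] by (simp add: simplicial_pair_def)
  from inv_simplicial_relative_cochains[OF this assms(3)] show ?thesis
    using V_tuples[OF assms(1), of _ m]
    by (auto simp: inv_AS_cochains_apply[OF assms(2)] pullback_def intro!: restrict_ext)
qed

lemma germ_cocycle_mult: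
  assumes "germ_cocycle \<beta> a" "germ_cocycle \<beta> b"
  shows "germ_cocycle \<beta> (a \<otimes>\<^bsub>AS_cochains X G n\<^esub> b)"
  using assms
  by (simp add: germ_cocycle_def localize_mult
      subgroup.m_closed[OF cochain_complex.cocycles_subgroup[OF vietoris_complex]])

lemma germ_cocycle_inv:
  assumes "germ_cocycle \<beta> a" "a \<in> carrier (AS_cochains X G n)"
  shows "germ_cocycle \<beta> (inv\<^bsub>AS_cochains X G n\<^esub> a)"
proof -
  have \<beta>: "normal_covering X \<beta>" and z: "localize \<beta> n a \<in> relative_cocycles (V \<beta>) (VA \<beta>) n"
    using assms(1) by (auto simp: germ_cocycle_def)
  show ?thesis
    unfolding germ_cocycle_def localize_inv[OF \<beta> assms(2) cochain_complex.cocycles_carrier[OF vietoris_complex z]]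
    using \<beta> subgroup.m_inv_closed[OF cochain_complex.cocycles_subgroup[OF vietoris_complex] z] by simp
qed

lemma germ_cocycles_mult:
  assumes "a \<in> germ_cocycles" "b \<in> germ_cocycles"
  shows "a \<otimes>\<^bsub>AS_cochains X G n\<^esub> b \<in> germ_cocycles"
proof -
  obtain \<beta> where "germ_cocycle \<beta> a" "germ_cocycle \<beta> b" using common_germ_cocycle[OF assms] .
  then have "germ_cocycle \<beta> (a \<otimes>\<^bsub>AS_cochains X G n\<^esub> b)" by (rule germ_cocycle_mult)
  moreover have "a \<otimes>\<^bsub>AS_cochains X G n\<^esub> b \<in> carrier (AS_cochains X G n)"
    using assms monoid.m_closed[OF group.is_monoid[OF cochain_complex.group[OF AS_cochains_complex[of X], of n]], of a b]
    by (simp add: germ_cocycles_def)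
  ultimately show ?thesis by (auto simp: germ_cocycles_def)
qed

lemma nerve_cochain_mult:
  assumes "germ_cocycle \<beta> a" "germ_cocycle \<beta> b"
  shows "nerve_cochain \<beta> (a \<otimes>\<^bsub>AS_cochains X G n\<^esub> b) =
    nerve_cochain \<beta> a \<otimes>\<^bsub>simplicial_relative_cochains (nerve \<beta>) (NA \<beta>) G n\<^esub> nerve_cochain \<beta> b"
proof -
  have \<beta>: "normal_covering X \<beta>" and c: "localize \<beta> n a \<in> carrier (VC \<beta> n)"
    "localize \<beta> n b \<in> carrier (VC \<beta> n)"
    using assms cochain_complex.cocycles_carrier[OF vietoris_complex] by (auto simp: germ_cocycle_def)
  have NA: "NA \<beta> \<subseteq> nerve \<beta>" using nerve_simplicial_pair[of \<beta> A] by (simp add: simplicial_pair_def)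
  show ?thesis
    unfolding localize_mult[OF \<beta>] by (rule hom_mult[OF pullback_hom[OF sample_simplicial[OF \<beta> refinement_of_refl] NA] c])
qed

lemma nerve_cochain_inv:
  assumes "germ_cocycle \<beta> a" "a \<in> carrier (AS_cochains X G n)"
  shows "nerve_cochain \<beta> (inv\<^bsub>AS_cochains X G n\<^esub> a) =
    inv\<^bsub>simplicial_relative_cochains (nerve \<beta>) (NA \<beta>) G n\<^esub> (nerve_cochain \<beta> a)"
proof -
  have \<beta>: "normal_covering X \<beta>" and c: "localize \<beta> n a \<in> carrier (VC \<beta> n)"
    using assms cochain_complex.cocycles_carrier[OF vietoris_complex] by (auto simp: germ_cocycle_def)
  have NA: "NA \<beta> \<subseteq> nerve \<beta>" using nerve_simplicial_pair[of \<beta> A] by (simp add: simplicial_pair_def)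
  have "group_hom (VC \<beta> n) (simplicial_relative_cochains (nerve \<beta>) (NA \<beta>) G n)
      (pullback n (nerve \<beta>) (sample A))"
    using pullback_hom[OF sample_simplicial[OF \<beta> refinement_of_refl] NA]
    by (simp add: group_hom_def group_hom_axioms_def cochain_complex.group[OF vietoris_complex]
        cochain_complex.group[OF nerve_complex])
  from group_hom.hom_inv[OF this c] show ?thesis unfolding localize_inv[OF \<beta> assms(2) c] .
qed

lemma nerve_class_eq_iff:
  assumes "germ_cocycle \<beta> a" "germ_cocycle \<beta> b" "b \<in> carrier (AS_cochains X G n)"
  shows "nerve_class \<beta> a = nerve_class \<beta> b \<longleftrightarrow>
    nerve_cochain \<beta> (a \<otimes>\<^bsub>AS_cochains X G n\<^esub> inv\<^bsub>AS_cochains X G n\<^esub> b) \<in> relative_coboundaries (nerve \<beta>) (NA \<beta>) n"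
  unfolding nerve_cochain_mult[OF assms(1) germ_cocycle_inv[OF assms(2,3)]] nerve_cochain_inv[OF assms(2,3)]
  by (rule cochain_complex.cohomology_class_eq_iff[OF nerve_complex nerve_cocycle[OF assms(1)] nerve_cocycle[OF assms(2)]])

text \<open>Injectivity on the Cech side. Pulling the nerve cochain back to a finer Vietoris complex
  returns the original cochain up to a coboundary, since sampling after
  \<open>star_projection\<close> is contiguous to the identity.\<close>

lemma germ_coboundary_if_nerve_coboundary:
  assumes \<phi>: "germ_cocycle \<gamma> \<phi>" and cob: "nerve_cochain \<gamma> \<phi> \<in> relative_coboundaries (nerve \<gamma>) (NA \<gamma>) n"
  shows "germ_coboundary \<phi>"
proof -
  have \<gamma>: "normal_covering X \<gamma>" and z: "localize \<gamma> n \<phi> \<in> relative_cocycles (V \<gamma>) (VA \<gamma>) n"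
    using \<phi> by (auto simp: germ_cocycle_def)
  obtain \<delta> where \<delta>: "normal_covering X \<delta>" "point_star_refinement X \<delta> \<gamma>"
    using normal_covering_point_star_refinement[OF \<gamma>] .
  obtain \<epsilon> where \<epsilon>: "normal_covering X \<epsilon>" "point_star_refinement X \<epsilon> \<delta>"
    using normal_covering_point_star_refinement[OF \<delta>(1)] .
  have r: "refinement_of \<epsilon> \<gamma>"
    using point_star_refinement_imp_refinement refinement_of_trans \<gamma> \<delta> \<epsilon> by blast
  let ?t = "star_projection \<gamma> \<delta>"
  let ?C = "VC \<epsilon> n"
  have t: "simplicial_pair_map ?t (V \<epsilon>) (VA \<epsilon>) (nerve \<gamma>) (NA \<gamma>)"
    by (rule star_projection_simplicial[OF \<epsilon> \<delta>(2)])
  have s: "simplicial_pair_map (sample A) (nerve \<gamma>) (NA \<gamma>) (V \<gamma>) (VA \<gamma>)"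
    by (rule sample_simplicial[OF \<gamma> refinement_of_refl])
  have st: "simplicial_pair_map (sample A \<circ> ?t) (V \<epsilon>) (VA \<epsilon>) (V \<gamma>) (VA \<gamma>)"
    by (rule simplicial_pair_map_comp[OF t s])
  have tK: "\<forall>\<sigma>\<in>V \<epsilon>. ?t ` \<sigma> \<in> nerve \<gamma>" using t by (simp add: simplicial_pair_map_def)
  have 1: "pullback n (V \<epsilon>) (sample A \<circ> ?t) (localize \<gamma> n \<phi>) \<in> relative_coboundaries (V \<epsilon>) (VA \<epsilon>) n"
    using pullback_coboundaries[OF nerve_simplicial_pair vietoris_simplicial_pair t] cob
    unfolding pullback_pullback[OF tK, symmetric] by (rule subsetD[OF _ imageI])
  have 2: "localize \<epsilon> n (localize \<gamma> n \<phi>) \<otimes>\<^bsub>?C\<^esub> inv\<^bsub>?C\<^esub> (pullback n (V \<epsilon>) (sample A \<circ> ?t) (localize \<gamma> n \<phi>))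
      \<in> relative_coboundaries (V \<epsilon>) (VA \<epsilon>) n"
    by (rule contiguous_pullback[OF vietoris_simplicial_pair vietoris_simplicial_pair st id_simplicial[OF r]
        sample_star_projection_contiguous[OF \<epsilon> \<delta>(2)] z])
  interpret C: group ?C by (rule cochain_complex.group[OF vietoris_complex])
  have B: "subgroup (relative_coboundaries (V \<epsilon>) (VA \<epsilon>) n) ?C"
    by (rule cochain_complex.coboundaries_subgroup[OF vietoris_complex])
  have 3: "localize \<epsilon> n (localize \<gamma> n \<phi>) \<in> carrier ?C"
    using cochain_complex.cocycles_carrier[OF vietoris_complex]
      pullback_cocycle[OF vietoris_simplicial_pair vietoris_simplicial_pair id_simplicial[OF r] z] .
  \<comment> \<open>A product of two coboundaries: the difference from the round trip, and the round
    trip itself, which is pulled back from a nerve coboundary.\<close>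
  have "localize \<epsilon> n (localize \<gamma> n \<phi>) \<in> relative_coboundaries (V \<epsilon>) (VA \<epsilon>) n"
    using subgroup.m_closed[OF B 2 1] 3 subgroup.mem_carrier[OF B 1] by (simp add: C.m_assoc)
  then show ?thesis unfolding localize_localize[OF r] germ_coboundary_def using \<epsilon>(1) by blast
qed

lemma cech_class_eq_iff:
  assumes a: "a \<in> germ_cocycles" and b: "b \<in> germ_cocycles"
  shows "cech_class a = cech_class b \<longleftrightarrow>
    germ_coboundary (a \<otimes>\<^bsub>AS_cochains X G n\<^esub> inv\<^bsub>AS_cochains X G n\<^esub> b)"
proof
  let ?c = "a \<otimes>\<^bsub>AS_cochains X G n\<^esub> inv\<^bsub>AS_cochains X G n\<^esub> b"
  obtain \<beta> where \<beta>: "normal_covering X \<beta>" "germ_cocycle \<beta> a" "germ_cocycle \<beta> b"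
    using common_germ_cocycle[OF a b] .
  have bc: "b \<in> carrier (AS_cochains X G n)" using b by (simp add: germ_cocycles_def)
  { assume "cech_class a = cech_class b"
    then have "cech.limit_class \<beta> (nerve_class \<beta> a) = cech.limit_class \<beta> (nerve_class \<beta> b)"
      by (simp add: cech_class_eq[OF \<beta>(2)] cech_class_eq[OF \<beta>(3)])
    then obtain \<gamma> where \<gamma>: "normal_covering X \<gamma>" "refinement_of \<gamma> \<beta>"
      and eq: "cech_bonding n A G \<beta> \<gamma> (nerve_class \<beta> a) = cech_bonding n A G \<beta> \<gamma> (nerve_class \<beta> b)"
      using \<beta> nerve_class_carrier by (subst (asm) cech.limit_class_eq_iff) auto
    have ab: "germ_cocycle \<gamma> a" "germ_cocycle \<gamma> b"
      using germ_cocycle_refinement[OF _ \<gamma>] \<beta> by auto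
    have "nerve_class \<gamma> a = nerve_class \<gamma> b"
      using eq by (simp add: cech_bonding_nerve_class[OF \<beta>(2) \<gamma>] cech_bonding_nerve_class[OF \<beta>(3) \<gamma>])
    then have "nerve_cochain \<gamma> ?c \<in> relative_coboundaries (nerve \<gamma>) (NA \<gamma>) n"
      by (simp add: nerve_class_eq_iff[OF ab bc])
    then show "germ_coboundary ?c"
      by (rule germ_coboundary_if_nerve_coboundary[OF germ_cocycle_mult[OF ab(1) germ_cocycle_inv[OF ab(2) bc]]])
  }
  assume "germ_coboundary ?c"
  then obtain \<alpha> where \<alpha>: "normal_covering X \<alpha>" "localize \<alpha> n ?c \<in> relative_coboundaries (V \<alpha>) (VA \<alpha>) n"
    by (auto simp: germ_coboundary_def)
  obtain \<gamma> where \<gamma>: "normal_covering X \<gamma>" "refinement_of \<gamma> \<alpha>" "refinement_of \<gamma> \<beta>"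
    using normal_covering_common_refinement[OF \<alpha>(1) \<beta>(1)] .
  have ab: "germ_cocycle \<gamma> a" "germ_cocycle \<gamma> b"
    using germ_cocycle_refinement[OF _ \<gamma>(1,3)] \<beta> by auto
  have "nerve_cochain \<gamma> ?c \<in> relative_coboundaries (nerve \<gamma>) (NA \<gamma>) n"
    using pullback_coboundaries[OF vietoris_simplicial_pair nerve_simplicial_pair sample_simplicial[OF \<gamma>(1) refinement_of_refl]]
      localize_coboundary_refinement[OF \<alpha>(2) \<gamma>(2)] by (rule subsetD[OF _ imageI])
  then have "nerve_class \<gamma> a = nerve_class \<gamma> b" by (simp add: nerve_class_eq_iff[OF ab bc])
  then show "cech_class a = cech_class b" by (simp add: cech_class_eq[OF ab(1)] cech_class_eq[OF ab(2)])
qed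

lemma cech_class_mult:
  assumes "a \<in> germ_cocycles" "b \<in> germ_cocycles"
  shows "cech_class (a \<otimes>\<^bsub>AS_cochains X G n\<^esub> b) =
    cech_class a \<otimes>\<^bsub>cech_normal_cohomology n X A G\<^esub> cech_class b"
proof -
  obtain \<beta> where \<beta>: "normal_covering X \<beta>" "germ_cocycle \<beta> a" "germ_cocycle \<beta> b"
    using common_germ_cocycle[OF assms] .
  have "cech_class a \<otimes>\<^bsub>cech_normal_cohomology n X A G\<^esub> cech_class b =
      cech.limit_class \<beta> (nerve_class \<beta> a \<otimes>\<^bsub>cech_group \<beta>\<^esub> nerve_class \<beta> b)"
    unfolding cech_normal_cohomology_def cech_class_eq[OF \<beta>(2)] cech_class_eq[OF \<beta>(3)]
    using \<beta> nerve_class_carrier by (intro cech.limit_class_mult) auto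
  also have "\<dots> = cech_class (a \<otimes>\<^bsub>AS_cochains X G n\<^esub> b)"
    unfolding cech_group_mult[OF nerve_cocycle[OF \<beta>(2)] nerve_cocycle[OF \<beta>(3)]]
      nerve_cochain_mult[OF \<beta>(2,3), symmetric] cech_class_eq[OF germ_cocycle_mult[OF \<beta>(2,3)]] ..
  finally show ?thesis ..
qed

text \<open>A cocycle of the nerve of \<open>\<alpha>\<close> is reached by its pullback along
  \<open>star_projection\<close>: sampling that pullback amounts to pulling back along an enlarging
  map, which agrees in cohomology with the bonding map.\<close>

lemma cech_class_surj: "cech_class ` germ_cocycles = carrier (cech_normal_cohomology n X A G)"
proof
  show "cech_class ` germ_cocycles \<subseteq> carrier (cech_normal_cohomology n X A G)"
  proof
    fix c assume "c \<in> cech_class ` germ_cocycles"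
    then obtain \<phi> \<beta> where "c = cech_class \<phi>" and \<beta>: "germ_cocycle \<beta> \<phi>" by (auto simp: germ_cocycles_def)
    then have "c = cech.limit_class \<beta> (nerve_class \<beta> \<phi>)" by (simp add: cech_class_eq)
    then show "c \<in> carrier (cech_normal_cohomology n X A G)"
      unfolding cech_normal_cohomology_def cech.carrier_direct_limit
      using \<beta> nerve_class_carrier[OF \<beta>] by (auto simp: germ_cocycle_def)
  qed
  show "carrier (cech_normal_cohomology n X A G) \<subseteq> cech_class ` germ_cocycles"
  proof
    fix c assume "c \<in> carrier (cech_normal_cohomology n X A G)"
    then obtain \<alpha> z where \<alpha>: "normal_covering X \<alpha>" and z: "z \<in> relative_cocycles (nerve \<alpha>) (NA \<alpha>) n"
      and c: "c = cech.limit_class \<alpha> (relative_class (nerve \<alpha>) (NA \<alpha>) n z)"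
      unfolding cech_normal_cohomology_def cech.carrier_direct_limit carrier_cech_group by auto
    obtain \<beta> where \<beta>: "normal_covering X \<beta>" "point_star_refinement X \<beta> \<alpha>"
      using normal_covering_point_star_refinement[OF \<alpha>] .
    obtain \<gamma> where \<gamma>: "normal_covering X \<gamma>" "point_star_refinement X \<gamma> \<beta>"
      using normal_covering_point_star_refinement[OF \<beta>(1)] .
    have r: "refinement_of \<gamma> \<beta>" "refinement_of \<gamma> \<alpha>"
      using point_star_refinement_imp_refinement refinement_of_trans \<alpha> \<beta> \<gamma> by blast+
    let ?t = "star_projection \<alpha> \<beta>"
    have t: "simplicial_pair_map ?t (V \<gamma>) (VA \<gamma>) (nerve \<alpha>) (NA \<alpha>)"
      by (rule star_projection_simplicial[OF \<gamma> \<beta>(2)])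
    have tK: "\<forall>\<sigma>\<in>V \<gamma>. ?t ` \<sigma> \<in> nerve \<alpha>" using t by (simp add: simplicial_pair_map_def)
    \<comment> \<open>An Alexander-Spanier cochain needs a value at every tuple of points. Where the
      assigned members span no simplex of the nerve it is one; on the Vietoris complex of
      \<open>\<gamma>\<close> this never occurs.\<close>
    define \<phi> where "\<phi> = (\<lambda>xs\<in>tuples n (topspace X).
      extend_by_one G (ordered_simplexes n (nerve \<alpha>)) z (map ?t xs))"
    have \<phi>c: "\<phi> \<in> carrier (AS_cochains X G n)"
      using extend_by_one_closed[OF cochain_complex.cocycles_carrier[OF nerve_complex z]]
      by (simp add: \<phi>_def AS_cochains_def)
    have loc: "localize \<gamma> n \<phi> = pullback n (V \<gamma>) ?t z"
      using V_tuples[OF \<gamma>(1), of _ n] map_ordered_simplex[OF tK, of _ n]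
      by (auto simp: pullback_def \<phi>_def extend_by_one_def intro!: restrict_ext)
    have g: "germ_cocycle \<gamma> \<phi>"
      unfolding germ_cocycle_def loc
      using \<gamma>(1) pullback_cocycle[OF nerve_simplicial_pair vietoris_simplicial_pair t z] by simp
    have sK: "\<forall>\<sigma>\<in>nerve \<gamma>. sample A ` \<sigma> \<in> V \<gamma>"
      using sample_simplicial[OF \<gamma>(1) refinement_of_refl, of A] by (simp add: simplicial_pair_map_def)
    have "nerve_class \<gamma> \<phi> = cech_bonding n A G \<alpha> \<gamma> (relative_class (nerve \<alpha>) (NA \<alpha>) n z)"
      unfolding loc pullback_pullback[OF sK] cech_bonding_class[OF r(2) z]
      by (rule pullback_enlarging_class[OF enlarging_projection[OF r(2)]
          enlarging_star_projection_sample[OF \<gamma>(1) r(1) \<beta>(2)] z])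
    then have "cech_class \<phi> = c"
      unfolding c cech_class_eq[OF g]
      using cech.limit_class_bonding[of \<alpha> \<gamma> "relative_class (nerve \<alpha>) (NA \<alpha>) n z"] \<alpha> \<gamma>(1) r(2) z carrier_cech_group
      by simp
    moreover have "\<phi> \<in> germ_cocycles" using \<phi>c g by (auto simp: germ_cocycles_def)
    ultimately show "c \<in> cech_class ` germ_cocycles" by blast
  qed
qed

end

section \<open>The map to Alexander-Spanier cohomology\<close>

context coefficients
begin

section \<open>Cochains modulo locally zero cochains\<close>

lemma N_locally_zero_subgroup: "subgroup (N_locally_zero Y G m) (AS_cochains Y G m)"
proof (rule group.subgroupI[OF cochain_complex.group[OF AS_cochains_complex]])
  let ?C = "AS_cochains Y G m"
  interpret C: group ?C by (rule cochain_complex.group[OF AS_cochains_complex])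
  show "N_locally_zero Y G m \<subseteq> carrier ?C" by (auto simp: N_locally_zero_def)
  have "\<one>\<^bsub>?C\<^esub> \<in> N_locally_zero Y G m"
    using normal_covering_trivial[of Y] C.one_closed by (auto simp: N_locally_zero_def one_AS_cochains)
  then show "N_locally_zero Y G m \<noteq> {}" by blast
  show "inv\<^bsub>?C\<^esub> a \<in> N_locally_zero Y G m" if "a \<in> N_locally_zero Y G m" for a
  proof -
    obtain \<alpha> where a: "a \<in> carrier ?C" and \<alpha>: "normal_covering Y \<alpha>" "\<forall>xs\<in>(\<Union>U\<in>\<alpha>. tuples m U). a xs = \<one>"
      using \<open>a \<in> _\<close> unfolding N_locally_zero_def by blast
    have "(inv\<^bsub>?C\<^esub> a) xs = \<one>" if "xs \<in> (\<Union>U\<in>\<alpha>. tuples m U)" for xs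
      using that \<alpha> normal_covering_tuples[OF \<alpha>(1)] by (auto simp: inv_AS_cochains_apply[OF a])
    then show ?thesis using C.inv_closed[OF a] \<alpha>(1) unfolding N_locally_zero_def by blast
  qed
  show "a \<otimes>\<^bsub>?C\<^esub> b \<in> N_locally_zero Y G m" if "a \<in> N_locally_zero Y G m" "b \<in> N_locally_zero Y G m" for a b
  proof -
    obtain \<alpha> where a: "a \<in> carrier ?C" and \<alpha>: "normal_covering Y \<alpha>" "\<forall>xs\<in>(\<Union>U\<in>\<alpha>. tuples m U). a xs = \<one>"
      using \<open>a \<in> _\<close> unfolding N_locally_zero_def by blast
    obtain \<beta> where b: "b \<in> carrier ?C" and \<beta>: "normal_covering Y \<beta>" "\<forall>xs\<in>(\<Union>U\<in>\<beta>. tuples m U). b xs = \<one>"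
      using \<open>b \<in> _\<close> unfolding N_locally_zero_def by blast
    obtain \<gamma> where \<gamma>: "normal_covering Y \<gamma>" "refinement_of \<gamma> \<alpha>" "refinement_of \<gamma> \<beta>"
      using normal_covering_common_refinement[OF \<alpha>(1) \<beta>(1)] .
    have "(a \<otimes>\<^bsub>?C\<^esub> b) xs = \<one>" if "xs \<in> (\<Union>U\<in>\<gamma>. tuples m U)" for xs
    proof -
      obtain W where W: "W \<in> \<gamma>" "xs \<in> tuples m W" using \<open>xs \<in> _\<close> by blast
      obtain U where "U \<in> \<alpha>" "W \<subseteq> U" using \<gamma>(2) W(1) by (auto simp: refinement_of_def)
      then have "a xs = \<one>" using \<alpha>(2) tuples_mono[of W U m] W(2) by auto
      moreover obtain U' where "U' \<in> \<beta>" "W \<subseteq> U'" using \<gamma>(3) W(1) by (auto simp: refinement_of_def)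
      then have "b xs = \<one>" using \<beta>(2) tuples_mono[of W U' m] W(2) by auto
      ultimately show ?thesis using normal_covering_tuples[OF \<gamma>(1) W] by (simp add: mult_AS_cochains)
    qed
    then show ?thesis using C.m_closed[OF a b] \<gamma>(1) unfolding N_locally_zero_def by blast
  qed
qed

lemma AS_coboundary_N_locally_zero: "AS_coboundary Y G m ` N_locally_zero Y G m \<subseteq> N_locally_zero Y G (Suc m)"
proof
  fix b assume "b \<in> AS_coboundary Y G m ` N_locally_zero Y G m"
  then obtain a \<alpha> where b: "b = AS_coboundary Y G m a" and a: "a \<in> carrier (AS_cochains Y G m)"
    and \<alpha>: "normal_covering Y \<alpha>" "\<forall>xs\<in>(\<Union>U\<in>\<alpha>. tuples m U). a xs = \<one>"
    unfolding N_locally_zero_def by blast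
  have "b xs = \<one>" if xs: "xs \<in> (\<Union>U\<in>\<alpha>. tuples (Suc m) U)" for xs
  proof -
    obtain U where U: "U \<in> \<alpha>" "xs \<in> tuples (Suc m) U" using xs by blast
    have "alternating_sum G a xs = \<one>"
      using \<alpha>(2) U face_tuples[OF U(2)] by (intro alternating_sum_one) auto
    then show ?thesis unfolding b using normal_covering_tuples[OF \<alpha>(1) U] by (simp add: AS_coboundary_apply)
  qed
  moreover have "b \<in> carrier (AS_cochains Y G (Suc m))"
    unfolding b using cochain_complex.hom[OF AS_cochains_complex[of Y], of m] a by (auto simp: hom_def)
  ultimately show "b \<in> N_locally_zero Y G (Suc m)" using \<alpha>(1) unfolding N_locally_zero_def by blast
qed

lemma ASN_cochains_comm_group: "comm_group (ASN_cochains Y G m)"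
  unfolding ASN_cochains_def
  by (rule comm_group.abelian_FactGroup[OF cochain_complex.comm_group[OF AS_cochains_complex] N_locally_zero_subgroup])

definition ASN_class :: "'b topology \<Rightarrow> nat \<Rightarrow> ('b list \<Rightarrow> 'g) \<Rightarrow> ('b list \<Rightarrow> 'g) set" where
  "ASN_class Y m \<phi> = N_locally_zero Y G m #>\<^bsub>AS_cochains Y G m\<^esub> \<phi>"

lemma carrier_ASN_cochains: "carrier (ASN_cochains Y G m) = ASN_class Y m ` carrier (AS_cochains Y G m)"
  by (simp add: ASN_cochains_def carrier_FactGroup ASN_class_def)

lemma ASN_class_mult:
  assumes "a \<in> carrier (AS_cochains Y G m)" "b \<in> carrier (AS_cochains Y G m)"
  shows "ASN_class Y m a \<otimes>\<^bsub>ASN_cochains Y G m\<^esub> ASN_class Y m b = ASN_class Y m (a \<otimes>\<^bsub>AS_cochains Y G m\<^esub> b)"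
  using normal.rcos_sum[OF comm_group.subgroup_imp_normal[OF cochain_complex.comm_group[OF AS_cochains_complex]
        N_locally_zero_subgroup] assms]
  by (simp add: ASN_cochains_def ASN_class_def)

lemma ASN_class_eq_iff:
  assumes "a \<in> carrier (AS_cochains Y G m)" "b \<in> carrier (AS_cochains Y G m)"
  shows "ASN_class Y m a = ASN_class Y m b \<longleftrightarrow>
    a \<otimes>\<^bsub>AS_cochains Y G m\<^esub> inv\<^bsub>AS_cochains Y G m\<^esub> b \<in> N_locally_zero Y G m"
  unfolding ASN_class_def
  by (rule group.r_coset_eq_iff[OF cochain_complex.group[OF AS_cochains_complex] N_locally_zero_subgroup assms])

lemma ASN_class_eq_one_iff:
  assumes "a \<in> carrier (AS_cochains Y G m)"
  shows "ASN_class Y m a = \<one>\<^bsub>ASN_cochains Y G m\<^esub> \<longleftrightarrow> a \<in> N_locally_zero Y G m"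
proof -
  interpret C: group "AS_cochains Y G m" by (rule cochain_complex.group[OF AS_cochains_complex])
  show ?thesis
    unfolding ASN_class_def ASN_cochains_def one_FactGroup
    using C.coset_join1[OF _ assms N_locally_zero_subgroup] C.coset_join2[OF assms N_locally_zero_subgroup] by blast
qed

lemma ASN_coboundary_class:
  assumes "a \<in> carrier (AS_cochains Y G m)"
  shows "ASN_coboundary Y G m (ASN_class Y m a) = ASN_class Y (Suc m) (AS_coboundary Y G m a)"
  unfolding ASN_coboundary_def ASN_class_def
  by (rule induced_on_cosets_r_coset[OF cochain_complex.group[OF AS_cochains_complex]
      cochain_complex.group[OF AS_cochains_complex] cochain_complex.hom[OF AS_cochains_complex]
      N_locally_zero_subgroup N_locally_zero_subgroup AS_coboundary_N_locally_zero assms])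

end

context normal_P_pair
begin

section \<open>Local vanishing on the space and on the subspace\<close>

lemma A_subset: "A \<subseteq> topspace X"
  using closed_P_pair by (simp add: closed_P_pair_def P_embedded_def)

lemma topspace_A: "topspace (subtopology X A) = A"
  using A_subset by (rule topspace_subtopology_subset)

abbreviation restriction :: "nat \<Rightarrow> ('a list \<Rightarrow> 'g) \<Rightarrow> 'a list \<Rightarrow> 'g" where
  "restriction m \<phi> \<equiv> restrict \<phi> (tuples m A)"

lemma restriction_hom: "restriction m \<in> hom (AS_cochains X G m) (AS_cochains (subtopology X A) G m)"
proof (rule homI)
  note sub = tuples_mono[OF A_subset, of m]
  fix a b assume "a \<in> carrier (AS_cochains X G m)"
  then show "restriction m a \<in> carrier (AS_cochains (subtopology X A) G m)"
    using sub unfolding carrier_AS_cochains topspace_A by auto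
  show "restriction m (a \<otimes>\<^bsub>AS_cochains X G m\<^esub> b) =
      restriction m a \<otimes>\<^bsub>AS_cochains (subtopology X A) G m\<^esub> restriction m b"
    using sub unfolding mult_AS_cochains topspace_A by (auto simp: restrict_def fun_eq_iff)
qed

text \<open>Tuples inside a member and tuples inside a star define the same notion of local
  vanishing: a star of a point-star refinement lies in a member, and a tuple inside a member lies in
  the star of its first entry.\<close>

lemma locally_zero_iff:
  assumes "\<phi> \<in> carrier (AS_cochains X G m)"
  shows "\<phi> \<in> N_locally_zero X G m \<longleftrightarrow>
    (\<exists>\<beta>. normal_covering X \<beta> \<and> (\<forall>xs\<in>ordered_simplexes m (V \<beta>). \<phi> xs = \<one>))"
proof
  assume "\<phi> \<in> N_locally_zero X G m"
  then obtain \<alpha> where \<alpha>: "normal_covering X \<alpha>" "\<forall>xs\<in>(\<Union>U\<in>\<alpha>. tuples m U). \<phi> xs = \<one>"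
    by (auto simp: N_locally_zero_def)
  obtain \<beta> where \<beta>: "normal_covering X \<beta>" "point_star_refinement X \<beta> \<alpha>"
    using normal_covering_point_star_refinement[OF \<alpha>(1)] .
  have "\<phi> xs = \<one>" if xs: "xs \<in> ordered_simplexes m (V \<beta>)" for xs
  proof -
    obtain z where "z \<in> topspace X" "set xs \<subseteq> star \<beta> z" "length xs = Suc m"
      using xs by (auto simp: ordered_simplexes_def vietoris_def)
    moreover from this obtain U where "U \<in> \<alpha>" "star \<beta> z \<subseteq> U"
      using \<beta>(2) by (auto simp: point_star_refinement_def)
    ultimately show ?thesis using \<alpha>(2) by (auto simp: tuples_def)
  qed
  with \<beta>(1) show "\<exists>\<beta>. normal_covering X \<beta> \<and> (\<forall>xs\<in>ordered_simplexes m (V \<beta>). \<phi> xs = \<one>)" by blast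
next
  assume "\<exists>\<beta>. normal_covering X \<beta> \<and> (\<forall>xs\<in>ordered_simplexes m (V \<beta>). \<phi> xs = \<one>)"
  then obtain \<beta> where \<beta>: "normal_covering X \<beta>" "\<forall>xs\<in>ordered_simplexes m (V \<beta>). \<phi> xs = \<one>" by blast
  have "\<phi> xs = \<one>" if "xs \<in> (\<Union>U\<in>\<beta>. tuples m U)" for xs
  proof -
    obtain U where U: "U \<in> \<beta>" "set xs \<subseteq> U" "length xs = Suc m" using \<open>xs \<in> _\<close> by (auto simp: tuples_def)
    then have hd: "hd xs \<in> U" and "xs \<noteq> []" by (cases xs; simp)+
    have "set xs \<subseteq> star \<beta> (hd xs)" "hd xs \<in> topspace X"
      using U hd normal_covering_subset_topspace[OF \<beta>(1) U(1)] by (auto simp: star_def)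
    then show ?thesis using \<beta>(2) U(3) \<open>xs \<noteq> []\<close> by (auto simp: ordered_simplexes_def vietoris_def)
  qed
  then show "\<phi> \<in> N_locally_zero X G m" using assms \<beta>(1) by (auto simp: N_locally_zero_def)
qed

text \<open>The only place where the \<open>P\<close>-embedding of \<open>A\<close> is needed.\<close>

lemma restriction_locally_zero_iff:
  assumes "\<phi> \<in> carrier (AS_cochains X G m)"
  shows "restriction m \<phi> \<in> N_locally_zero (subtopology X A) G m \<longleftrightarrow>
    (\<exists>\<beta>. normal_covering X \<beta> \<and> (\<forall>xs\<in>ordered_simplexes m (VA \<beta>). \<phi> xs = \<one>))"
proof
  assume "restriction m \<phi> \<in> N_locally_zero (subtopology X A) G m"
  then obtain \<alpha> where \<alpha>: "normal_covering (subtopology X A) \<alpha>" "\<forall>xs\<in>(\<Union>U\<in>\<alpha>. tuples m U). restriction m \<phi> xs = \<one>"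
    by (auto simp: N_locally_zero_def)
  obtain \<gamma> where \<gamma>: "normal_covering X \<gamma>" "refinement_of (restrict_covering \<gamma> A) \<alpha>"
    using closed_P_pair \<alpha>(1) by (auto simp: closed_P_pair_def P_embedded_def)
  obtain \<beta> where \<beta>: "normal_covering X \<beta>" "point_star_refinement X \<beta> \<gamma>"
    using normal_covering_point_star_refinement[OF \<gamma>(1)] .
  have "\<phi> xs = \<one>" if xs: "xs \<in> ordered_simplexes m (VA \<beta>)" for xs
  proof -
    obtain z where z: "z \<in> topspace X" "set xs \<subseteq> star \<beta> z" "set xs \<subseteq> A" "length xs = Suc m"
      using xs by (auto simp: ordered_simplexes_def vietoris_def)
    \<comment> \<open>The centre z may lie outside \<open>A\<close>, so the star is enclosed in a
      member W of a covering of the whole space; only then is W cut down to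
      \<open>A\<close>.\<close>
    obtain W where W: "W \<in> \<gamma>" "star \<beta> z \<subseteq> W"
      using \<beta>(2) z(1) by (auto simp: point_star_refinement_def)
    obtain U where "U \<in> \<alpha>" "W \<inter> A \<subseteq> U"
      using \<gamma>(2) W(1) by (auto simp: refinement_of_def restrict_covering_def)
    moreover from this have "xs \<in> tuples m U" using z W(2) by (auto simp: tuples_def)
    ultimately have "restriction m \<phi> xs = \<one>" using \<alpha>(2) by blast
    then show ?thesis using z by (simp add: tuples_def)
  qed
  with \<beta>(1) show "\<exists>\<beta>. normal_covering X \<beta> \<and> (\<forall>xs\<in>ordered_simplexes m (VA \<beta>). \<phi> xs = \<one>)" by blast
next
  assume "\<exists>\<beta>. normal_covering X \<beta> \<and> (\<forall>xs\<in>ordered_simplexes m (VA \<beta>). \<phi> xs = \<one>)"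
  then obtain \<beta> where \<beta>: "normal_covering X \<beta>" "\<forall>xs\<in>ordered_simplexes m (VA \<beta>). \<phi> xs = \<one>" by blast
  have "restriction m \<phi> xs = \<one>" if "xs \<in> (\<Union>U\<in>restrict_covering \<beta> A. tuples m U)" for xs
  proof -
    obtain U where U: "U \<in> \<beta>" "set xs \<subseteq> U" "set xs \<subseteq> A" "length xs = Suc m"
      using \<open>xs \<in> _\<close> by (auto simp: tuples_def restrict_covering_def)
    then have hd: "hd xs \<in> U" and "xs \<noteq> []" by (cases xs; simp)+
    have "set xs \<subseteq> star \<beta> (hd xs)" "hd xs \<in> topspace X"
      using U hd normal_covering_subset_topspace[OF \<beta>(1) U(1)] by (auto simp: star_def)
    then have "\<phi> xs = \<one>" using \<beta>(2) U(3,4) \<open>xs \<noteq> []\<close> by (auto simp: ordered_simplexes_def vietoris_def)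
    then show ?thesis using U(3,4) by (simp add: tuples_def)
  qed
  moreover have "restriction m \<phi> \<in> carrier (AS_cochains (subtopology X A) G m)"
    using restriction_hom assms by (auto simp: hom_def)
  ultimately show "restriction m \<phi> \<in> N_locally_zero (subtopology X A) G m"
    using normal_covering_restrict[OF \<beta>(1) A_subset] unfolding N_locally_zero_def by blast
qed

lemma restriction_N_locally_zero: "restriction m ` N_locally_zero X G m \<subseteq> N_locally_zero (subtopology X A) G m"
proof
  fix b assume "b \<in> restriction m ` N_locally_zero X G m"
  then obtain a where b: "b = restriction m a" and a: "a \<in> N_locally_zero X G m" by blast
  have ac: "a \<in> carrier (AS_cochains X G m)" using a by (simp add: N_locally_zero_def)
  obtain \<beta> where \<beta>: "normal_covering X \<beta>" "\<forall>xs\<in>ordered_simplexes m (V \<beta>). a xs = \<one>"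
    using a unfolding locally_zero_iff[OF ac] by blast
  have "VA \<beta> \<subseteq> V \<beta>" using vietoris_simplicial_pair[of X \<beta> A] by (simp add: simplicial_pair_def)
  with \<beta> show "b \<in> N_locally_zero (subtopology X A) G m"
    unfolding b restriction_locally_zero_iff[OF ac] using ordered_simplexes_mono by blast
qed

lemma ASN_restriction_class:
  assumes "a \<in> carrier (AS_cochains X G m)"
  shows "ASN_restriction X A G m (ASN_class X m a) = ASN_class (subtopology X A) m (restriction m a)"
  unfolding ASN_restriction_def ASN_class_def topspace_A
  by (rule induced_on_cosets_r_coset[OF cochain_complex.group[OF AS_cochains_complex]
      cochain_complex.group[OF AS_cochains_complex] restriction_hom
      N_locally_zero_subgroup N_locally_zero_subgroup restriction_N_locally_zero assms])

lemma restriction_closed: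
  "a \<in> carrier (AS_cochains X G m) \<Longrightarrow> restriction m a \<in> carrier (AS_cochains (subtopology X A) G m)"
  using restriction_hom by (auto simp: hom_def)

lemma ASN_restriction_hom: "ASN_restriction X A G m \<in> hom (ASN_cochains X G m) (ASN_cochains (subtopology X A) G m)"
proof (rule homI)
  fix c assume "c \<in> carrier (ASN_cochains X G m)"
  then obtain a where a: "a \<in> carrier (AS_cochains X G m)" and c: "c = ASN_class X m a"
    unfolding carrier_ASN_cochains by blast
  show "ASN_restriction X A G m c \<in> carrier (ASN_cochains (subtopology X A) G m)"
    unfolding c ASN_restriction_class[OF a] carrier_ASN_cochains by (rule imageI[OF restriction_closed[OF a]])
  fix e assume "e \<in> carrier (ASN_cochains X G m)"
  then obtain b where b: "b \<in> carrier (AS_cochains X G m)" and e: "e = ASN_class X m b"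
    unfolding carrier_ASN_cochains by blast
  have ab: "a \<otimes>\<^bsub>AS_cochains X G m\<^esub> b \<in> carrier (AS_cochains X G m)"
    by (rule monoid.m_closed[OF group.is_monoid[OF cochain_complex.group[OF AS_cochains_complex]] a b])
  show "ASN_restriction X A G m (c \<otimes>\<^bsub>ASN_cochains X G m\<^esub> e) =
      ASN_restriction X A G m c \<otimes>\<^bsub>ASN_cochains (subtopology X A) G m\<^esub> ASN_restriction X A G m e"
    unfolding c e ASN_class_mult[OF a b] ASN_restriction_class[OF ab] ASN_restriction_class[OF a]
      ASN_restriction_class[OF b] ASN_class_mult[OF restriction_closed[OF a] restriction_closed[OF b]]
      hom_mult[OF restriction_hom a b] ..
qed

lemma ASN_restriction_group_hom:
  "group_hom (ASN_cochains X G m) (ASN_cochains (subtopology X A) G m) (ASN_restriction X A G m)"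
  by (simp add: group_hom_def group_hom_axioms_def ASN_restriction_hom comm_group.axioms(2)[OF ASN_cochains_comm_group])

text \<open>The functions representing elements of the kernel of restriction: on \<open>A\<close>
  they are locally zero, not necessarily zero.\<close>

definition relative_cochains :: "nat \<Rightarrow> ('a list \<Rightarrow> 'g) set" where
  "relative_cochains m = {\<phi> \<in> carrier (AS_cochains X G m).
     restriction m \<phi> \<in> N_locally_zero (subtopology X A) G m}"

lemma carrier_ASN_relative_cochains: "carrier (ASN_relative_cochains X A G m) = ASN_class X m ` relative_cochains m"
proof -
  have "ASN_restriction X A G m (ASN_class X m a) = \<one>\<^bsub>ASN_cochains (subtopology X A) G m\<^esub> \<longleftrightarrow>
      restriction m a \<in> N_locally_zero (subtopology X A) G m" if "a \<in> carrier (AS_cochains X G m)" for a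
    unfolding ASN_restriction_class[OF that] by (rule ASN_class_eq_one_iff[OF restriction_closed[OF that]])
  then show ?thesis
    by (auto simp: ASN_relative_cochains_def kernel_def carrier_ASN_cochains relative_cochains_def)
qed

lemma relative_cochains_carrier: "a \<in> relative_cochains m \<Longrightarrow> a \<in> carrier (AS_cochains X G m)"
  by (simp add: relative_cochains_def)

lemma mult_ASN_relative_cochains:
  assumes "a \<in> relative_cochains m" "b \<in> relative_cochains m"
  shows "ASN_class X m a \<otimes>\<^bsub>ASN_relative_cochains X A G m\<^esub> ASN_class X m b =
    ASN_class X m (a \<otimes>\<^bsub>AS_cochains X G m\<^esub> b)"
  using ASN_class_mult[of a X m b] assms by (simp add: ASN_relative_cochains_def relative_cochains_def)

lemma one_ASN_relative_cochains: "\<one>\<^bsub>ASN_relative_cochains X A G m\<^esub> = \<one>\<^bsub>ASN_cochains X G m\<^esub>"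
  by (simp add: ASN_relative_cochains_def)

lemma AS_coboundary_closed:
  "a \<in> carrier (AS_cochains X G m) \<Longrightarrow> AS_coboundary X G m a \<in> carrier (AS_cochains X G (Suc m))"
  using cochain_complex.hom[OF AS_cochains_complex[of X], of m] by (auto simp: hom_def)

lemma relative_cochains_coboundary:
  assumes "a \<in> relative_cochains m"
  shows "AS_coboundary X G m a \<in> relative_cochains (Suc m)"
proof -
  have a: "a \<in> carrier (AS_cochains X G m)" using assms by (simp add: relative_cochains_def)
  obtain \<beta> where \<beta>: "normal_covering X \<beta>" "\<forall>xs\<in>ordered_simplexes m (VA \<beta>). a xs = \<one>"
    using assms restriction_locally_zero_iff[OF a] by (auto simp: relative_cochains_def)
  have sp: "simplicial_pair (V \<beta>) (VA \<beta>)" by (rule vietoris_simplicial_pair)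
  have "AS_coboundary X G m a xs = \<one>" if xs: "xs \<in> ordered_simplexes (Suc m) (VA \<beta>)" for xs
  proof -
    have "face i xs \<in> ordered_simplexes m (VA \<beta>)" if "i < length xs" for i
      using face_ordered_simplex[OF xs that] sp by (simp add: simplicial_pair_def)
    then have "alternating_sum G a xs = \<one>" using \<beta>(2) by (intro alternating_sum_one) auto
    moreover have "xs \<in> ordered_simplexes (Suc m) (V \<beta>)"
      using xs sp ordered_simplexes_mono[of "VA \<beta>" "V \<beta>" "Suc m"] by (auto simp: simplicial_pair_def)
    then have "xs \<in> tuples (Suc m) (topspace X)" by (rule V_tuples[OF \<beta>(1)])
    ultimately show ?thesis by (simp add: AS_coboundary_apply)
  qed
  then show ?thesis
    using AS_coboundary_closed[OF a] restriction_locally_zero_iff[OF AS_coboundary_closed[OF a]] \<beta>(1)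
    by (auto simp: relative_cochains_def)
qed

lemma ASN_relative_complex: "cochain_complex (ASN_relative_cochains X A G) (ASN_coboundary X G)"
proof (rule cochain_complex.intro)
  fix m
  have sub: "subgroup (kernel (ASN_cochains X G m) (ASN_cochains (subtopology X A) G m) (ASN_restriction X A G m))
      (ASN_cochains X G m)" for m
    by (rule group_hom.subgroup_kernel[OF ASN_restriction_group_hom])
  show comm: "comm_group (ASN_relative_cochains X A G m)" for m
    unfolding ASN_relative_cochains_def by (rule comm_group.subgroup_comm_group[OF ASN_cochains_comm_group sub])
  have closed: "a \<otimes>\<^bsub>AS_cochains X G m\<^esub> b \<in> carrier (AS_cochains X G m)"
    if "a \<in> relative_cochains m" "b \<in> relative_cochains m" for a b
    using that by (intro monoid.m_closed[OF group.is_monoid[OF cochain_complex.group[OF AS_cochains_complex]]])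
      (auto simp: relative_cochains_def)
  show "ASN_coboundary X G m \<in> hom (ASN_relative_cochains X A G m) (ASN_relative_cochains X A G (Suc m))"
  proof (rule homI)
    fix c assume "c \<in> carrier (ASN_relative_cochains X A G m)"
    then obtain a where a: "a \<in> relative_cochains m" and c: "c = ASN_class X m a"
      unfolding carrier_ASN_relative_cochains by blast
    note ac = relative_cochains_carrier[OF a]
    show "ASN_coboundary X G m c \<in> carrier (ASN_relative_cochains X A G (Suc m))"
      unfolding c ASN_coboundary_class[OF ac] carrier_ASN_relative_cochains
      by (rule imageI[OF relative_cochains_coboundary[OF a]])
    fix e assume "e \<in> carrier (ASN_relative_cochains X A G m)"
    then obtain b where b: "b \<in> relative_cochains m" and e: "e = ASN_class X m b"
      unfolding carrier_ASN_relative_cochains by blast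
    note bc = relative_cochains_carrier[OF b]
    show "ASN_coboundary X G m (c \<otimes>\<^bsub>ASN_relative_cochains X A G m\<^esub> e) =
        ASN_coboundary X G m c \<otimes>\<^bsub>ASN_relative_cochains X A G (Suc m)\<^esub> ASN_coboundary X G m e"
      unfolding c e mult_ASN_relative_cochains[OF a b] ASN_coboundary_class[OF closed[OF a b]]
        ASN_coboundary_class[OF ac] ASN_coboundary_class[OF bc]
        mult_ASN_relative_cochains[OF relative_cochains_coboundary[OF a] relative_cochains_coboundary[OF b]]
        hom_mult[OF cochain_complex.hom[OF AS_cochains_complex] ac bc] ..
  qed
  fix c assume "c \<in> carrier (ASN_relative_cochains X A G m)"
  then obtain a where a: "a \<in> relative_cochains m" and c: "c = ASN_class X m a"
    unfolding carrier_ASN_relative_cochains by blast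
  note ac = relative_cochains_carrier[OF a]
  have "AS_coboundary X G (Suc m) (AS_coboundary X G m a) \<in> N_locally_zero X G (Suc (Suc m))"
    unfolding cochain_complex.square_zero[OF AS_cochains_complex ac]
    by (rule subgroup.one_closed[OF N_locally_zero_subgroup])
  then show "ASN_coboundary X G (Suc m) (ASN_coboundary X G m c) = \<one>\<^bsub>ASN_relative_cochains X A G (Suc (Suc m))\<^esub>"
    unfolding c ASN_coboundary_class[OF ac] ASN_coboundary_class[OF AS_coboundary_closed[OF ac]]
      one_ASN_relative_cochains ASN_class_eq_one_iff[OF AS_coboundary_closed[OF AS_coboundary_closed[OF ac]]] .
qed

section \<open>Comparison of cocycles and coboundaries\<close>

text \<open>The inclusion of the Vietoris complex into the full complex on the points is simplicial.
  The empty subcomplex is used on both sides because \<open>\<phi>\<close> may be nontrivial on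
  tuples in \<open>A\<close>.\<close>

lemma localize_coboundary:
  assumes "normal_covering X \<beta>" "\<phi> \<in> carrier (AS_cochains X G m)"
  shows "simplicial_coboundary (V \<beta>) G m (localize \<beta> m \<phi>) = localize \<beta> (Suc m) (AS_coboundary X G m \<phi>)"
proof -
  have K': "simplicial_pair (V \<beta>) {}" using vietoris_simplicial_pair[of X \<beta> A] by (simp add: simplicial_pair_def)
  have p: "simplicial_pair_map id (V \<beta>) {} (finite_subsets (topspace X)) {}"
    using star_subset_topspace[OF assms(1)] by (auto simp: simplicial_pair_map_def finite_subsets_def vietoris_def)
  from assms(2) show ?thesis unfolding AS_cochains_eq AS_coboundary_eq
    by (rule pullback_coboundary[OF finite_subsets_simplicial_pair K' p])
qed

lemma localize_carrier_iff:
  assumes "normal_covering X \<beta>" "\<phi> \<in> carrier (AS_cochains X G m)"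
  shows "localize \<beta> m \<phi> \<in> carrier (VC \<beta> m) \<longleftrightarrow>
    (\<forall>xs\<in>ordered_simplexes m (VA \<beta>). \<phi> xs = \<one>)"
proof -
  have "ordered_simplexes m (VA \<beta>) \<subseteq> ordered_simplexes m (V \<beta>)"
    using vietoris_simplicial_pair[of X \<beta> A] by (simp add: simplicial_pair_def ordered_simplexes_mono)
  moreover have "\<phi> xs \<in> carrier G" if "xs \<in> ordered_simplexes m (V \<beta>)" for xs
    using V_tuples[OF assms(1) that] assms(2) by (auto simp: carrier_AS_cochains)
  ultimately show ?thesis
    by (auto simp: carrier_simplicial_relative_cochains pullback_def subset_iff)
qed

lemma germ_cocycle_iff:
  assumes "\<phi> \<in> carrier (AS_cochains X G n)"
  shows "germ_cocycle \<beta> \<phi> \<longleftrightarrow> normal_covering X \<beta> \<and> (\<forall>xs\<in>ordered_simplexes n (VA \<beta>). \<phi> xs = \<one>) \<and>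
    (\<forall>xs\<in>ordered_simplexes (Suc n) (V \<beta>). AS_coboundary X G n \<phi> xs = \<one>)"
proof (cases "normal_covering X \<beta>")
  case True
  have "localize \<beta> (Suc n) (AS_coboundary X G n \<phi>) = \<one>\<^bsub>VC \<beta> (Suc n)\<^esub> \<longleftrightarrow>
      (\<forall>xs\<in>ordered_simplexes (Suc n) (V \<beta>). AS_coboundary X G n \<phi> xs = \<one>)"
    by (auto simp: one_simplicial_relative_cochains pullback_def restrict_def fun_eq_iff)
  then show ?thesis
    using True by (simp add: germ_cocycle_def cocycles_def kernel_def localize_carrier_iff[OF True assms]
        localize_coboundary[OF True assms])
qed (simp add: germ_cocycle_def)

text \<open>Vanishing on tuples in \<open>A\<close> and vanishing of the coboundary are witnessed by
  two unrelated coverings; a common refinement witnesses both, as Vietoris complexes shrink under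
  refinement.\<close>

lemma germ_cocycles_eq:
  "germ_cocycles = {\<phi> \<in> relative_cochains n. AS_coboundary X G n \<phi> \<in> N_locally_zero X G (Suc n)}"
proof (intro Set.set_eqI iffI)
  fix \<phi> assume "\<phi> \<in> germ_cocycles"
  then obtain \<beta> where \<phi>: "\<phi> \<in> carrier (AS_cochains X G n)" and \<beta>: "germ_cocycle \<beta> \<phi>" by (auto simp: germ_cocycles_def)
  then show "\<phi> \<in> {\<phi> \<in> relative_cochains n. AS_coboundary X G n \<phi> \<in> N_locally_zero X G (Suc n)}"
    using germ_cocycle_iff[OF \<phi>, of \<beta>]
    by (auto simp: relative_cochains_def restriction_locally_zero_iff locally_zero_iff AS_coboundary_closed)
next
  fix \<phi> assume a: "\<phi> \<in> {\<phi> \<in> relative_cochains n. AS_coboundary X G n \<phi> \<in> N_locally_zero X G (Suc n)}"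
  then have \<phi>: "\<phi> \<in> carrier (AS_cochains X G n)" by (simp add: relative_cochains_def)
  obtain \<alpha> where \<alpha>: "normal_covering X \<alpha>" "\<forall>xs\<in>ordered_simplexes n (VA \<alpha>). \<phi> xs = \<one>"
    using a restriction_locally_zero_iff[OF \<phi>] by (auto simp: relative_cochains_def)
  obtain \<beta> where \<beta>: "normal_covering X \<beta>" "\<forall>xs\<in>ordered_simplexes (Suc n) (V \<beta>). AS_coboundary X G n \<phi> xs = \<one>"
    using a locally_zero_iff[OF AS_coboundary_closed[OF \<phi>]] by auto
  obtain \<gamma> where \<gamma>: "normal_covering X \<gamma>" "refinement_of \<gamma> \<alpha>" "refinement_of \<gamma> \<beta>"
    using normal_covering_common_refinement[OF \<alpha>(1) \<beta>(1)] .
  have "germ_cocycle \<gamma> \<phi>"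
    unfolding germ_cocycle_iff[OF \<phi>]
    using \<alpha>(2) \<beta>(2) \<gamma>(1) ordered_simplexes_mono[OF vietoris_mono[OF \<gamma>(2), of X A], of n]
      ordered_simplexes_mono[OF vietoris_mono[OF \<gamma>(3), of X UNIV], of "Suc n"] by (auto simp: subset_iff)
  then show "\<phi> \<in> germ_cocycles" using \<phi> by (auto simp: germ_cocycles_def)
qed

lemma localize_mult_inv_apply:
  assumes "normal_covering X \<beta>" "xs \<in> ordered_simplexes m (V \<beta>)" "b \<in> carrier (AS_cochains X G m)"
  shows "(a \<otimes>\<^bsub>AS_cochains X G m\<^esub> inv\<^bsub>AS_cochains X G m\<^esub> b) xs = a xs \<otimes> inv (b xs)"
  using V_tuples[OF assms(1,2)] by (simp add: mult_AS_cochains inv_AS_cochains_apply[OF assms(3)])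

text \<open>A primitive on a Vietoris complex extends to a function on all tuples; conversely a
  primitive modulo locally zero cochains becomes an exact one after localizing at a fine enough
  covering. Degree 0 is separate because no cochains precede it.\<close>

lemma germ_coboundary_iff:
  assumes \<phi>: "\<phi> \<in> carrier (AS_cochains X G n)"
  shows "germ_coboundary \<phi> \<longleftrightarrow> (case n of 0 \<Rightarrow> \<phi> \<in> N_locally_zero X G n
    | Suc m \<Rightarrow> \<exists>\<psi>\<in>relative_cochains m. \<phi> \<otimes>\<^bsub>AS_cochains X G n\<^esub> inv\<^bsub>AS_cochains X G n\<^esub> (AS_coboundary X G m \<psi>)
        \<in> N_locally_zero X G n)"
proof (cases n)
  case 0
  have "localize \<beta> n \<phi> = \<one>\<^bsub>VC \<beta> n\<^esub> \<longleftrightarrow>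
      (\<forall>xs\<in>ordered_simplexes n (V \<beta>). \<phi> xs = \<one>)" for \<beta>
    by (auto simp: one_simplicial_relative_cochains pullback_def restrict_def fun_eq_iff)
  moreover have "relative_coboundaries (V \<beta>) (VA \<beta>) n = {\<one>\<^bsub>VC \<beta> n\<^esub>}" for \<beta>
    using 0 by (simp add: coboundaries_def)
  ultimately have "germ_coboundary \<phi> \<longleftrightarrow> \<phi> \<in> N_locally_zero X G n"
    unfolding germ_coboundary_def locally_zero_iff[OF \<phi>] by simp
  then show ?thesis using 0 by simp
next
  case (Suc m)
  have cob: "relative_coboundaries (V \<beta>) (VA \<beta>) n =
      simplicial_coboundary (V \<beta>) G m ` carrier (VC \<beta> m)" for \<beta>
    using Suc by (simp add: coboundaries_def)
  have "germ_coboundary \<phi> \<longleftrightarrow> (\<exists>\<psi>\<in>relative_cochains m. \<phi> \<otimes>\<^bsub>AS_cochains X G n\<^esub>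
      inv\<^bsub>AS_cochains X G n\<^esub> (AS_coboundary X G m \<psi>) \<in> N_locally_zero X G n)"
  proof
    assume "germ_coboundary \<phi>"
    then obtain \<beta> b where \<beta>: "normal_covering X \<beta>"
      and b: "b \<in> carrier (VC \<beta> m)"
      and \<phi>b: "localize \<beta> n \<phi> = simplicial_coboundary (V \<beta>) G m b"
      unfolding germ_coboundary_def cob by blast
    \<comment> \<open>The value one outside the Vietoris complex is an arbitrary choice in the
      group: localizing at \<open>\<beta>\<close> gives back b, and every later condition is tested
      on tuples of that complex.\<close>
    define \<psi> where "\<psi> = (\<lambda>xs\<in>tuples m (topspace X). extend_by_one G (ordered_simplexes m (V \<beta>)) b xs)"
    have \<psi>: "\<psi> \<in> carrier (AS_cochains X G m)"
      using extend_by_one_closed[OF b] by (simp add: \<psi>_def carrier_AS_cochains)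
    have "b \<in> extensional (ordered_simplexes m (V \<beta>))"
      using b by (simp add: carrier_simplicial_relative_cochains PiE_def)
    then have loc: "localize \<beta> m \<psi> = b"
      using V_tuples[OF \<beta>, of _ m]
      by (intro extensionalityI[of _ "ordered_simplexes m (V \<beta>)"]) (auto simp: pullback_def \<psi>_def extend_by_one_def)
    have "\<forall>xs\<in>ordered_simplexes m (VA \<beta>). \<psi> xs = \<one>"
      using b unfolding loc[symmetric] localize_carrier_iff[OF \<beta> \<psi>] .
    then have rel: "\<psi> \<in> relative_cochains m"
      using \<psi> \<beta> restriction_locally_zero_iff[OF \<psi>] by (auto simp: relative_cochains_def)
    have \<delta>: "AS_coboundary X G m \<psi> \<in> carrier (AS_cochains X G n)" using AS_coboundary_closed[OF \<psi>] Suc by simp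
    have eq: "localize \<beta> n \<phi> = localize \<beta> n (AS_coboundary X G m \<psi>)"
      unfolding \<phi>b loc[symmetric] using localize_coboundary[OF \<beta> \<psi>] Suc by simp
    have "(\<phi> \<otimes>\<^bsub>AS_cochains X G n\<^esub> inv\<^bsub>AS_cochains X G n\<^esub> (AS_coboundary X G m \<psi>)) xs = \<one>"
      if xs: "xs \<in> ordered_simplexes n (V \<beta>)" for xs
    proof -
      have "\<phi> xs = AS_coboundary X G m \<psi> xs" using fun_cong[OF eq, of xs] xs by (simp add: localize_apply)
      moreover have "AS_coboundary X G m \<psi> xs \<in> carrier G"
        using \<delta> V_tuples[OF \<beta> xs] by (auto simp: carrier_AS_cochains)
      ultimately show ?thesis unfolding localize_mult_inv_apply[OF \<beta> xs \<delta>] by simp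
    qed
    moreover have "\<phi> \<otimes>\<^bsub>AS_cochains X G n\<^esub> inv\<^bsub>AS_cochains X G n\<^esub> (AS_coboundary X G m \<psi>) \<in> carrier (AS_cochains X G n)"
    proof -
      interpret C: group "AS_cochains X G n" by (rule cochain_complex.group[OF AS_cochains_complex])
      show ?thesis using \<phi> \<delta> by simp
    qed
    ultimately have "\<phi> \<otimes>\<^bsub>AS_cochains X G n\<^esub> inv\<^bsub>AS_cochains X G n\<^esub> (AS_coboundary X G m \<psi>) \<in> N_locally_zero X G n"
      using locally_zero_iff \<beta> by blast
    with rel show "\<exists>\<psi>\<in>relative_cochains m. \<phi> \<otimes>\<^bsub>AS_cochains X G n\<^esub>
      inv\<^bsub>AS_cochains X G n\<^esub> (AS_coboundary X G m \<psi>) \<in> N_locally_zero X G n" by blast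
  next
    assume "\<exists>\<psi>\<in>relative_cochains m. \<phi> \<otimes>\<^bsub>AS_cochains X G n\<^esub>
      inv\<^bsub>AS_cochains X G n\<^esub> (AS_coboundary X G m \<psi>) \<in> N_locally_zero X G n"
    then obtain \<psi> where rel: "\<psi> \<in> relative_cochains m"
      and nz: "\<phi> \<otimes>\<^bsub>AS_cochains X G n\<^esub> inv\<^bsub>AS_cochains X G n\<^esub> (AS_coboundary X G m \<psi>) \<in> N_locally_zero X G n"
      by blast
    have \<psi>: "\<psi> \<in> carrier (AS_cochains X G m)" by (rule relative_cochains_carrier[OF rel])
    have \<delta>: "AS_coboundary X G m \<psi> \<in> carrier (AS_cochains X G n)" using AS_coboundary_closed[OF \<psi>] Suc by simp
    obtain \<alpha> where \<alpha>: "normal_covering X \<alpha>" "\<forall>xs\<in>ordered_simplexes m (VA \<alpha>). \<psi> xs = \<one>"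
      using rel restriction_locally_zero_iff[OF \<psi>] by (auto simp: relative_cochains_def)
    have "\<phi> \<otimes>\<^bsub>AS_cochains X G n\<^esub> inv\<^bsub>AS_cochains X G n\<^esub> (AS_coboundary X G m \<psi>) \<in> carrier (AS_cochains X G n)"
      using nz by (simp add: N_locally_zero_def)
    from nz[unfolded locally_zero_iff[OF this]] obtain \<beta> where \<beta>: "normal_covering X \<beta>"
      "\<forall>xs\<in>ordered_simplexes n (V \<beta>).
        (\<phi> \<otimes>\<^bsub>AS_cochains X G n\<^esub> inv\<^bsub>AS_cochains X G n\<^esub> (AS_coboundary X G m \<psi>)) xs = \<one>" by blast
    obtain \<gamma> where \<gamma>: "normal_covering X \<gamma>" "refinement_of \<gamma> \<alpha>" "refinement_of \<gamma> \<beta>"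
      using normal_covering_common_refinement[OF \<alpha>(1) \<beta>(1)] .
    have "\<forall>xs\<in>ordered_simplexes m (VA \<gamma>). \<psi> xs = \<one>"
      using \<alpha>(2) ordered_simplexes_mono[OF vietoris_mono[OF \<gamma>(2), of X A], of m] by (auto simp: subset_iff)
    then have b: "localize \<gamma> m \<psi> \<in> carrier (VC \<gamma> m)"
      unfolding localize_carrier_iff[OF \<gamma>(1) \<psi>] .
    have "\<phi> xs = AS_coboundary X G m \<psi> xs" if xs: "xs \<in> ordered_simplexes n (V \<gamma>)" for xs
    proof -
      have "xs \<in> ordered_simplexes n (V \<beta>)"
        using xs ordered_simplexes_mono[OF vietoris_mono[OF \<gamma>(3), of X UNIV], of n] by (rule rev_subsetD)
      with \<beta>(2) have "\<phi> xs \<otimes> inv (AS_coboundary X G m \<psi> xs) = \<one>"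
        unfolding localize_mult_inv_apply[OF \<gamma>(1) xs \<delta>, symmetric] by blast
      moreover have "\<phi> xs \<in> carrier G" "AS_coboundary X G m \<psi> xs \<in> carrier G"
        using \<phi> \<delta> V_tuples[OF \<gamma>(1) xs] by (auto simp: carrier_AS_cochains)
      ultimately show ?thesis using inv_equality[of "\<phi> xs" "inv (AS_coboundary X G m \<psi> xs)"] by simp
    qed
    then have "localize \<gamma> n \<phi> = localize \<gamma> n (AS_coboundary X G m \<psi>)"
      by (auto simp: pullback_def intro!: restrict_ext)
    also have "\<dots> = simplicial_coboundary (V \<gamma>) G m (localize \<gamma> m \<psi>)"
      using localize_coboundary[OF \<gamma>(1) \<psi>] Suc by simp
    finally have "localize \<gamma> n \<phi> \<in> relative_coboundaries (V \<gamma>) (VA \<gamma>) n"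
      using b unfolding cob by (rule image_eqI)
    then show "germ_coboundary \<phi>" using \<gamma>(1) by (auto simp: germ_coboundary_def)
  qed
  then show ?thesis using Suc by simp
qed

definition AS_class :: "('a list \<Rightarrow> 'g) \<Rightarrow> ('a list \<Rightarrow> 'g) set set" where
  "AS_class \<phi> = cohomology_class (ASN_relative_cochains X A G) (ASN_coboundary X G) n (ASN_class X n \<phi>)"

lemma ASN_cocycles: "cocycles (ASN_relative_cochains X A G) (ASN_coboundary X G) n = ASN_class X n ` germ_cocycles"
proof -
  have "ASN_coboundary X G n (ASN_class X n a) = \<one>\<^bsub>ASN_relative_cochains X A G (Suc n)\<^esub> \<longleftrightarrow>
      AS_coboundary X G n a \<in> N_locally_zero X G (Suc n)" if "a \<in> relative_cochains n" for a
    unfolding ASN_coboundary_class[OF relative_cochains_carrier[OF that]] one_ASN_relative_cochains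
    by (rule ASN_class_eq_one_iff[OF AS_coboundary_closed[OF relative_cochains_carrier[OF that]]])
  then show ?thesis
    unfolding germ_cocycles_eq by (auto simp: cocycles_def kernel_def carrier_ASN_relative_cochains)
qed

lemma AS_class_surj: "AS_class ` germ_cocycles = carrier (alexander_spanier_normal_cohomology n X A G)"
  unfolding alexander_spanier_normal_cohomology_def
    cochain_complex.carrier_cohomology_group[OF ASN_relative_complex] ASN_cocycles
  by (simp add: image_image AS_class_def)

lemma AS_class_mult:
  assumes a: "a \<in> germ_cocycles" and b: "b \<in> germ_cocycles"
  shows "AS_class (a \<otimes>\<^bsub>AS_cochains X G n\<^esub> b) =
    AS_class a \<otimes>\<^bsub>alexander_spanier_normal_cohomology n X A G\<^esub> AS_class b"
proof -
  have z: "ASN_class X n c \<in> cocycles (ASN_relative_cochains X A G) (ASN_coboundary X G) n"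
    if "c \<in> germ_cocycles" for c using that unfolding ASN_cocycles by (rule imageI)
  have "a \<in> relative_cochains n" "b \<in> relative_cochains n" using a b by (auto simp: germ_cocycles_eq)
  then show ?thesis
    using cochain_complex.cohomology_class_mult[OF ASN_relative_complex z[OF a] z[OF b]]
    by (simp add: AS_class_def alexander_spanier_normal_cohomology_def mult_ASN_relative_cochains)
qed

lemma germ_cocycles_inv: "b \<in> germ_cocycles \<Longrightarrow> inv\<^bsub>AS_cochains X G n\<^esub> b \<in> germ_cocycles"
  using germ_cocycle_inv[of _ b] group.inv_closed[OF cochain_complex.group[OF AS_cochains_complex[of X], of n], of b]
  by (auto simp: germ_cocycles_def)

text \<open>In positive degree, a class is a coboundary when it equals the coboundary class of some
  relative cochain, that is, when their quotient is locally zero; this is the form given by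
  \<open>germ_coboundary_iff\<close>.\<close>

lemma ASN_coboundaries:
  assumes \<phi>: "\<phi> \<in> carrier (AS_cochains X G n)"
  shows "ASN_class X n \<phi> \<in> coboundaries (ASN_relative_cochains X A G) (ASN_coboundary X G) n \<longleftrightarrow> germ_coboundary \<phi>"
proof (cases n)
  case 0
  have "coboundaries (ASN_relative_cochains X A G) (ASN_coboundary X G) n = {\<one>\<^bsub>ASN_cochains X G n\<^esub>}"
    using 0 by (simp add: coboundaries_def one_ASN_relative_cochains)
  moreover have "germ_coboundary \<phi> \<longleftrightarrow> \<phi> \<in> N_locally_zero X G n"
    using germ_coboundary_iff[OF \<phi>] 0 by simp
  ultimately show ?thesis using ASN_class_eq_one_iff[OF \<phi>] by simp
next
  case (Suc m)
  have "ASN_class X n \<phi> = ASN_coboundary X G m (ASN_class X m \<psi>) \<longleftrightarrow>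
      \<phi> \<otimes>\<^bsub>AS_cochains X G n\<^esub> inv\<^bsub>AS_cochains X G n\<^esub> (AS_coboundary X G m \<psi>) \<in> N_locally_zero X G n"
    if "\<psi> \<in> relative_cochains m" for \<psi>
    using ASN_class_eq_iff[of \<phi> X n "AS_coboundary X G m \<psi>"] \<phi> Suc
      AS_coboundary_closed[OF relative_cochains_carrier[OF that]]
      ASN_coboundary_class[OF relative_cochains_carrier[OF that]] by simp
  moreover have "coboundaries (ASN_relative_cochains X A G) (ASN_coboundary X G) n =
      ASN_coboundary X G m ` ASN_class X m ` relative_cochains m"
    using Suc by (simp add: coboundaries_def carrier_ASN_relative_cochains)
  moreover have "germ_coboundary \<phi> \<longleftrightarrow> (\<exists>\<psi>\<in>relative_cochains m. \<phi> \<otimes>\<^bsub>AS_cochains X G n\<^esub>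
      inv\<^bsub>AS_cochains X G n\<^esub> (AS_coboundary X G m \<psi>) \<in> N_locally_zero X G n)"
    using germ_coboundary_iff[OF \<phi>] Suc by simp
  ultimately show ?thesis by (auto simp: image_iff)
qed

lemma AS_class_eq_iff:
  assumes a: "a \<in> germ_cocycles" and b: "b \<in> germ_cocycles"
  shows "AS_class a = AS_class b \<longleftrightarrow>
    germ_coboundary (a \<otimes>\<^bsub>AS_cochains X G n\<^esub> inv\<^bsub>AS_cochains X G n\<^esub> b)"
proof -
  let ?C = "ASN_relative_cochains X A G n"
  let ?b = "inv\<^bsub>AS_cochains X G n\<^esub> b"
  interpret C: group "AS_cochains X G n" by (rule cochain_complex.group[OF AS_cochains_complex])
  have z: "ASN_class X n c \<in> cocycles (ASN_relative_cochains X A G) (ASN_coboundary X G) n"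
    if "c \<in> germ_cocycles" for c using that unfolding ASN_cocycles by (rule imageI)
  have rel: "c \<in> relative_cochains n" if "c \<in> germ_cocycles" for c using that by (simp add: germ_cocycles_eq)
  have bc: "b \<in> carrier (AS_cochains X G n)" using relative_cochains_carrier[OF rel[OF b]] .
  have "inv\<^bsub>?C\<^esub> (ASN_class X n b) = ASN_class X n ?b"
  proof (rule group.inv_equality[OF cochain_complex.group[OF ASN_relative_complex]])
    have "ASN_class X n ?b \<otimes>\<^bsub>?C\<^esub> ASN_class X n b = ASN_class X n \<one>\<^bsub>AS_cochains X G n\<^esub>"
      using mult_ASN_relative_cochains[OF rel[OF germ_cocycles_inv[OF b]] rel[OF b]] bc by simp
    also have "\<dots> = \<one>\<^bsub>?C\<^esub>"
      unfolding one_ASN_relative_cochains ASN_class_eq_one_iff[OF C.one_closed]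
      by (rule subgroup.one_closed[OF N_locally_zero_subgroup])
    finally show "ASN_class X n ?b \<otimes>\<^bsub>?C\<^esub> ASN_class X n b = \<one>\<^bsub>?C\<^esub>" .
  qed (use b germ_cocycles_inv[OF b] rel in \<open>auto simp: carrier_ASN_relative_cochains\<close>)
  then have "AS_class a = AS_class b \<longleftrightarrow> ASN_class X n (a \<otimes>\<^bsub>AS_cochains X G n\<^esub> ?b) \<in>
      coboundaries (ASN_relative_cochains X A G) (ASN_coboundary X G) n"
    unfolding AS_class_def cochain_complex.cohomology_class_eq_iff[OF ASN_relative_complex z[OF a] z[OF b]]
    using mult_ASN_relative_cochains[OF rel[OF a] rel[OF germ_cocycles_inv[OF b]]] by simp
  also have "\<dots> \<longleftrightarrow> germ_coboundary (a \<otimes>\<^bsub>AS_cochains X G n\<^esub> ?b)"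
    using bc relative_cochains_carrier[OF rel[OF a]] by (intro ASN_coboundaries) simp
  finally show ?thesis .
qed

end

theorem corollary2:
  fixes X :: "'a topology" and A :: "'a set" and G :: "('g, 'm) monoid_scheme" and n :: nat
  assumes "closed_P_pair X A" and "comm_group G"
  shows "alexander_spanier_normal_cohomology n X A G \<cong> cech_normal_cohomology n X A G"
proof -
  interpret normal_P_pair G X A n
    using assms by (simp add: normal_P_pair_def coefficients_def normal_P_pair_axioms_def)
  show ?thesis
  proof (rule iso_by_common_representatives[where \<Psi> = AS_class and \<Phi> = cech_class and Z = germ_cocycles
        and m = "\<lambda>a b. a \<otimes>\<^bsub>AS_cochains X G n\<^esub> b"])
    \<comment> \<open>Each side holds exactly when the quotient of a by b satisfies
      \<open>germ_coboundary\<close>; this is where the two descriptions meet.\<close>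
    show "AS_class a = AS_class b \<longleftrightarrow> cech_class a = cech_class b"
      if "a \<in> germ_cocycles" "b \<in> germ_cocycles" for a b
      unfolding AS_class_eq_iff[OF that] cech_class_eq_iff[OF that] ..
  qed (rule AS_class_surj cech_class_surj germ_cocycles_mult AS_class_mult cech_class_mult; assumption)+
qed

end
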